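(* Let $0\le p\le1$ and $A\in\mathcal W_p(E)$ with representation $A=\sum_{j\in G}M_{b^{(j)}}V_j$. Let $(b^G,0)$ be the graph over $G$ with $$b^G(k,\ell):=2\Bigl(\frac{\|b^{(k-\ell)}\|_\infty+\|b^{(\ell-k)}\|_\infty}{2}\Bigr)^p\ (k\ne\ell),\qquad b^G(k,k):=0,$$ and assume that this graph has subexponential growth and is connected. Let $\varepsilon>0$ and let $(W_n)_{n\in\mathbb N}$ be a sequence of finite nonempty subsets of $G$ with $W_n\subseteq W_{n+1}$ for all $n\in\mathbb N$ and $\bigcup_{n\in\mathbb N}W_n=G$. For $k\in G$, $n\in\mathbb N$ let $P_{k,n}x:=\chi_{k+W_n}\cdot x$ and $A_{k,n}:=P_{k,n}AP_{k,n}$, acting on $\ell^2(k+W_n,Y)$. If the patches $(A_{k,n})_{k\in G,n\in\mathbb N}$ do not suffer from spectral pollution, that is, $$\forall\delta>0:\quad\limsup_{n\to\infty}\bigcup_{k\in G}\mathrm{Spec}_\delta A_{k,n}\ \subset\ \mathrm{Spec}_\delta A,$$ then the sets $$\bigcup_{k\in G}\mathrm{spec}_{\varepsilon+\varepsilon_p(W_n,A)}A_{k,n}\qquad\text{and}\qquad\operatorname{clos}\bigcup_{k\in G}\mathrm{Spec}_{\varepsilon+\varepsilon_p(W_n,A)}A_{k,n}$$ Hausdorff-converge to $\mathrm{Spec}_\varepsilon A$ as $n\to\infty$.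
   Context: $(G,+)$ is a countable Abelian group with neutral element $0$ and counting measure, $Y$ is a complex Hilbert space, $E:=\ell^2(G,Y)$. $M_b$ is multiplication by $b\in\ell^\infty(G,L(Y))$, $(M_bx)_i=b_ix_i$; $V_j$ is the shift $(V_jx)_i=x_{i-j}$. The Wiener algebra $\mathcal W(E)$ is the set of all $A=\sum_{j\in G}M_{b^{(j)}}V_j$ with $b^{(j)}\in\ell^\infty(G,L(Y))$ and $\sum_{j\in G}\|b^{(j)}\|_\infty<\infty$. For $0\le p\le1$, $\mathcal W_p(E):=\{A\in\mathcal W(E):\sum_{j\in G}\|b^{(j)}\|_\infty^p<\infty\}$. Convention: $a^0:=\lim_{p\to0^+}a^p$ for $a\ge0$, so $0^0=0$. For a bounded linear operator $B$ on $\ell^2(\mathbb I,Y)$, $\mathbb I\subset G$: $\nu(B):=\inf\{\|Bx\|:\|x\|=1\}$, $B^*$ is the Banach space adjoint, $\mu(B):=\min(\nu(B),\nu(B^* ))$, $\mathrm{spec}_\varepsilon B:=\{\lambda\in\mathbb C:\mu(B-\lambda I)<\varepsilon\}$ and $\mathrm{Spec}_\varepsilon B:=\{\lambda\in\mathbb C:\mu(B-\lambda I)\le\varepsilon\}$ for $\varepsilon>0$. Penalty term: with $\beta_j:=\frac{\|b^{(j)}\|_\infty+\|b^{(-j)}\|_\infty}{2}$ and finite $W\subset G$, $$\varepsilon_p(W,A):=\sqrt{\sum_{j\in G\setminus\{0\}}\beta_j^{2-p}}\ \sqrt{\min\operatorname{Spec}L_W^{(D)}},$$ where $L_W^{(D)}$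 is the non-negative self-adjoint operator on $\ell^2(W)$ given by $(L_W^{(D)}x)_k=\sum_{\ell\in W}b^W(k,\ell)(x_k-x_\ell)+c^W(k)x_k$ ($k\in W$), with $b^W(k,\ell):=2\beta_{k-\ell}^p$ for $k,\ell\in W$, $k\ne\ell$ (and $0$ otherwise) and $c^W(k):=2\sum_{j\in G\setminus\{0\},\,k-j\in G\setminus W}\beta_j^p$. Graph notions for $(b,0)$: $k\sim\ell$ iff $b(k,\ell)>0$; $d(k,\ell)$ is the combinatorial graph distance, i.e. the least $n\in\mathbb N_0$ such that there are $k=i_0\sim i_1\sim\dots\sim i_n=\ell$ ($\infty$ if there is none); the graph is connected if $d(k,\ell)<\infty$ for all $k,\ell$; $B(k,r):=\{\ell\in G:d(k,\ell)\le r\}$; the graph has subexponential growth if $\liminf_{r\to\infty}\inf_{k\in G}\frac1r\log\frac{\sharp B(k,r)}{\sharp B(k,1)}=0$. Set limits: $\limsup_{n\to\infty}S_n$ is the set of all partial limits (accumulation points) of sequences $(s_n)$ with $s_n\in S_n$. For bounded $S,T\subset\mathbb C$, $d_H(S,T):=\max(\sup_{s\in S}\operatorname{dist}(s,T),\sup_{t\in T}\operatorname{dist}(t,S))$; $S_n$ Hausdorff-converges to $S$ if $d_H(S_n,S)\to0$. *)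

theory Defs
  imports "HOL-Analysis.Analysis"
begin

section \<open>Complex Hilbert spaces\<close>

class complex_normed_space = real_normed_vector +
  fixes scaleC :: "complex \<Rightarrow> 'a \<Rightarrow> 'a"  (infixr "*\<^sub>C" 75)
  assumes scaleC_add_right: "a *\<^sub>C (x + y) = a *\<^sub>C x + a *\<^sub>C y"
    and scaleC_add_left: "(a + b) *\<^sub>C x = a *\<^sub>C x + b *\<^sub>C x"
    and scaleC_scaleC: "a *\<^sub>C b *\<^sub>C x = (a * b) *\<^sub>C x"
    and scaleR_scaleC: "r *\<^sub>R x = complex_of_real r *\<^sub>C x"
    and norm_scaleC: "norm (a *\<^sub>C x) = cmod a * norm x"

class complex_hilbert_space = complex_normed_space + complete_space +
  fixes cinner :: "'a \<Rightarrow> 'a \<Rightarrow> complex"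
  assumes cinner_commute: "cinner x y = cnj (cinner y x)"
    and cinner_add_left: "cinner (x + y) z = cinner x z + cinner y z"
    and cinner_scaleC_left: "cinner (a *\<^sub>C x) y = a * cinner x y"
    and cinner_self: "cinner x x = complex_of_real ((norm x)\<^sup>2)"

instantiation complex :: complex_hilbert_space
begin

definition "a *\<^sub>C x = a * (x::complex)"

definition "cinner x y = x * cnj (y::complex)"

instance
proof
  fix a b x y z :: complex and r :: real
  show "a *\<^sub>C (x + y) = a *\<^sub>C x + a *\<^sub>C y" "(a + b) *\<^sub>C x = a *\<^sub>C x + b *\<^sub>C x"
    "a *\<^sub>C b *\<^sub>C x = (a * b) *\<^sub>C x"
    by (simp_all add: scaleC_complex_def distrib_left distrib_right mult.assoc)
  show "r *\<^sub>R x = complex_of_real r *\<^sub>C x"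
    by (simp add: scaleC_complex_def scaleR_conv_of_real)
  show "norm (a *\<^sub>C x) = cmod a * norm x"
    by (simp add: scaleC_complex_def norm_mult)
  show "cinner x y = cnj (cinner y x)" "cinner (a *\<^sub>C x) y = a * cinner x y"
    by (simp_all add: scaleC_complex_def cinner_complex_def)
  show "cinner (x + y) z = cinner x z + cinner y z"
    by (simp add: cinner_complex_def distrib_right)
  show "cinner x x = complex_of_real ((norm x)\<^sup>2)"
    unfolding cinner_complex_def by (rule complex_norm_square[symmetric])
qed

end

section \<open>The space \<open>\<ell>\<^sup>2(G, Y)\<close>\<close>

definition square_summable :: "('g \<Rightarrow> 'y::real_normed_vector) \<Rightarrow> bool" where
  "square_summable x \<longleftrightarrow> (\<lambda>i. (norm (x i))\<^sup>2) summable_on UNIV"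

definition l2norm :: "('g \<Rightarrow> 'y::real_normed_vector) \<Rightarrow> real" where
  "l2norm x = sqrt (\<Sum>\<^sub>\<infinity>i. (norm (x i))\<^sup>2)"

lemma L2_set_le_l2norm:
  assumes "square_summable x" "finite F"
  shows "L2_set (\<lambda>i. norm (x i)) F \<le> l2norm x"
  unfolding L2_set_def l2norm_def
  using assms by (auto simp: square_summable_def intro!: finite_sum_le_infsum)

lemma l2norm_nonneg: "0 \<le> l2norm x"
  by (simp add: l2norm_def infsum_nonneg)

lemma square_summable_bound:
  assumes "\<And>F. finite F \<Longrightarrow> L2_set (\<lambda>i. norm (x i)) F \<le> C"
  shows "square_summable x" and "l2norm x \<le> C"
proof -
  have C: "0 \<le> C" using assms[of "{}"] by simp
  have le: "(\<Sum>i\<in>F. (norm (x i))\<^sup>2) \<le> C\<^sup>2" if "finite F" for F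
    using power_mono[OF assms[OF that], of 2] by (simp add: L2_set_def sum_nonneg)
  have s: "(\<lambda>i. (norm (x i))\<^sup>2) summable_on UNIV"
    by (rule nonneg_bdd_above_summable_on) (auto simp: bdd_above_def intro!: le)
  then show "square_summable x" by (simp add: square_summable_def)
  show "l2norm x \<le> C"
    unfolding l2norm_def
    by (rule real_le_lsqrt) (use C s le in \<open>auto intro!: infsum_le_finite_sums\<close>)
qed

lemma square_summable_zero: "square_summable (\<lambda>_. 0)"
  by (simp add: square_summable_def)

lemma square_summable_add:
  assumes "square_summable x" "square_summable y"
  shows "square_summable (\<lambda>i. x i + y i)" "l2norm (\<lambda>i. x i + y i) \<le> l2norm x + l2norm y"
proof -
  have *: "L2_set (\<lambda>i. norm (x i + y i)) F \<le> l2norm x + l2norm y" if "finite F" for F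
  proof -
    have "L2_set (\<lambda>i. norm (x i + y i)) F \<le> L2_set (\<lambda>i. norm (x i) + norm (y i)) F"
      by (rule L2_set_mono) (auto simp: norm_triangle_ineq)
    also have "\<dots> \<le> L2_set (\<lambda>i. norm (x i)) F + L2_set (\<lambda>i. norm (y i)) F"
      by (rule L2_set_triangle_ineq)
    also have "\<dots> \<le> l2norm x + l2norm y"
      using L2_set_le_l2norm assms that by (intro add_mono) auto
    finally show ?thesis .
  qed
  show "square_summable (\<lambda>i. x i + y i)" "l2norm (\<lambda>i. x i + y i) \<le> l2norm x + l2norm y"
    by (rule square_summable_bound[OF *]; assumption)+
qed

lemma square_summable_dominated:
  assumes "square_summable x" "0 \<le> C" "\<And>i. norm (y i) \<le> C * norm (x i)"
  shows "square_summable y" "l2norm y \<le> C * l2norm x"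
proof -
  have *: "L2_set (\<lambda>i. norm (y i)) F \<le> C * l2norm x" if "finite F" for F
  proof -
    have "L2_set (\<lambda>i. norm (y i)) F \<le> L2_set (\<lambda>i. C * norm (x i)) F"
      by (rule L2_set_mono) (auto simp: assms)
    also have "\<dots> = C * L2_set (\<lambda>i. norm (x i)) F"
      using assms(2) by (simp add: L2_set_right_distrib)
    also have "\<dots> \<le> C * l2norm x"
      using L2_set_le_l2norm assms that by (intro mult_left_mono) auto
    finally show ?thesis .
  qed
  show "square_summable y" "l2norm y \<le> C * l2norm x"
    by (rule square_summable_bound[OF *]; assumption)+
qed

lemma square_summable_finite_support:
  assumes "finite W" "\<And>i. i \<notin> W \<Longrightarrow> x i = 0"
  shows "square_summable x"
proof -
  have "(\<lambda>i. (norm (x i))\<^sup>2) summable_on W \<longleftrightarrow>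
      (\<lambda>i. (norm (x i))\<^sup>2) summable_on UNIV"
    by (rule summable_on_cong_neutral) (auto simp: assms(2))
  then show ?thesis
    using assms(1) by (simp add: square_summable_def)
qed

lemma square_summable_translate:
  fixes x :: "'g::ab_group_add \<Rightarrow> 'y::real_normed_vector"
  shows "square_summable x \<Longrightarrow> square_summable (\<lambda>i. x (i - j))"
    and "l2norm (\<lambda>i. x (i - j)) = l2norm x"
proof -
  have bij: "bij_betw (\<lambda>i. i - j) UNIV UNIV"
    by (rule bij_betwI[where g = "\<lambda>i. i + j"]) auto
  show "square_summable x \<Longrightarrow> square_summable (\<lambda>i. x (i - j))"
    unfolding square_summable_def
    using summable_on_reindex_bij_betw[OF bij, of "\<lambda>i. (norm (x i))\<^sup>2"] by simp
  show "l2norm (\<lambda>i. x (i - j)) = l2norm x"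
    unfolding l2norm_def
    using infsum_reindex_bij_betw[OF bij, of "\<lambda>i. (norm (x i))\<^sup>2"] by simp
qed

typedef (overloaded) ('g, 'y) ell2 = "{x :: 'g \<Rightarrow> 'y::complex_normed_space. square_summable x}"
  morphisms ell2_nth Abs_ell2
  using square_summable_zero by auto

lemma square_summable_ell2_nth: "square_summable (ell2_nth x)"
  using ell2_nth by auto

lemma ell2_nth_Abs: "square_summable x \<Longrightarrow> ell2_nth (Abs_ell2 x) = x"
  by (simp add: Abs_ell2_inverse)

lemma ell2_eqI: "(\<And>i. ell2_nth x i = ell2_nth y i) \<Longrightarrow> x = y"
  by (metis ell2_nth_inject ext)

instantiation ell2 :: (type, complex_normed_space) complex_normed_space
begin

definition "0 = Abs_ell2 (\<lambda>_. 0)"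
definition "x + y = Abs_ell2 (\<lambda>i. ell2_nth x i + ell2_nth y i)"
definition "- x = Abs_ell2 (\<lambda>i. - ell2_nth x i)"
definition "x - y = Abs_ell2 (\<lambda>i. ell2_nth x i - ell2_nth y i)"
definition "r *\<^sub>R x = Abs_ell2 (\<lambda>i. r *\<^sub>R ell2_nth x i)"
definition "a *\<^sub>C x = Abs_ell2 (\<lambda>i. a *\<^sub>C ell2_nth x i)"
definition "norm x = l2norm (ell2_nth x)"
definition "sgn (x::('a, 'b) ell2) = scaleR (inverse (norm x)) x"
definition "dist (x::('a, 'b) ell2) y = norm (x - y)"
definition
  "(uniformity :: (('a, 'b) ell2 \<times> ('a, 'b) ell2) filter) =
    (INF e\<in>{0<..}. principal {(x, y). dist x y < e})"
definition
  "open (U :: ('a, 'b) ell2 set) \<longleftrightarrow>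
    (\<forall>x\<in>U. \<forall>\<^sub>F (x', y) in uniformity. x' = x \<longrightarrow> y \<in> U)"

lemma ell2_nth_simps [simp]:
  fixes x y :: "('a, 'b) ell2"
  shows "ell2_nth (0 :: ('a, 'b) ell2) i = 0"
    and "ell2_nth (x + y) i = ell2_nth x i + ell2_nth y i"
    and "ell2_nth (- x) i = - ell2_nth x i"
    and "ell2_nth (x - y) i = ell2_nth x i - ell2_nth y i"
    and "ell2_nth (r *\<^sub>R x) i = r *\<^sub>R ell2_nth x i"
    and "ell2_nth (a *\<^sub>C x) i = a *\<^sub>C ell2_nth x i"
proof -
  have uminus: "square_summable (\<lambda>i. - ell2_nth z i)" for z :: "('a, 'b) ell2"
    by (rule square_summable_dominated(1)[OF square_summable_ell2_nth[of z], where C = 1]) auto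
  show "ell2_nth (0 :: ('a, 'b) ell2) i = 0"
    by (simp add: zero_ell2_def ell2_nth_Abs square_summable_zero)
  show "ell2_nth (x + y) i = ell2_nth x i + ell2_nth y i"
    by (simp add: plus_ell2_def ell2_nth_Abs square_summable_add(1) square_summable_ell2_nth)
  show "ell2_nth (- x) i = - ell2_nth x i"
    by (simp add: uminus_ell2_def ell2_nth_Abs uminus)
  show "ell2_nth (x - y) i = ell2_nth x i - ell2_nth y i"
    using square_summable_add(1)[OF square_summable_ell2_nth[of x] uminus[of y]]
    by (simp add: minus_ell2_def ell2_nth_Abs)
  have "square_summable (\<lambda>i. r *\<^sub>R ell2_nth x i)"
    by (rule square_summable_dominated(1)[OF square_summable_ell2_nth[of x], where C = "\<bar>r\<bar>"]) auto
  then show "ell2_nth (r *\<^sub>R x) i = r *\<^sub>R ell2_nth x i"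
    by (simp add: scaleR_ell2_def ell2_nth_Abs)
  have "square_summable (\<lambda>i. a *\<^sub>C ell2_nth x i)"
    by (rule square_summable_dominated(1)[OF square_summable_ell2_nth[of x], where C = "cmod a"])
      (auto simp: norm_scaleC)
  then show "ell2_nth (a *\<^sub>C x) i = a *\<^sub>C ell2_nth x i"
    by (simp add: scaleC_ell2_def ell2_nth_Abs)
qed

instance
proof
  fix x y z :: "('a, 'b) ell2" and r s :: real and a b :: complex
  have hom: "norm (a *\<^sub>C x) = cmod a * norm x" for a and x :: "('a, 'b) ell2"
    by (simp add: norm_ell2_def l2norm_def norm_scaleC power_mult_distrib infsum_cmult_right'
        real_sqrt_mult)
  have scRC: "r *\<^sub>R x = complex_of_real r *\<^sub>C x" for r and x :: "('a, 'b) ell2"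
    by (rule ell2_eqI) (simp add: scaleR_scaleC)
  show "x + y + z = x + (y + z)" "x + y = y + x" "0 + x = x" "- x + x = 0" "x - y = x + - y"
    "r *\<^sub>R (x + y) = r *\<^sub>R x + r *\<^sub>R y" "(r + s) *\<^sub>R x = r *\<^sub>R x + s *\<^sub>R x"
    "r *\<^sub>R s *\<^sub>R x = (r * s) *\<^sub>R x" "1 *\<^sub>R x = x"
    "a *\<^sub>C (x + y) = a *\<^sub>C x + a *\<^sub>C y" "(a + b) *\<^sub>C x = a *\<^sub>C x + b *\<^sub>C x"
    "a *\<^sub>C b *\<^sub>C x = (a * b) *\<^sub>C x"
    by (rule ell2_eqI; simp add: algebra_simps scaleR_add_left scaleR_add_right
        scaleC_add_right scaleC_add_left scaleC_scaleC)+
  show "r *\<^sub>R x = complex_of_real r *\<^sub>C x" by (rule scRC)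
  show "norm (a *\<^sub>C x) = cmod a * norm x" by (rule hom)
  show "norm (r *\<^sub>R x) = \<bar>r\<bar> * norm x" by (simp add: scRC hom)
  show "dist x y = norm (x - y)" by (rule dist_ell2_def)
  show "sgn x = inverse (norm x) *\<^sub>R x" by (rule sgn_ell2_def)
  show "(uniformity :: (('a, 'b) ell2 \<times> ('a, 'b) ell2) filter) =
      (INF e\<in>{0<..}. principal {(x, y). dist x y < e})"
    by (rule uniformity_ell2_def)
  show "open U \<longleftrightarrow> (\<forall>x\<in>U. \<forall>\<^sub>F (x', y) in uniformity. x' = x \<longrightarrow> y \<in> U)"
    for U :: "('a, 'b) ell2 set"
    by (rule open_ell2_def)
  show "norm (x + y) \<le> norm x + norm y"
    using square_summable_add(2)[OF square_summable_ell2_nth square_summable_ell2_nth, of x y]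
    by (simp add: norm_ell2_def ext[of "ell2_nth (x + y)", OF ell2_nth_simps(2)])
  show "norm x = 0 \<longleftrightarrow> x = 0"
  proof
    assume "norm x = 0"
    have "ell2_nth x i = 0" for i
      using L2_set_le_l2norm[OF square_summable_ell2_nth, of "{i}" x] \<open>norm x = 0\<close>
      by (simp add: norm_ell2_def)
    then show "x = 0" by (intro ell2_eqI) simp
  qed (simp add: norm_ell2_def l2norm_def)
qed

end

text \<open>For \<open>I \<subseteq> G\<close>, the space \<open>\<ell>\<^sup>2(I, Y)\<close> is realised as the closed subspace of
  \<open>\<ell>\<^sup>2(G, Y)\<close> of the elements vanishing off \<open>I\<close>; an operator on it is a map on
  \<open>\<ell>\<^sup>2(G, Y)\<close> leaving this subspace invariant, whose values elsewhere are irrelevant.\<close>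

definition ell2_on :: "'g set \<Rightarrow> ('g, 'y::complex_normed_space) ell2 set" where
  "ell2_on I = {x. \<forall>i. i \<notin> I \<longrightarrow> ell2_nth x i = 0}"

section \<open>Multiplication, shift and projection operators\<close>

definition norm_inf :: "('g \<Rightarrow> 'a::real_normed_vector) \<Rightarrow> real" where
  "norm_inf b = (SUP i. norm (b i))"

definition clinear_op :: "('y::complex_normed_space \<Rightarrow>\<^sub>L 'y) \<Rightarrow> bool" where
  "clinear_op T \<longleftrightarrow> (\<forall>c x. T (c *\<^sub>C x) = c *\<^sub>C T x)"

text \<open>\<open>\<ell>\<^sup>\<infinity>(G, L(Y))\<close>; the type \<open>'y \<Rightarrow>\<^sub>L 'y\<close> only accounts for real linearity.\<close>

definition linf :: "('g \<Rightarrow> ('y::complex_normed_space \<Rightarrow>\<^sub>L 'y)) set" where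
  "linf = {b. (\<forall>i. clinear_op (b i)) \<and> bounded (range b)}"

definition mult_op ::
  "('g \<Rightarrow> ('y::complex_normed_space \<Rightarrow>\<^sub>L 'y)) \<Rightarrow> ('g, 'y) ell2 \<Rightarrow>\<^sub>L ('g, 'y) ell2" where
  "mult_op b = Blinfun (\<lambda>x. Abs_ell2 (\<lambda>i. b i (ell2_nth x i)))"

definition shift_op ::
  "'g::ab_group_add \<Rightarrow> ('g, 'y::complex_normed_space) ell2 \<Rightarrow>\<^sub>L ('g, 'y) ell2" where
  "shift_op j = Blinfun (\<lambda>x. Abs_ell2 (\<lambda>i. ell2_nth x (i - j)))"

definition proj_op :: "'g set \<Rightarrow> ('g, 'y::complex_normed_space) ell2 \<Rightarrow>\<^sub>L ('g, 'y) ell2" where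
  "proj_op S = Blinfun (\<lambda>x. Abs_ell2 (\<lambda>i. if i \<in> S then ell2_nth x i else 0))"

text \<open>The arguments of \<open>Blinfun\<close> and \<open>Abs_ell2\<close> above are legitimate:\<close>

lemma ell2_nth_mult_op:
  fixes b :: "'g \<Rightarrow> ('y::complex_normed_space \<Rightarrow>\<^sub>L 'y)"
  assumes "bounded (range b)"
  shows "ell2_nth (mult_op b x) i = b i (ell2_nth x i)"
proof -
  obtain C where C: "\<And>i. norm (b i) \<le> C" using assms by (auto simp: bounded_iff)
  then have C0: "0 \<le> C" using norm_ge_zero order_trans by blast
  have le: "norm (b i (ell2_nth x i)) \<le> C * norm (ell2_nth x i)" for i and x :: "('g, 'y) ell2"
    by (rule order_trans[OF norm_blinfun]) (simp add: C mult_right_mono)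
  note dom = square_summable_dominated[OF square_summable_ell2_nth C0 le]
  define F where "F x = Abs_ell2 (\<lambda>i. b i (ell2_nth x i))" for x
  have nth: "ell2_nth (F x) = (\<lambda>i. b i (ell2_nth x i))" for x
    by (simp add: F_def ell2_nth_Abs dom(1))
  have "bounded_linear F"
    by (rule bounded_linear_intro[where K = C])
      (auto intro!: ell2_eqI simp: nth dom(2) blinfun.bilinear_simps norm_ell2_def
        mult.commute[of _ C])
  then have "mult_op b x = F x"
    by (simp add: mult_op_def F_def[abs_def] bounded_linear_Blinfun_apply)
  then show ?thesis by (simp add: nth)
qed

lemma ell2_nth_shift_op:
  fixes x :: "('g::ab_group_add, 'y::complex_normed_space) ell2"
  shows "ell2_nth (shift_op j x) i = ell2_nth x (i - j)"
proof -
  note tr = square_summable_translate(1)[OF square_summable_ell2_nth]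
  define F where "F x = Abs_ell2 (\<lambda>i. ell2_nth x (i - j))" for x :: "('g, 'y) ell2"
  have nth: "ell2_nth (F x) = (\<lambda>i. ell2_nth x (i - j))" for x
    by (simp add: F_def ell2_nth_Abs tr)
  have "bounded_linear F"
    by (rule bounded_linear_intro[where K = 1])
      (auto intro!: ell2_eqI simp: nth norm_ell2_def square_summable_translate(2))
  then have "shift_op j x = F x"
    by (simp add: shift_op_def F_def[abs_def] bounded_linear_Blinfun_apply)
  then show ?thesis by (simp add: nth)
qed

lemma ell2_nth_proj_op:
  fixes x :: "('g, 'y::complex_normed_space) ell2"
  shows "ell2_nth (proj_op S x) i = (if i \<in> S then ell2_nth x i else 0)"
proof -
  have le: "norm (if i \<in> S then ell2_nth x i else 0) \<le> 1 * norm (ell2_nth x i)"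
    for i and x :: "('g, 'y) ell2" by simp
  note dom = square_summable_dominated[OF square_summable_ell2_nth zero_le_one le]
  define F where "F x = Abs_ell2 (\<lambda>i. if i \<in> S then ell2_nth x i else 0)"
    for x :: "('g, 'y) ell2"
  have nth: "ell2_nth (F x) = (\<lambda>i. if i \<in> S then ell2_nth x i else 0)" for x
    by (simp add: F_def ell2_nth_Abs dom(1))
  have "bounded_linear F"
  proof (rule bounded_linear_intro[where K = 1])
    show "norm (F x) \<le> norm x * 1" for x
      using dom(2)[of x] by (simp add: norm_ell2_def nth)
  qed (auto intro!: ell2_eqI simp: nth)
  then have "proj_op S x = F x"
    by (simp add: proj_op_def F_def[abs_def] bounded_linear_Blinfun_apply)
  then show ?thesis by (simp add: nth)
qed

text \<open>\<open>A\<close> belongs to \<open>\<W>\<^sub>p(E)\<close> with representation \<open>A = \<Sum>\<^sub>j M\<^bsub>b j\<^esub> V\<^sub>j\<close>, the series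
  converging in operator norm. Since \<open>0 powr p = 0\<close> for every \<open>p\<close> and
  \<open>a powr 0 = 1\<close> for \<open>a > 0\<close>, \<open>powr\<close> obeys the convention
  \<open>a\<^sup>0 = lim\<^bsub>p\<rightarrow>0+\<^esub> a\<^sup>p\<close>.\<close>

definition wiener_rep ::
  "real \<Rightarrow> (('g::ab_group_add, 'y::complex_normed_space) ell2 \<Rightarrow>\<^sub>L ('g, 'y) ell2) \<Rightarrow>
    ('g \<Rightarrow> 'g \<Rightarrow> ('y \<Rightarrow>\<^sub>L 'y)) \<Rightarrow> bool" where
  "wiener_rep p A b \<longleftrightarrow>
    (\<forall>j. b j \<in> linf) \<and>
    (\<lambda>j. norm_inf (b j)) summable_on UNIV \<and>
    (\<lambda>j. norm_inf (b j) powr p) summable_on UNIV \<and>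
    ((\<lambda>j. mult_op (b j) o\<^sub>L shift_op j) has_sum A) UNIV"

section \<open>Lower norms and pseudospectra\<close>

text \<open>Infima are taken in \<open>ennreal\<close>, so that the infimum over an empty unit sphere
  is \<open>\<infinity>\<close>.\<close>

definition lower_norm :: "'a set \<Rightarrow> ('a \<Rightarrow> real) \<Rightarrow> ('a \<Rightarrow> 'a) \<Rightarrow> ennreal" where
  "lower_norm X N B = (INF x\<in>{x\<in>X. N x = 1}. ennreal (N (B x)))"

text \<open>The dual space of \<open>\<ell>\<^sup>2(I, Y)\<close>. Only the restriction of a functional to
  \<open>ell2_on I\<close> matters.\<close>

definition dual_ell2 :: "'g set \<Rightarrow> (('g, 'y::complex_normed_space) ell2 \<Rightarrow> complex) set" where
  "dual_ell2 I = {f.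
    (\<forall>x\<in>ell2_on I. \<forall>y\<in>ell2_on I. f (x + y) = f x + f y) \<and>
    (\<forall>c. \<forall>x\<in>ell2_on I. f (c *\<^sub>C x) = c * f x) \<and>
    (\<exists>C. \<forall>x\<in>ell2_on I. cmod (f x) \<le> C * norm x)}"

definition dual_norm :: "'g set \<Rightarrow> (('g, 'y::complex_normed_space) ell2 \<Rightarrow> complex) \<Rightarrow> real" where
  "dual_norm I f = (SUP x\<in>{x\<in>ell2_on I. norm x \<le> 1}. cmod (f x))"

definition banach_adjoint :: "('a \<Rightarrow> 'a) \<Rightarrow> ('a \<Rightarrow> complex) \<Rightarrow> ('a \<Rightarrow> complex)" where
  "banach_adjoint B f = f \<circ> B"

definition mu :: "'g set \<Rightarrow> (('g, 'y::complex_normed_space) ell2 \<Rightarrow> ('g, 'y) ell2) \<Rightarrow> ennreal" where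
  "mu I B = min (lower_norm (ell2_on I) norm B)
                (lower_norm (dual_ell2 I) (dual_norm I) (banach_adjoint B))"

definition spec_open ::
  "real \<Rightarrow> 'g set \<Rightarrow> (('g, 'y::complex_normed_space) ell2 \<Rightarrow> ('g, 'y) ell2) \<Rightarrow> complex set" where
  "spec_open \<epsilon> I B = {z. mu I (\<lambda>x. B x - z *\<^sub>C x) < ennreal \<epsilon>}"

definition Spec_closed ::
  "real \<Rightarrow> 'g set \<Rightarrow> (('g, 'y::complex_normed_space) ell2 \<Rightarrow> ('g, 'y) ell2) \<Rightarrow> complex set" where
  "Spec_closed \<epsilon> I B = {z. mu I (\<lambda>x. B x - z *\<^sub>C x) \<le> ennreal \<epsilon>}"

section \<open>The penalty term\<close>

definition beta :: "('g::ab_group_add \<Rightarrow> 'g \<Rightarrow> 'a::real_normed_vector) \<Rightarrow> 'g \<Rightarrow> real" where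
  "beta b j = (norm_inf (b j) + norm_inf (b (- j))) / 2"

definition edge_weight_on ::
  "real \<Rightarrow> ('g::ab_group_add \<Rightarrow> 'g \<Rightarrow> 'a::real_normed_vector) \<Rightarrow> 'g set \<Rightarrow> 'g \<Rightarrow> 'g \<Rightarrow> real" where
  "edge_weight_on p b W k l =
    (if k \<in> W \<and> l \<in> W \<and> k \<noteq> l then 2 * beta b (k - l) powr p else 0)"

definition killing_term ::
  "real \<Rightarrow> ('g::ab_group_add \<Rightarrow> 'g \<Rightarrow> 'a::real_normed_vector) \<Rightarrow> 'g set \<Rightarrow> 'g \<Rightarrow> real" where
  "killing_term p b W k = 2 * (\<Sum>\<^sub>\<infinity>j\<in>{j. j \<noteq> 0 \<and> k - j \<notin> W}. beta b j powr p)"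

definition dirichlet_laplacian ::
  "real \<Rightarrow> ('g::ab_group_add \<Rightarrow> 'g \<Rightarrow> 'a::real_normed_vector) \<Rightarrow> 'g set \<Rightarrow>
    ('g, complex) ell2 \<Rightarrow> ('g, complex) ell2" where
  "dirichlet_laplacian p b W x = Abs_ell2 (\<lambda>k. if k \<in> W
     then (\<Sum>l\<in>W. edge_weight_on p b W k l *\<^sub>R (ell2_nth x k - ell2_nth x l))
          + killing_term p b W k *\<^sub>R ell2_nth x k
     else 0)"

lemma ell2_nth_dirichlet_laplacian:
  assumes "finite W"
  shows "ell2_nth (dirichlet_laplacian p b W x) k = (if k \<in> W
     then (\<Sum>l\<in>W. edge_weight_on p b W k l *\<^sub>R (ell2_nth x k - ell2_nth x l))
          + killing_term p b W k *\<^sub>R ell2_nth x k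
     else 0)"
  unfolding dirichlet_laplacian_def
  by (subst ell2_nth_Abs) (auto intro!: square_summable_finite_support[OF assms])

text \<open>The spectrum of a bounded operator on \<open>\<ell>\<^sup>2(I, Y)\<close>; boundedness of the inverse is
  automatic when \<open>Y\<close> is complete.\<close>

definition spectrum_on ::
  "'g set \<Rightarrow> (('g, 'y::complex_normed_space) ell2 \<Rightarrow> ('g, 'y) ell2) \<Rightarrow> complex set" where
  "spectrum_on I B = {z. \<not> bij_betw (\<lambda>x. B x - z *\<^sub>C x) (ell2_on I) (ell2_on I)}"

definition penalty ::
  "real \<Rightarrow> ('g::ab_group_add \<Rightarrow> 'g \<Rightarrow> 'a::real_normed_vector) \<Rightarrow> 'g set \<Rightarrow> real" where
  "penalty p b W =
    sqrt (\<Sum>\<^sub>\<infinity>j\<in>UNIV - {0}. beta b j powr (2 - p)) *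
    sqrt (Min {t::real. complex_of_real t \<in> spectrum_on W (dirichlet_laplacian p b W)})"

section \<open>Weighted graphs\<close>

definition wiener_graph ::
  "real \<Rightarrow> ('g::ab_group_add \<Rightarrow> 'g \<Rightarrow> 'a::real_normed_vector) \<Rightarrow> 'g \<Rightarrow> 'g \<Rightarrow> real" where
  "wiener_graph p b k l = (if k = l then 0
     else 2 * ((norm_inf (b (k - l)) + norm_inf (b (l - k))) / 2) powr p)"

definition graph_dist :: "('g \<Rightarrow> 'g \<Rightarrow> real) \<Rightarrow> 'g \<Rightarrow> 'g \<Rightarrow> enat" where
  "graph_dist w k l = (INF n\<in>{n. (k, l) \<in> {(i, j). w i j > 0} ^^ n}. enat n)"

definition graph_connected :: "('g \<Rightarrow> 'g \<Rightarrow> real) \<Rightarrow> bool" where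
  "graph_connected w \<longleftrightarrow> (\<forall>k l. graph_dist w k l < \<infinity>)"

definition graph_ball :: "('g \<Rightarrow> 'g \<Rightarrow> real) \<Rightarrow> 'g \<Rightarrow> nat \<Rightarrow> 'g set" where
  "graph_ball w k r = {l. graph_dist w k l \<le> enat r}"

text \<open>The quotients of cardinalities are meaningful for finite balls only, and \<open>card\<close>
  vanishes on infinite sets, so finiteness of the balls has to be required explicitly.\<close>

definition subexponential_growth :: "('g \<Rightarrow> 'g \<Rightarrow> real) \<Rightarrow> bool" where
  "subexponential_growth w \<longleftrightarrow>
    (\<forall>k r. finite (graph_ball w k r)) \<and>
    liminf (\<lambda>r. INF k. ereal
      (1 / real r * ln (real (card (graph_ball w k r)) / real (card (graph_ball w k 1))))) = 0"

section \<open>Set limits\<close>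

definition set_limsup :: "(nat \<Rightarrow> complex set) \<Rightarrow> complex set" where
  "set_limsup S = {z. \<exists>s r. (\<forall>n. s n \<in> S n) \<and> strict_mono (r :: nat \<Rightarrow> nat) \<and>
    (s \<circ> r) \<longlonglongrightarrow> z}"

text \<open>In \<open>ennreal\<close>, \<open>dist(s, \<emptyset>) = \<infinity>\<close> and a supremum over the empty set is \<open>0\<close>.\<close>

definition hausdorff_distance :: "complex set \<Rightarrow> complex set \<Rightarrow> ennreal" where
  "hausdorff_distance S T =
    max (SUP s\<in>S. INF t\<in>T. ennreal (dist s t)) (SUP t\<in>T. INF s\<in>S. ennreal (dist t s))"

definition hausdorff_converges :: "(nat \<Rightarrow> complex set) \<Rightarrow> complex set \<Rightarrow> bool" where
  "hausdorff_converges S T \<longleftrightarrow> (\<lambda>n. hausdorff_distance (S n) T) \<longlonglongrightarrow> 0"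

section \<open>Patches\<close>

definition patch_set :: "(nat \<Rightarrow> 'g::ab_group_add set) \<Rightarrow> 'g \<Rightarrow> nat \<Rightarrow> 'g set" where
  "patch_set W k n = (\<lambda>w. k + w) ` W n"

definition patch ::
  "(('g::ab_group_add, 'y::complex_normed_space) ell2 \<Rightarrow>\<^sub>L ('g, 'y) ell2) \<Rightarrow>
    (nat \<Rightarrow> 'g set) \<Rightarrow> 'g \<Rightarrow> nat \<Rightarrow> ('g, 'y) ell2 \<Rightarrow>\<^sub>L ('g, 'y) ell2" where
  "patch A W k n = proj_op (patch_set W k n) o\<^sub>L A o\<^sub>L proj_op (patch_set W k n)"

definition no_spectral_pollution ::
  "(('g::ab_group_add, 'y::complex_normed_space) ell2 \<Rightarrow>\<^sub>L ('g, 'y) ell2) \<Rightarrow>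
    (nat \<Rightarrow> 'g set) \<Rightarrow> bool" where
  "no_spectral_pollution A W \<longleftrightarrow> (\<forall>\<delta>>0.
    set_limsup (\<lambda>n. \<Union>k. Spec_closed \<delta> (patch_set W k n) (patch A W k n))
      \<subseteq> Spec_closed \<delta> UNIV A)"

end

theory Submission
  imports Defs "HOL-Complex_Analysis.Cauchy_Integral_Formula"
begin

text \<open>
  Write \<open>\<epsilon>\<^sub>n\<close> for the penalty of \<open>W n\<close> and \<open>A\<^sub>k\<^sub>,\<^sub>n\<close> for the patches.

  The pseudospectrum is covered from inside: \<open>spec\<^sub>\<epsilon> A\<close> is contained in the union over \<open>k\<close> of the sets
  \<open>spec\<^sub>\<epsilon>\<^sub>+\<^sub>\<epsilon>\<^sub>n A\<^sub>k\<^sub>,\<^sub>n\<close>, for every \<open>n\<close>. An approximate eigenvector \<open>x\<close> of \<open>A\<close> is cut into the pieces \<open>\<phi>(\<cdot> - k) x\<close>,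
  where \<open>\<phi>\<close> is supported in \<open>W n\<close> and normalised. Averaged over \<open>k\<close>, the commutators of \<open>A\<close> with these
  cut-offs cost at most \<open>\<Sum>j. \<beta>\<^sub>j \<parallel>\<phi>(\<cdot> - j) - \<phi>\<parallel>\<close>, so some piece is an approximate eigenvector of a patch
  (\<open>localize_pseudo_eigenvector\<close>). By Cauchy-Schwarz this cost is controlled by the Dirichlet form of \<open>\<phi>\<close>,
  and the optimal choice, the ground state of the Dirichlet Laplacian, bounds it by \<open>\<epsilon>\<^sub>n\<close>
  (\<open>penalty_attained\<close>). The Hilbert space adjoint of \<open>A\<close> has diagonals of the same kind, which takes
  care of the second lower norm in \<open>\<mu>\<close> (\<open>mu_less_iff\<close>, \<open>wiener_localization\<close>).

  The penalty tends to zero: subexponential growth provides balls with small relative boundary, and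
  their indicator functions are test functions for the Rayleigh quotient (\<open>subexponential_growth_step\<close>,
  \<open>penalty_tendsto_0\<close>). Since the balls are finite, \<open>A\<close> is in fact a band operator.

  In a Hilbert space \<open>Spec\<^sub>\<epsilon> A\<close> is the closure of \<open>spec\<^sub>\<epsilon> A\<close>, because the resolvent norm satisfies a strict
  maximum principle (\<open>closed_pseudospectrum_subset_closure\<close>). Together with the first fact this gives one
  half of the Hausdorff convergence.

  For the other half, points of the patch pseudospectra that stay away from \<open>Spec\<^sub>\<epsilon> A\<close> would have a partial
  limit; as \<open>\<epsilon>\<^sub>n\<close> tends to zero, absence of pollution puts it into \<open>Spec\<^sub>\<delta> A\<close> for every \<open>\<delta> > \<epsilon>\<close>, hence into
  \<open>Spec\<^sub>\<epsilon> A\<close> (\<open>eventually_near_no_pollution\<close>). As partial limits are formed along full sequences of points, this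
  also needs that no patch pseudospectrum is empty if \<open>Y \<noteq> {0}\<close> (\<open>pseudospectrum_nonempty\<close>).
\<close>

section \<open>Complex Hilbert spaces\<close>

interpretation cvec: vector_space "scaleC :: complex \<Rightarrow> 'a::complex_normed_space \<Rightarrow> 'a"
proof
  fix a b :: complex and x y :: 'a
  show "a *\<^sub>C (x + y) = a *\<^sub>C x + a *\<^sub>C y" by (rule scaleC_add_right)
  show "(a + b) *\<^sub>C x = a *\<^sub>C x + b *\<^sub>C x" by (rule scaleC_add_left)
  show "a *\<^sub>C b *\<^sub>C x = (a * b) *\<^sub>C x" by (rule scaleC_scaleC)
  show "1 *\<^sub>C x = x" using scaleR_scaleC[of 1 x] by simp
qed

lemma cinner_zero_left [simp]: "cinner 0 (y::'a::complex_hilbert_space) = 0"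
  using cinner_add_left[of 0 0 y] by simp

lemma cinner_zero_right [simp]: "cinner x (0::'a::complex_hilbert_space) = 0"
  using cinner_commute[of x 0] by simp

lemma cinner_minus_left: "cinner (- x) (y::'a::complex_hilbert_space) = - cinner x y"
  using cinner_add_left[of x "-x" y] by (simp add: eq_neg_iff_add_eq_0 add.commute)

lemma cinner_diff_left: "cinner (x - y) (z::'a::complex_hilbert_space) = cinner x z - cinner y z"
  using cinner_add_left[of x "-y" z] by (simp add: cinner_minus_left)

lemma cinner_add_right: "cinner x (y + z::'a::complex_hilbert_space) = cinner x y + cinner x z"
  by (subst (1 2 3) cinner_commute) (simp add: cinner_add_left)

lemma cinner_diff_right: "cinner x (y - z::'a::complex_hilbert_space) = cinner x y - cinner x z"
  by (subst (1 2 3) cinner_commute) (simp add: cinner_diff_left)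

lemma cinner_scaleC_right: "cinner x (c *\<^sub>C y::'a::complex_hilbert_space) = cnj c * cinner x y"
  by (subst (1 2) cinner_commute) (simp add: cinner_scaleC_left)

lemma cinner_scaleR_left: "cinner (r *\<^sub>R x) (y::'a::complex_hilbert_space) = of_real r * cinner x y"
  by (simp add: scaleR_scaleC cinner_scaleC_left)

lemma cinner_scaleR_right: "cinner x (r *\<^sub>R (y::'a::complex_hilbert_space)) = of_real r * cinner x y"
  by (simp add: scaleR_scaleC cinner_scaleC_right)

lemma cinner_sum_left: "cinner (\<Sum>i\<in>F. f i) (y::'a::complex_hilbert_space) = (\<Sum>i\<in>F. cinner (f i) y)"
  by (induction F rule: infinite_finite_induct) (auto simp: cinner_add_left)

lemma cinner_sum_right: "cinner x (\<Sum>i\<in>F. f i :: 'a::complex_hilbert_space) = (\<Sum>i\<in>F. cinner x (f i))"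
  by (induction F rule: infinite_finite_induct) (auto simp: cinner_add_right)

lemma power2_norm_eq_Re_cinner: "(norm (x::'a::complex_hilbert_space))\<^sup>2 = Re (cinner x x)"
  by (simp add: cinner_self)

lemma Re_cinner_commute: "Re (cinner x y) = Re (cinner y (x::'a::complex_hilbert_space))"
  using cinner_commute[of x y] by simp

lemma power2_norm_add:
  "(norm (x + y::'a::complex_hilbert_space))\<^sup>2 = (norm x)\<^sup>2 + (norm y)\<^sup>2 + 2 * Re (cinner x y)"
  by (simp add: power2_norm_eq_Re_cinner cinner_add_left cinner_add_right Re_cinner_commute[of y x])

lemma power2_norm_diff:
  "(norm (x - y::'a::complex_hilbert_space))\<^sup>2 = (norm x)\<^sup>2 + (norm y)\<^sup>2 - 2 * Re (cinner x y)"
  by (simp add: power2_norm_eq_Re_cinner cinner_diff_left cinner_diff_right Re_cinner_commute[of y x])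

lemma cmod_cinner_le: "cmod (cinner x y) \<le> norm x * norm (y::'a::complex_hilbert_space)"
proof (cases "y = 0")
  case False
  define c where "c = cinner x y"
  have n: "complex_of_real ((norm y)\<^sup>2) = cinner y y" by (simp add: cinner_self)
  have "cinner ((complex_of_real ((norm y)\<^sup>2)) *\<^sub>C x - c *\<^sub>C y) ((complex_of_real ((norm y)\<^sup>2)) *\<^sub>C x - c *\<^sub>C y)
      = complex_of_real ((norm y)\<^sup>2 * ((norm x)\<^sup>2 * (norm y)\<^sup>2 - (cmod c)\<^sup>2))"
    by (simp add: cinner_diff_left cinner_diff_right cinner_scaleC_left cinner_scaleC_right
        cinner_self[of x] cinner_self[of y] c_def[symmetric] cinner_commute[of y x] algebra_simps
        flip: complex_norm_square)
  then have "0 \<le> (norm y)\<^sup>2 * ((norm x)\<^sup>2 * (norm y)\<^sup>2 - (cmod c)\<^sup>2)"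
    by (metis Re_complex_of_real power2_norm_eq_Re_cinner zero_le_power2)
  then have "(cmod c)\<^sup>2 \<le> (norm x * norm y)\<^sup>2"
    using False by (simp add: zero_le_mult_iff power_mult_distrib)
  then show ?thesis unfolding c_def by (rule power2_le_imp_le) simp
qed simp

lemma cinner_ext:
  fixes x y :: "'a::complex_hilbert_space"
  assumes "\<And>z. cinner x z = cinner y z"
  shows "x = y"
  using assms[of "x - y"] cinner_self[of "x - y"] by (simp add: cinner_diff_left)

lemma norm_cinner_bound:
  fixes y :: "'a::complex_hilbert_space"
  assumes "cmod (cinner y y) \<le> C * norm y" and "0 \<le> C"
  shows "norm y \<le> C"
  using assms by (cases "y = 0") (auto simp: cinner_self power2_eq_square norm_mult)

section \<open>Riesz representation and adjoints\<close>

text \<open>The representing vector of a functional \<open>f\<close> minimises \<open>\<parallel>y\<parallel>\<^sup>2 - 2 Re (f y)\<close>: by the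
  parallelogram law a minimising sequence is Cauchy, and the first variation at the minimum is the
  claim.\<close>
theorem riesz_representation:
  fixes S :: "'a::complex_hilbert_space set" and f :: "'a \<Rightarrow> complex"
  assumes S: "cvec.subspace S" "closed S"
    and f_add: "\<And>x y. x \<in> S \<Longrightarrow> y \<in> S \<Longrightarrow> f (x + y) = f x + f y"
    and f_scale: "\<And>c x. x \<in> S \<Longrightarrow> f (c *\<^sub>C x) = c * f x"
    and f_bound: "\<And>x. x \<in> S \<Longrightarrow> cmod (f x) \<le> C * norm x"
  obtains y where "y \<in> S" "\<And>x. x \<in> S \<Longrightarrow> f x = cinner x y"
proof -
  note sub = cvec.subspace_add[OF S(1)] cvec.subspace_scale[OF S(1)] cvec.subspace_0[OF S(1)]
    cvec.subspace_diff[OF S(1)]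
  have subR: "r *\<^sub>R x \<in> S" if "x \<in> S" for r x
    using sub(2)[OF that] by (simp add: scaleR_scaleC)
  have fR: "f (r *\<^sub>R x) = r * f x" if "x \<in> S" for r x
    using f_scale[OF that] by (simp add: scaleR_scaleC)
  have f_diff: "f (x - y) = f x - f y" if "x \<in> S" "y \<in> S" for x y
    using f_add[of "x - y" y] sub(4)[OF that] that by simp
  define g where "g y = (norm y)\<^sup>2 - 2 * Re (f y)" for y
  have low: "- C\<^sup>2 \<le> g y" if "y \<in> S" for y
  proof -
    have "Re (f y) \<le> C * norm y" using f_bound[OF that] complex_Re_le_cmod order_trans by blast
    moreover have "0 \<le> (norm y - C)\<^sup>2" by simp
    ultimately show ?thesis by (simp add: g_def power2_diff mult.commute)
  qed
  define m where "m = Inf (g ` S)"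
  have bdd: "bdd_below (g ` S)" using low by (auto simp: bdd_below_def)
  have m_le: "m \<le> g y" if "y \<in> S" for y
    unfolding m_def using that by (intro cInf_lower bdd) auto
  have "\<exists>y\<in>S. g y < m + inverse (real (Suc n))" for n
    using cInf_lessD[of "g ` S" "m + inverse (real (Suc n))"] sub(3) unfolding m_def by auto
  then obtain u where u: "\<And>n. u n \<in> S" "\<And>n. g (u n) < m + inverse (real (Suc n))"
    by metis
  have dist_u: "(norm (x - y))\<^sup>2 \<le> 2 * (g x - m) + 2 * (g y - m)" if "x \<in> S" "y \<in> S" for x y
  proof -
    have mid: "(1/2::real) *\<^sub>R (x + y) \<in> S" using subR[OF sub(1)[OF that]] .
    have "4 * (norm ((1/2::real) *\<^sub>R (x + y)))\<^sup>2 = (norm (x + y))\<^sup>2"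
      by (simp add: power_divide)
    then have "4 * g ((1/2::real) *\<^sub>R (x + y)) = (norm (x + y))\<^sup>2 - 4 * Re (f x) - 4 * Re (f y)"
      using sub(1)[OF that] by (simp add: g_def fR f_add that add_divide_distrib)
    with m_le[OF mid] show ?thesis
      by (simp add: g_def power2_norm_add power2_norm_diff)
  qed
  have "Cauchy u"
  proof (rule metric_CauchyI)
    fix e :: real assume "0 < e"
    then obtain N where N: "inverse (real (Suc N)) < e\<^sup>2 / 4"
      using reals_Archimedean[of "e\<^sup>2 / 4"] by auto
    have gu: "g (u n) - m < e\<^sup>2 / 4" if "n \<ge> N" for n
    proof -
      have "inverse (real (Suc n)) \<le> inverse (real (Suc N))" using that by (simp add: field_simps)
      with u(2)[of n] N show ?thesis by linarith
    qed
    have "dist (u i) (u n) < e" if "i \<ge> N" "n \<ge> N" for i n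
    proof -
      have "(norm (u i - u n))\<^sup>2 < e\<^sup>2"
        using dist_u[OF u(1) u(1), of i n] gu[OF that(1)] gu[OF that(2)] by argo
      then show ?thesis using \<open>0 < e\<close> by (simp add: dist_norm power2_less_imp_less)
    qed
    then show "\<exists>M. \<forall>i\<ge>M. \<forall>n\<ge>M. dist (u i) (u n) < e" by blast
  qed
  then obtain y where y: "u \<longlonglongrightarrow> y" using Cauchy_convergent convergentD by blast
  have yS: "y \<in> S" using closed_sequentially[OF S(2)] u(1) y by blast
  have "(\<lambda>n. f (u n)) \<longlonglongrightarrow> f y"
  proof -
    have "(\<lambda>n. f (u n) - f y) \<longlonglongrightarrow> 0"
    proof (rule Lim_null_comparison)
      show "\<forall>\<^sub>F n in sequentially. cmod (f (u n) - f y) \<le> C * norm (u n - y)"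
        using f_bound sub(4) u(1) yS by (auto simp: f_diff[symmetric])
      show "(\<lambda>n. C * norm (u n - y)) \<longlonglongrightarrow> 0"
        using tendsto_mult_right_zero[OF tendsto_norm_zero[OF LIM_zero[OF y]]] .
    qed
    then show ?thesis by (rule LIM_zero_cancel)
  qed
  then have "(\<lambda>n. g (u n)) \<longlonglongrightarrow> g y"
    unfolding g_def using y by (intro tendsto_intros)
  moreover have "(\<lambda>n. m + inverse (real (Suc n))) \<longlonglongrightarrow> m"
    using LIMSEQ_inverse_real_of_nat_add by simp
  ultimately have gy: "g y \<le> m"
    by (rule LIMSEQ_le) (use u(2) less_imp_le in blast)
  have Re_eq: "Re (f x) = Re (cinner x y)" if "x \<in> S" for x
  proof -
    define d where "d = Re (cinner x y) - Re (f x)"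
    have pos: "0 \<le> 2 * t * d + t\<^sup>2 * (norm x)\<^sup>2" for t
    proof -
      have tx: "t *\<^sub>R x \<in> S" using subR[OF that] .
      have "g (t *\<^sub>R x + y) = g y + (2 * t * d + t\<^sup>2 * (norm x)\<^sup>2)"
        unfolding g_def f_add[OF tx yS] fR[OF that] power2_norm_add cinner_scaleR_left
        by (simp add: d_def power_mult_distrib right_diff_distrib)
      moreover have "g y \<le> g (t *\<^sub>R x + y)" using gy m_le[OF sub(1)[OF tx yS]] by linarith
      ultimately show ?thesis by linarith
    qed
    have "d = 0"
    proof (rule ccontr)
      assume "d \<noteq> 0"
      define s where "s = (norm x)\<^sup>2 + 1"
      have s: "s > 0" by (simp add: s_def add_nonneg_pos)
      have "0 \<le> 2 * (- d / s) * d + (- d / s)\<^sup>2 * (norm x)\<^sup>2" by (rule pos)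
      also have "\<dots> \<le> 2 * (- d / s) * d + (- d / s)\<^sup>2 * s"
        by (intro add_left_mono mult_left_mono) (auto simp: s_def)
      also have "\<dots> = - (d\<^sup>2 / s)" using s by (simp add: power2_eq_square field_simps)
      finally show False using s \<open>d \<noteq> 0\<close> by (simp add: divide_le_0_iff)
    qed
    then show ?thesis by (simp add: d_def)
  qed
  have "f x = cinner x y" if "x \<in> S" for x
  proof (rule complex_eqI)
    show "Re (f x) = Re (cinner x y)" by (rule Re_eq[OF that])
    show "Im (f x) = Im (cinner x y)"
      using Re_eq[OF sub(2)[OF that, of "\<i>"]] by (simp add: f_scale that cinner_scaleC_left)
  qed
  with yS show ?thesis by (rule that)
qed

text \<open>The orthogonal complement of the range of \<open>T\<close> is the kernel of \<open>T'\<close>, which is trivial, and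
  the range is complete because \<open>T\<close> is bounded below.\<close>
lemma bounded_below_imp_surj:
  fixes S :: "'a::complex_hilbert_space set"
  assumes S: "cvec.subspace S" "closed S" and "0 < c"
    and T: "\<And>x. x \<in> S \<Longrightarrow> T x \<in> S" "linear T" "\<And>a x. T (a *\<^sub>C x) = a *\<^sub>C T x"
    and cont: "continuous_on S T"
    and T': "\<And>y. y \<in> S \<Longrightarrow> T' y \<in> S"
    and adj: "\<And>x y. x \<in> S \<Longrightarrow> y \<in> S \<Longrightarrow> cinner (T x) y = cinner x (T' y)"
    and low: "\<And>x. x \<in> S \<Longrightarrow> c * norm x \<le> norm (T x)"
    and low': "\<And>y. y \<in> S \<Longrightarrow> c * norm y \<le> norm (T' y)"
  shows "T ` S = S"
proof
  show "T ` S \<subseteq> S" using T(1) by blast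
  note sub = cvec.subspace_add[OF S(1)] cvec.subspace_scale[OF S(1)] cvec.subspace_0[OF S(1)]
    cvec.subspace_diff[OF S(1)]
  have ran: "cvec.subspace (T ` S)"
    unfolding cvec.subspace_def
  proof (intro conjI ballI allI)
    show "0 \<in> T ` S" using sub(3) linear_0[OF T(2)] by (metis imageI)
    show "x + y \<in> T ` S" if "x \<in> T ` S" "y \<in> T ` S" for x y
      using that sub(1) by (auto simp: linear_add[OF T(2), symmetric])
    show "a *\<^sub>C x \<in> T ` S" if "x \<in> T ` S" for a x
      using that sub(2) by (auto simp: T(3)[symmetric])
  qed
  have "closed (T ` S)"
    unfolding closed_sequential_limits
  proof (intro allI impI, elim conjE)
    fix v l assume v: "\<forall>n. v n \<in> T ` S" and l: "v \<longlonglongrightarrow> l"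
    define u where "u n = (SOME x. x \<in> S \<and> v n = T x)" for n
    have "u n \<in> S \<and> v n = T (u n)" for n
      unfolding u_def by (rule someI_ex) (use v in blast)
    then have u: "\<And>n. u n \<in> S" "\<And>n. v n = T (u n)" by blast+
    have "Cauchy u"
    proof (rule metric_CauchyI)
      fix e :: real assume "0 < e"
      obtain M where M: "\<And>i n. i \<ge> M \<Longrightarrow> n \<ge> M \<Longrightarrow> dist (v i) (v n) < c * e"
        using metric_CauchyD[OF LIMSEQ_imp_Cauchy[OF l], of "c * e"] \<open>0 < e\<close> \<open>0 < c\<close> by auto
      have "dist (u i) (u n) < e" if "i \<ge> M" "n \<ge> M" for i n
      proof -
        have "c * norm (u i - u n) \<le> norm (v i - v n)"
          using low[OF sub(4)[OF u(1) u(1)], of i n] by (simp add: linear_diff[OF T(2)] u(2))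
        also have "\<dots> < c * e" using M[OF that] by (simp add: dist_norm)
        finally show ?thesis using \<open>0 < c\<close> by (simp add: dist_norm)
      qed
      then show "\<exists>M. \<forall>i\<ge>M. \<forall>n\<ge>M. dist (u i) (u n) < e" by blast
    qed
    then obtain x where x: "u \<longlonglongrightarrow> x" using Cauchy_convergent convergentD by blast
    have xS: "x \<in> S" using closed_sequentially[OF S(2)] u(1) x by blast
    have "(\<lambda>n. T (u n)) \<longlonglongrightarrow> T x"
      using cont x xS u(1) by (auto simp: continuous_on_sequentially o_def)
    then have "l = T x" using l LIMSEQ_unique by (simp add: u(2)[abs_def, symmetric])
    with xS show "l \<in> T ` S" by blast
  qed
  show "S \<subseteq> T ` S"
  proof
    fix y assume y: "y \<in> S"
    obtain v where v: "v \<in> T ` S" "\<And>x. x \<in> T ` S \<Longrightarrow> cinner x y = cinner x v"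
      using riesz_representation[OF ran \<open>closed (T ` S)\<close>, of "\<lambda>x. cinner x y" "norm y"]
      using cmod_cinner_le[of _ y] by (auto simp: cinner_add_left cinner_scaleC_left mult.commute)
    have yv: "y - v \<in> S" using sub(4) y v(1) T(1) by blast
    have "cinner (T' (y - v)) (T' (y - v)) = 0"
      using adj[OF T'[OF yv] yv] v(2)[of "T (T' (y - v))"] T'[OF yv] by (simp add: cinner_diff_right)
    then have "T' (y - v) = 0" by (simp add: cinner_self)
    then have "c * norm (y - v) \<le> 0" using low'[OF yv] by simp
    then have "y = v" using \<open>0 < c\<close> by (simp add: mult_le_0_iff)
    with v(1) show "y \<in> T ` S" by simp
  qed
qed

text \<open>Both components carry complex linearity because the type \<open>\<Rightarrow>\<^sub>L\<close> only records real linearity.\<close>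
definition adjoint_pair ::
  "('a::complex_hilbert_space \<Rightarrow>\<^sub>L 'a) \<Rightarrow> ('a \<Rightarrow>\<^sub>L 'a) \<Rightarrow> bool" where
  "adjoint_pair B B' \<longleftrightarrow> clinear_op B \<and> clinear_op B' \<and> (\<forall>x y. cinner (B x) y = cinner x (B' y))"

lemma adjoint_pair_sym: "adjoint_pair B B' \<Longrightarrow> adjoint_pair B' B"
  unfolding adjoint_pair_def using cinner_commute by metis

lemma adjoint_pair_exists:
  fixes B :: "'a::complex_hilbert_space \<Rightarrow>\<^sub>L 'a"
  assumes "clinear_op B"
  obtains B' where "adjoint_pair B B'"
proof -
  have "\<exists>v. \<forall>x. cinner (B x) y = cinner x v" for y
  proof -
    have "cmod (cinner (B x) y) \<le> (norm B * norm y) * norm x" for x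
      using order_trans[OF cmod_cinner_le mult_right_mono[OF norm_blinfun norm_ge_zero], of B x y]
      by (simp add: mult_ac)
    then obtain v where "\<And>x. cinner (B x) y = cinner x v"
      using riesz_representation[of UNIV "\<lambda>x. cinner (B x) y" "norm B * norm y"] assms
      by (auto simp: blinfun.add_right cinner_add_left cinner_scaleC_left clinear_op_def)
    then show ?thesis by blast
  qed
  then obtain F where F: "\<And>x y. cinner (B x) y = cinner x (F y)" by metis
  have F': "cinner (F y) x = cinner y (B x)" for x y
    using F cinner_commute by metis
  have "bounded_linear F"
  proof (rule bounded_linear_intro[where K = "norm B"])
    fix x y and r :: real
    show "F (x + y) = F x + F y" by (rule cinner_ext) (simp add: F' cinner_add_left)
    show "F (r *\<^sub>R x) = r *\<^sub>R F x"
      by (rule cinner_ext) (simp add: F' cinner_scaleC_left scaleR_scaleC)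
    have "cmod (cinner (F x) (F x)) \<le> norm x * norm (B (F x))"
      unfolding F' by (rule cmod_cinner_le)
    also have "\<dots> \<le> norm x * (norm B * norm (F x))"
      by (intro mult_left_mono norm_blinfun) auto
    finally have "cmod (cinner (F x) (F x)) \<le> norm x * norm B * norm (F x)"
      by (simp add: mult.assoc)
    then show "norm (F x) \<le> norm x * norm B" by (rule norm_cinner_bound) simp
  qed
  then have B': "blinfun_apply (Blinfun F) = F" by (rule bounded_linear_Blinfun_apply)
  have "clinear_op (Blinfun F)"
    unfolding clinear_op_def B'
  proof (intro allI)
    show "F (c *\<^sub>C y) = c *\<^sub>C F y" for c y
      by (rule cinner_ext) (simp add: F' cinner_scaleC_left)
  qed
  then show ?thesis
    using that[of "Blinfun F"] assms by (simp add: adjoint_pair_def B' F)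
qed

section \<open>The Hilbert space of square summable families\<close>

lemma norm_ell2_sq: "(norm (x::('g,'y::complex_normed_space) ell2))\<^sup>2 = (\<Sum>\<^sub>\<infinity>i. (norm (ell2_nth x i))\<^sup>2)"
  by (simp add: norm_ell2_def l2norm_def infsum_nonneg)

lemma ell2_summable: "(\<lambda>i. (norm (ell2_nth (x::('g,'y::complex_normed_space) ell2) i))\<^sup>2) summable_on UNIV"
  using square_summable_ell2_nth[of x] by (simp add: square_summable_def)

lemma norm_ell2_nth_le: "norm (ell2_nth x i) \<le> norm x"
  using L2_set_le_l2norm[OF square_summable_ell2_nth, of "{i}" x] by (simp add: norm_ell2_def)

lemma ell2_cinner_summable:
  fixes x y :: "('g, 'y::complex_hilbert_space) ell2"
  shows "(\<lambda>i. cinner (ell2_nth x i) (ell2_nth y i)) summable_on UNIV"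
proof (rule abs_summable_summable, rule summable_on_comparison_test)
  show "(\<lambda>i. (norm (ell2_nth x i))\<^sup>2 + (norm (ell2_nth y i))\<^sup>2) summable_on UNIV"
    by (intro summable_on_add ell2_summable)
  fix i
  have "cmod (cinner (ell2_nth x i) (ell2_nth y i)) \<le> norm (ell2_nth x i) * norm (ell2_nth y i)"
    by (rule cmod_cinner_le)
  also have "\<dots> \<le> (norm (ell2_nth x i))\<^sup>2 + (norm (ell2_nth y i))\<^sup>2"
    using sum_squares_bound[of "norm (ell2_nth x i)" "norm (ell2_nth y i)"]
      mult_nonneg_nonneg[OF norm_ge_zero[of "ell2_nth x i"] norm_ge_zero[of "ell2_nth y i"]]
    by linarith
  finally show "cmod (cinner (ell2_nth x i) (ell2_nth y i)) \<le> (norm (ell2_nth x i))\<^sup>2 + (norm (ell2_nth y i))\<^sup>2" .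
qed auto

instantiation ell2 :: (type, complex_hilbert_space) complex_hilbert_space
begin

definition "cinner x y = (\<Sum>\<^sub>\<infinity>i. cinner (ell2_nth x i) (ell2_nth y i))"

instance
proof
  fix x y z :: "('a, 'b) ell2" and c :: complex and X :: "nat \<Rightarrow> ('a, 'b) ell2"
  show "cinner x y = cnj (cinner y x)"
    unfolding cinner_ell2_def infsum_cnj[symmetric] by (intro infsum_cong cinner_commute)
  show "cinner (x + y) z = cinner x z + cinner y z"
    unfolding cinner_ell2_def by (simp add: cinner_add_left infsum_add ell2_cinner_summable)
  show "cinner (c *\<^sub>C x) y = c * cinner x y"
    unfolding cinner_ell2_def by (simp add: cinner_scaleC_left infsum_cmult_right')
  show "cinner x x = complex_of_real ((norm x)\<^sup>2)"
    unfolding cinner_ell2_def norm_ell2_sq cinner_self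
    by (rule infsum_bounded_linear_strong[OF _ bounded_linear_of_real])
      (use ell2_summable[of x] summable_on_of_real in blast)
  assume X: "Cauchy X"
  have "Cauchy (\<lambda>n. ell2_nth (X n) i)" for i
    unfolding Cauchy_def
  proof (intro allI impI)
    fix e :: real assume "0 < e"
    then obtain M where M: "\<And>m n. m \<ge> M \<Longrightarrow> n \<ge> M \<Longrightarrow> dist (X m) (X n) < e"
      using X unfolding Cauchy_def by blast
    have "dist (ell2_nth (X m) i) (ell2_nth (X n) i) < e" if "m \<ge> M" "n \<ge> M" for m n
      using M[OF that] norm_ell2_nth_le[of "X m - X n" i] by (simp add: dist_norm)
    then show "\<exists>M. \<forall>m\<ge>M. \<forall>n\<ge>M. dist (ell2_nth (X m) i) (ell2_nth (X n) i) < e" by blast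
  qed
  then have "\<exists>l. (\<lambda>n. ell2_nth (X n) i) \<longlonglongrightarrow> l" for i
    using Cauchy_convergent convergentD by blast
  then obtain l where l: "\<And>i. (\<lambda>n. ell2_nth (X n) i) \<longlonglongrightarrow> l i" by metis
  have tail: "L2_set (\<lambda>i. norm (ell2_nth (X m) i - l i)) F \<le> e"
    if M: "\<And>m n. m \<ge> M \<Longrightarrow> n \<ge> M \<Longrightarrow> norm (X m - X n) < e" and "m \<ge> M" "finite F" for e M m F
  proof (rule LIMSEQ_le_const2)
    show "(\<lambda>n. L2_set (\<lambda>i. norm (ell2_nth (X m) i - ell2_nth (X n) i)) F)
      \<longlonglongrightarrow> L2_set (\<lambda>i. norm (ell2_nth (X m) i - l i)) F"
      unfolding L2_set_def by (intro tendsto_intros l)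
    have "L2_set (\<lambda>i. norm (ell2_nth (X m) i - ell2_nth (X n) i)) F \<le> e" if "n \<ge> M" for n
      using L2_set_le_l2norm[OF square_summable_ell2_nth \<open>finite F\<close>, of "X m - X n"]
        M[OF \<open>m \<ge> M\<close> that] by (simp add: norm_ell2_def)
    then show "\<exists>N. \<forall>n\<ge>N. L2_set (\<lambda>i. norm (ell2_nth (X m) i - ell2_nth (X n) i)) F \<le> e" by blast
  qed
  obtain M1 where M1: "\<And>m n. m \<ge> M1 \<Longrightarrow> n \<ge> M1 \<Longrightarrow> norm (X m - X n) < 1"
    using X unfolding Cauchy_def dist_norm by (metis zero_less_one)
  have "square_summable (\<lambda>i. ell2_nth (X M1) i - l i)"
    by (rule square_summable_bound(1)) (rule tail[OF M1 order_refl])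
  then have "square_summable (\<lambda>i. - (ell2_nth (X M1) i - l i))"
    by (simp add: square_summable_def norm_minus_commute)
  from square_summable_add(1)[OF square_summable_ell2_nth[of "X M1"] this]
  have "square_summable l" by (simp add: square_summable_def)
  then have nth: "ell2_nth (Abs_ell2 l) = l" by (rule ell2_nth_Abs)
  have "X \<longlonglongrightarrow> Abs_ell2 l"
  proof (rule LIMSEQ_I)
    fix e :: real assume "0 < e"
    then obtain M where M: "\<And>m n. m \<ge> M \<Longrightarrow> n \<ge> M \<Longrightarrow> norm (X m - X n) < e / 2"
      using X unfolding Cauchy_def dist_norm by (meson half_gt_zero)
    have "norm (X m - Abs_ell2 l) < e" if "m \<ge> M" for m
    proof -
      have "norm (X m - Abs_ell2 l) \<le> e / 2"
        unfolding norm_ell2_def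
        by (rule square_summable_bound(2)) (use tail[OF M that] in \<open>simp add: nth\<close>)
      then show ?thesis using \<open>0 < e\<close> by simp
    qed
    then show "\<exists>no. \<forall>n\<ge>no. norm (X n - Abs_ell2 l) < e" by blast
  qed
  then show "convergent X" by (rule convergentI)
qed

end

lemma subspace_ell2_on: "cvec.subspace (ell2_on I :: ('g, 'y::complex_normed_space) ell2 set)"
  by (auto simp: cvec.subspace_def ell2_on_def)

lemma closed_ell2_on: "closed (ell2_on I :: ('g, 'y::complex_normed_space) ell2 set)"
  unfolding closed_sequential_limits
proof (intro allI impI, elim conjE)
  fix x :: "nat \<Rightarrow> ('g, 'y) ell2" and l
  assume x: "\<forall>n. x n \<in> ell2_on I" and l: "x \<longlonglongrightarrow> l"
  have "ell2_nth l i = 0" if "i \<notin> I" for i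
  proof -
    have "norm (ell2_nth l i) \<le> norm (x n - l)" for n
      using norm_ell2_nth_le[of "x n - l" i] x that by (simp add: ell2_on_def)
    moreover have "(\<lambda>n. norm (x n - l)) \<longlonglongrightarrow> 0" using tendsto_norm_zero[OF LIM_zero[OF l]] .
    ultimately have "norm (ell2_nth l i) \<le> 0" using LIMSEQ_le_const by blast
    then show ?thesis by simp
  qed
  then show "l \<in> ell2_on I" by (simp add: ell2_on_def)
qed

section \<open>Pseudospectra in terms of the Hilbert space adjoint\<close>

text \<open>This is \<open>\<nu>(B - z) < e\<close> on \<open>S\<close>. The homogeneous form needs no normalised vectors, so that
  cut-off functions can be applied freely, and it is false for \<open>S = {0}\<close>, in accordance with
  \<open>inf \<emptyset> = \<infinity>\<close>.\<close>
definition pseudo_eigenvalue ::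
  "'a::complex_normed_space set \<Rightarrow> ('a \<Rightarrow>\<^sub>L 'a) \<Rightarrow> complex \<Rightarrow> real \<Rightarrow> bool" where
  "pseudo_eigenvalue S B z e \<longleftrightarrow> (\<exists>x\<in>S. norm (B x - z *\<^sub>C x) < e * norm x)"

lemma scaleC_scaleR_commute: "z *\<^sub>C r *\<^sub>R x = r *\<^sub>R (z *\<^sub>C (x::'a::complex_normed_space))"
  by (simp add: scaleR_scaleC mult.commute scaleC_scaleC)

lemma pseudo_eigenvalue_mono:
  "pseudo_eigenvalue S B z d \<Longrightarrow> d \<le> e \<Longrightarrow> pseudo_eigenvalue S B z e"
  unfolding pseudo_eigenvalue_def by (meson less_le_trans mult_right_mono norm_ge_zero)

lemma not_pseudo_eigenvalue_iff:
  "\<not> pseudo_eigenvalue S B z e \<longleftrightarrow> (\<forall>x\<in>S. e * norm x \<le> norm (B x - z *\<^sub>C x))"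
  by (auto simp: pseudo_eigenvalue_def not_less)

lemma lower_norm_less_iff:
  assumes "\<And>x. x \<in> X \<Longrightarrow> 0 \<le> N (B x)"
  shows "lower_norm X N B < ennreal e \<longleftrightarrow> (\<exists>x\<in>X. N x = 1 \<and> N (B x) < e)"
  unfolding lower_norm_def INF_less_iff using assms by (auto simp: ennreal_less_iff)

lemma normalize_pseudo_eigenvector:
  fixes B :: "'a::complex_normed_space \<Rightarrow>\<^sub>L 'a"
  assumes "cvec.subspace S"
  shows "(\<exists>x\<in>S. norm x = 1 \<and> norm (B x - z *\<^sub>C x) < e) \<longleftrightarrow> pseudo_eigenvalue S B z e"
proof
  assume "\<exists>x\<in>S. norm x = 1 \<and> norm (B x - z *\<^sub>C x) < e"
  then show "pseudo_eigenvalue S B z e" unfolding pseudo_eigenvalue_def by (metis mult.right_neutral)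
next
  assume "pseudo_eigenvalue S B z e"
  then obtain x where x: "x \<in> S" "norm (B x - z *\<^sub>C x) < e * norm x"
    by (auto simp: pseudo_eigenvalue_def)
  have x0: "x \<noteq> 0" using x(2) by auto
  define y where "y = inverse (norm x) *\<^sub>R x"
  have "y \<in> S" unfolding y_def scaleR_scaleC by (rule cvec.subspace_scale[OF assms x(1)])
  moreover have "norm y = 1" using x0 by (simp add: y_def)
  moreover have "B y - z *\<^sub>C y = inverse (norm x) *\<^sub>R (B x - z *\<^sub>C x)"
    by (simp add: y_def blinfun.scaleR_right scaleC_scaleR_commute scaleR_right_diff_distrib)
  then have "norm (B y - z *\<^sub>C y) < e"
    using x(2) x0 by (simp add: divide_simps mult.commute)
  ultimately show "\<exists>x\<in>S. norm x = 1 \<and> norm (B x - z *\<^sub>C x) < e" by blast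
qed

lemma dual_norm_eq_norm:
  fixes y :: "('g, 'y::complex_hilbert_space) ell2"
  assumes y: "y \<in> ell2_on I" and f: "\<And>x. x \<in> ell2_on I \<Longrightarrow> f x = cinner x y"
  shows "dual_norm I f = norm y"
  unfolding dual_norm_def
proof (rule cSup_eq_maximum)
  show "norm y \<in> (\<lambda>x. cmod (f x)) ` {x \<in> ell2_on I. norm x \<le> 1}"
  proof (cases "y = 0")
    case True
    then show ?thesis
      by (intro image_eqI[of _ _ 0]) (auto simp: f cvec.subspace_0[OF subspace_ell2_on])
  next
    case False
    have "inverse (norm y) *\<^sub>R y \<in> ell2_on I"
      unfolding scaleR_scaleC by (rule cvec.subspace_scale[OF subspace_ell2_on y])
    then show ?thesis
      using False
      by (intro image_eqI[of _ _ "inverse (norm y) *\<^sub>R y"])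
        (auto simp: f cinner_scaleR_left cinner_self norm_mult norm_inverse power2_eq_square)
  qed
  fix t assume "t \<in> (\<lambda>x. cmod (f x)) ` {x \<in> ell2_on I. norm x \<le> 1}"
  then obtain x where x: "x \<in> ell2_on I" "norm x \<le> 1" "t = cmod (cinner x y)"
    using f by auto
  have "t \<le> norm x * norm y" unfolding x(3) by (rule cmod_cinner_le)
  also have "\<dots> \<le> 1 * norm y" by (rule mult_right_mono[OF x(2)]) simp
  finally show "t \<le> norm y" by simp
qed

text \<open>By the Riesz representation theorem the Banach space adjoint of \<open>B - z\<close> on the dual space is
  antiunitarily equivalent to the Hilbert space adjoint \<open>B' - cnj z\<close>.\<close>
lemma mu_less_iff:
  fixes B B' :: "('g, 'y::complex_hilbert_space) ell2 \<Rightarrow>\<^sub>L ('g, 'y) ell2"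
  assumes adj: "adjoint_pair B B'"
    and inv: "\<And>x. x \<in> ell2_on I \<Longrightarrow> B x \<in> ell2_on I" "\<And>x. x \<in> ell2_on I \<Longrightarrow> B' x \<in> ell2_on I"
  shows "mu I (\<lambda>x. B x - z *\<^sub>C x) < ennreal e \<longleftrightarrow>
    pseudo_eigenvalue (ell2_on I) B z e \<or> pseudo_eigenvalue (ell2_on I) B' (cnj z) e"
proof -
  note sub = cvec.subspace_diff[OF subspace_ell2_on] cvec.subspace_scale[OF subspace_ell2_on]
  have adj': "cinner (B x - z *\<^sub>C x) y = cinner x (B' y - cnj z *\<^sub>C y)" for x y
    using adj by (simp add: adjoint_pair_def cinner_diff_left cinner_diff_right cinner_scaleC_left
        cinner_scaleC_right)
  have "(\<exists>f\<in>dual_ell2 I. dual_norm I f = 1 \<and> dual_norm I (banach_adjoint (\<lambda>x. B x - z *\<^sub>C x) f) < e)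
    \<longleftrightarrow> (\<exists>y\<in>ell2_on I. norm y = 1 \<and> norm (B' y - cnj z *\<^sub>C y) < e)"
  proof -
    have norms: "dual_norm I f = norm y"
      "dual_norm I (banach_adjoint (\<lambda>x. B x - z *\<^sub>C x) f) = norm (B' y - cnj z *\<^sub>C y)"
      if y: "y \<in> ell2_on I" and f: "\<And>x. x \<in> ell2_on I \<Longrightarrow> f x = cinner x y" for f y
    proof -
      show "dual_norm I f = norm y" by (rule dual_norm_eq_norm[OF y f])
      show "dual_norm I (banach_adjoint (\<lambda>x. B x - z *\<^sub>C x) f) = norm (B' y - cnj z *\<^sub>C y)"
        by (rule dual_norm_eq_norm)
          (auto simp: banach_adjoint_def f y sub inv adj')
    qed
    have riesz: "\<exists>y\<in>ell2_on I. \<forall>x\<in>ell2_on I. f x = cinner x y" if f: "f \<in> dual_ell2 I"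
      for f :: "('g, 'y) ell2 \<Rightarrow> complex"
    proof -
      obtain C where C: "\<forall>x\<in>ell2_on I. cmod (f x) \<le> C * norm x" using f unfolding dual_ell2_def by blast
      obtain y where "y \<in> ell2_on I" "\<And>x. x \<in> ell2_on I \<Longrightarrow> f x = cinner x y"
        by (rule riesz_representation[OF subspace_ell2_on closed_ell2_on, of I f C])
          (use f C in \<open>simp_all add: dual_ell2_def\<close>)
      then show ?thesis by blast
    qed
    have dual: "(\<lambda>x. cinner x y) \<in> dual_ell2 I" for y :: "('g, 'y) ell2"
    proof -
      have "\<exists>C. \<forall>x\<in>ell2_on I. cmod (cinner x y) \<le> C * norm x"
        using cmod_cinner_le[of _ y] by (intro exI[of _ "norm y"]) (simp add: mult.commute)
      then show ?thesis by (simp add: dual_ell2_def cinner_add_left cinner_scaleC_left)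
    qed
    show ?thesis
    proof
      assume "\<exists>f\<in>dual_ell2 I. dual_norm I f = 1 \<and> dual_norm I (banach_adjoint (\<lambda>x. B x - z *\<^sub>C x) f) < e"
      then obtain f where f: "f \<in> dual_ell2 I" "dual_norm I f = 1"
        "dual_norm I (banach_adjoint (\<lambda>x. B x - z *\<^sub>C x) f) < e" by blast
      obtain y where "y \<in> ell2_on I" "\<And>x. x \<in> ell2_on I \<Longrightarrow> f x = cinner x y"
        using riesz[OF f(1)] by blast
      then show "\<exists>y\<in>ell2_on I. norm y = 1 \<and> norm (B' y - cnj z *\<^sub>C y) < e"
        using f(2,3) norms[of y f] by metis
    next
      assume "\<exists>y\<in>ell2_on I. norm y = 1 \<and> norm (B' y - cnj z *\<^sub>C y) < e"
      then obtain y where y: "y \<in> ell2_on I" "norm y = 1" "norm (B' y - cnj z *\<^sub>C y) < e" by blast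
      then show "\<exists>f\<in>dual_ell2 I. dual_norm I f = 1 \<and> dual_norm I (banach_adjoint (\<lambda>x. B x - z *\<^sub>C x) f) < e"
        by (intro bexI[OF _ dual[of y]]) (simp add: norms)
    qed
  qed
  moreover have "0 \<le> dual_norm I f" if f: "f \<in> dual_ell2 I" for f :: "('g, 'y) ell2 \<Rightarrow> complex"
  proof -
    obtain C where C: "\<forall>x\<in>ell2_on I. cmod (f x) \<le> C * norm x" using f unfolding dual_ell2_def by blast
    have "bdd_above ((\<lambda>x. cmod (f x)) ` {x \<in> ell2_on I. norm x \<le> 1})"
    proof (rule bdd_aboveI2)
      fix x :: "('g, 'y) ell2" assume x: "x \<in> {x \<in> ell2_on I. norm x \<le> 1}"
      then have "cmod (f x) \<le> C * norm x" using C by blast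
      also have "\<dots> \<le> \<bar>C\<bar> * norm x" by (intro mult_right_mono) auto
      also have "\<dots> \<le> \<bar>C\<bar> * 1" using x by (intro mult_left_mono) auto
      finally show "cmod (f x) \<le> \<bar>C\<bar>" by simp
    qed
    then have "cmod (f 0) \<le> dual_norm I f"
      unfolding dual_norm_def
      by (intro cSUP_upper) (auto simp: cvec.subspace_0[OF subspace_ell2_on])
    then show ?thesis using norm_ge_zero order_trans by blast
  qed
  moreover have "banach_adjoint (\<lambda>x. B x - z *\<^sub>C x) f \<in> dual_ell2 I" if f: "f \<in> dual_ell2 I" for f
  proof -
    obtain C where C: "\<forall>x\<in>ell2_on I. cmod (f x) \<le> C * norm x" using f unfolding dual_ell2_def by blast
    have inv': "B x - z *\<^sub>C x \<in> ell2_on I" if "x \<in> ell2_on I" for x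
      using that by (intro sub inv)
    have "cmod (f (B x - z *\<^sub>C x)) \<le> (\<bar>C\<bar> * (norm B + cmod z)) * norm x" if "x \<in> ell2_on I" for x
    proof -
      have "cmod (f (B x - z *\<^sub>C x)) \<le> C * norm (B x - z *\<^sub>C x)" using C inv'[OF that] by blast
      also have "\<dots> \<le> \<bar>C\<bar> * norm (B x - z *\<^sub>C x)" by (intro mult_right_mono) auto
      also have "\<dots> \<le> \<bar>C\<bar> * (norm B * norm x + cmod z * norm x)"
        using norm_triangle_ineq4[of "B x" "z *\<^sub>C x"] norm_blinfun[of B x]
        by (intro mult_left_mono) (auto simp: norm_scaleC)
      finally show ?thesis by (simp add: algebra_simps)
    qed
    moreover have "f (B (x + y) - z *\<^sub>C (x + y)) = f (B x - z *\<^sub>C x) + f (B y - z *\<^sub>C y)"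
      if "x \<in> ell2_on I" "y \<in> ell2_on I" for x y
    proof -
      have "B (x + y) - z *\<^sub>C (x + y) = (B x - z *\<^sub>C x) + (B y - z *\<^sub>C y)"
        by (simp add: blinfun.add_right scaleC_add_right)
      then show ?thesis using f inv'[OF that(1)] inv'[OF that(2)] by (simp add: dual_ell2_def)
    qed
    moreover have "f (B (c *\<^sub>C x) - z *\<^sub>C c *\<^sub>C x) = c * f (B x - z *\<^sub>C x)" if "x \<in> ell2_on I" for c x
    proof -
      have "B (c *\<^sub>C x) - z *\<^sub>C c *\<^sub>C x = c *\<^sub>C (B x - z *\<^sub>C x)"
        using adj by (simp add: adjoint_pair_def clinear_op_def cvec.scale_right_diff_distrib
            cvec.scale_left_commute)
      then show ?thesis using f inv'[OF that] by (simp add: dual_ell2_def)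
    qed
    ultimately show ?thesis
      unfolding dual_ell2_def banach_adjoint_def by auto
  qed
  ultimately show ?thesis
    unfolding mu_def min_less_iff_disj
    by (simp add: lower_norm_less_iff normalize_pseudo_eigenvector[OF subspace_ell2_on])
qed

section \<open>Level sets of the pseudospectrum have no interior\<close>

text \<open>\<open>B\<close> is regarded as an operator on \<open>S\<close>, although its type says that it lives on the whole
  space. Invariance of \<open>S\<close> under \<open>B'\<close> makes the restriction of \<open>B'\<close> the adjoint of the restriction
  of \<open>B\<close>, and everything holds for the pair \<open>B', B\<close> as well.\<close>
locale hilbert_operator =
  fixes S :: "'a::complex_hilbert_space set" and B B' :: "'a \<Rightarrow>\<^sub>L 'a"
  assumes subspace: "cvec.subspace S" and closed: "closed S"
    and adjoint: "adjoint_pair B B'"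
    and inv: "\<And>x. x \<in> S \<Longrightarrow> B x \<in> S" and inv': "\<And>x. x \<in> S \<Longrightarrow> B' x \<in> S"
begin

lemma dual: "hilbert_operator S B' B"
  by unfold_locales (auto intro: subspace closed inv inv' adjoint_pair_sym[OF adjoint])

lemma shifted_in: "x \<in> S \<Longrightarrow> B x - z *\<^sub>C x \<in> S"
  by (intro cvec.subspace_diff[OF subspace] cvec.subspace_scale[OF subspace] inv)

lemma shifted_scale: "B (c *\<^sub>C x) - z *\<^sub>C c *\<^sub>C x = c *\<^sub>C (B x - z *\<^sub>C x)"
  using adjoint by (simp add: adjoint_pair_def clinear_op_def cvec.scale_right_diff_distrib
      cvec.scale_left_commute)

lemma shifted_linear: "linear (\<lambda>x. B x - z *\<^sub>C x)"
  by (rule linearI) (simp_all add: blinfun.add_right scaleC_add_right blinfun.scaleR_right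
      scaleC_scaleR_commute scaleR_right_diff_distrib)

lemma shifted_bound: "norm (B x - z *\<^sub>C x) \<le> (norm B + cmod z) * norm x"
  using norm_triangle_ineq4[of "B x" "z *\<^sub>C x"] norm_blinfun[of B x]
  by (simp add: norm_scaleC distrib_right)

lemma shifted_surj:
  assumes "0 < e" "\<not> pseudo_eigenvalue S B z e" "\<not> pseudo_eigenvalue S B' (cnj z) e"
  shows "(\<lambda>x. B x - z *\<^sub>C x) ` S = S"
proof (rule bounded_below_imp_surj[OF subspace closed \<open>0 < e\<close>, where T' = "\<lambda>y. B' y - cnj z *\<^sub>C y"])
  show "linear (\<lambda>x. B x - z *\<^sub>C x)" by (rule shifted_linear)
  have "bounded_linear (\<lambda>x. B x - z *\<^sub>C x)"
    by (rule bounded_linear_intro[where K = "norm B + cmod z"])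
      (use linear_add[OF shifted_linear[of z]] linear_scale[OF shifted_linear[of z]]
        shifted_bound[of _ z] in \<open>simp_all add: mult.commute\<close>)
  then show "continuous_on S (\<lambda>x. B x - z *\<^sub>C x)"
    using bounded_linear.continuous_on[OF _ continuous_on_id] by blast
  show "B' y - cnj z *\<^sub>C y \<in> S" if "y \<in> S" for y
    by (rule hilbert_operator.shifted_in[OF dual that])
  show "cinner (B x - z *\<^sub>C x) y = cinner x (B' y - cnj z *\<^sub>C y)" for x y
    using adjoint by (simp add: adjoint_pair_def cinner_diff_left cinner_diff_right
        cinner_scaleC_left cinner_scaleC_right)
qed (use assms shifted_in shifted_scale in \<open>auto simp: not_pseudo_eigenvalue_iff\<close>)

end

lemma parallelogram_law:
  "(norm (x + y))\<^sup>2 + (norm (x - y))\<^sup>2 = 2 * (norm x)\<^sup>2 + 2 * (norm (y::'a::complex_hilbert_space))\<^sup>2"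
  by (simp add: power2_norm_add power2_norm_diff)

text \<open>Parseval's identity for the polynomial \<open>a + w b + w\<^sup>2 c + w\<^sup>3 d\<close> on the four points
  \<open>w = r, - r, \<i> r, - \<i> r\<close>, with the contributions of \<open>c\<close> and \<open>d\<close> dropped.\<close>
lemma cubic_mean_value:
  fixes a b c d :: "'a::complex_hilbert_space" and r M :: real
  assumes M: "\<And>w. w ^ 4 = complex_of_real (r ^ 4) \<Longrightarrow>
    norm (a + w *\<^sub>C b + w\<^sup>2 *\<^sub>C c + w ^ 3 *\<^sub>C d) \<le> M"
  shows "(norm a)\<^sup>2 + r\<^sup>2 * (norm b)\<^sup>2 \<le> M\<^sup>2"
proof -
  define P where "P w = a + w *\<^sub>C b + w\<^sup>2 *\<^sub>C c + w ^ 3 *\<^sub>C d" for w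
  define R where "R = complex_of_real r"
  have bound: "(norm (P w))\<^sup>2 \<le> M\<^sup>2" if "w ^ 4 = R ^ 4" for w
    using M[of w] that by (intro power_mono) (auto simp: P_def R_def)
  have pair: "(norm (P w))\<^sup>2 + (norm (P (- w)))\<^sup>2
      = 2 * (norm (a + w\<^sup>2 *\<^sub>C c))\<^sup>2 + 2 * (cmod w)\<^sup>2 * (norm (b + w\<^sup>2 *\<^sub>C d))\<^sup>2" for w
  proof -
    have 1: "P w = (a + w\<^sup>2 *\<^sub>C c) + w *\<^sub>C (b + w\<^sup>2 *\<^sub>C d)"
      by (simp add: P_def scaleC_add_right scaleC_scaleC power3_eq_cube power2_eq_square mult.assoc)
    have 2: "P (- w) = (a + w\<^sup>2 *\<^sub>C c) - w *\<^sub>C (b + w\<^sup>2 *\<^sub>C d)"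
      by (simp add: P_def scaleC_add_right scaleC_scaleC power3_eq_cube power2_eq_square mult.assoc
          cvec.scale_minus_left)
    show ?thesis unfolding 1 2 parallelogram_law by (simp add: norm_scaleC power_mult_distrib)
  qed
  have "(norm (P R))\<^sup>2 + (norm (P (- R)))\<^sup>2 + ((norm (P (\<i> * R)))\<^sup>2 + (norm (P (- (\<i> * R))))\<^sup>2)
    = 2 * ((norm (a + R\<^sup>2 *\<^sub>C c))\<^sup>2 + (norm (a - R\<^sup>2 *\<^sub>C c))\<^sup>2)
      + 2 * r\<^sup>2 * ((norm (b + R\<^sup>2 *\<^sub>C d))\<^sup>2 + (norm (b - R\<^sup>2 *\<^sub>C d))\<^sup>2)"
    unfolding pair by (simp add: power_mult_distrib R_def norm_mult cvec.scale_minus_left algebra_simps)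
  also have "\<dots> = 4 * ((norm a)\<^sup>2 + (norm (R\<^sup>2 *\<^sub>C c))\<^sup>2) + 4 * r\<^sup>2 * ((norm b)\<^sup>2 + (norm (R\<^sup>2 *\<^sub>C d))\<^sup>2)"
    unfolding parallelogram_law by (simp add: algebra_simps)
  also have "\<dots> \<ge> 4 * ((norm a)\<^sup>2 + r\<^sup>2 * (norm b)\<^sup>2)"
    by (simp add: algebra_simps)
  moreover have "(norm (P R))\<^sup>2 + (norm (P (- R)))\<^sup>2 + ((norm (P (\<i> * R)))\<^sup>2 + (norm (P (- (\<i> * R))))\<^sup>2)
    \<le> M\<^sup>2 + M\<^sup>2 + (M\<^sup>2 + M\<^sup>2)"
    by (intro add_mono bound) (auto simp: power_mult_distrib)
  ultimately show ?thesis by argo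
qed

context hilbert_operator
begin

text \<open>A maximum principle: if \<open>\<parallel>(B - z)\<^sup>-\<^sup>1\<parallel> \<le> 1/e\<close> on a disc, then the bound is not attained at
  the centre. In the power series \<open>(B - z\<^sub>0 - w)\<^sup>-\<^sup>1 = \<Sum>n. w\<^sup>n (B - z\<^sub>0)\<^sup>-\<^sup>n\<^sup>-\<^sup>1\<close> the term with
  \<open>n = 1\<close> is bounded below and contributes, by Parseval, to the mean of
  \<open>\<parallel>(B - z\<^sub>0 - w)\<^sup>-\<^sup>1 x\<parallel>\<^sup>2\<close> over the points of a circle. Four points suffice, with the series cut off
  after the cubic term: on them \<open>w\<^sup>4\<close> is constant, and the error \<open>w\<^sup>4 v\<close> is of higher order than the
  gain \<open>\<bar>w\<bar>\<^sup>2\<close>.\<close>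
lemma resolvent_maximum_principle:
  assumes "0 < e" "0 < r"
    and low: "\<And>z. dist z z0 \<le> r \<Longrightarrow> \<not> pseudo_eigenvalue S B z e"
    and low': "\<not> pseudo_eigenvalue S B' (cnj z0) e"
  obtains \<eta> where "e < \<eta>" "\<not> pseudo_eigenvalue S B z0 \<eta>"
proof -
  define T where "T x = B x - z0 *\<^sub>C x" for x
  define K where "K = norm B + cmod z0 + 1"
  have K: "0 < K" by (simp add: K_def add_nonneg_pos)
  have TK: "norm (T x) \<le> K * norm x" for x
    using shifted_bound[of x z0] norm_ge_zero[of x] unfolding T_def K_def distrib_right mult_1
    by linarith
  have Tlow: "e * norm x \<le> norm (T x)" if "x \<in> S" for x
    using low[of z0] \<open>0 < r\<close> that by (simp add: T_def not_pseudo_eigenvalue_iff)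
  have T_in: "T x \<in> S" if "x \<in> S" for x using shifted_in[OF that] by (simp add: T_def)
  have Tsurj: "\<exists>x\<in>S. T x = y" if "y \<in> S" for y
    using that \<open>0 < r\<close> low' unfolding T_def
    by (subst (asm) shifted_surj[OF \<open>0 < e\<close> low low', symmetric]) auto
  have T_add: "T (x + y) = T x + T y" for x y
    using linear_add[OF shifted_linear[of z0]] by (simp add: T_def)
  have T_scale: "T (c *\<^sub>C x) = c *\<^sub>C T x" for c x
    using shifted_scale by (simp add: T_def)
  \<comment> \<open>The radius \<open>\<rho>\<close> is so small that the gain \<open>e\<^sup>2 \<rho>\<^sup>2 / K\<^sup>2\<close> from the linear term beats the truncation
    error, which is of order \<open>\<rho>\<^sup>4\<close>; then there is still room for some \<open>\<eta> > e\<close>.\<close>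
  have "((\<lambda>\<rho>::real. \<rho>\<^sup>2 * (2 / e\<^sup>2 + \<rho> ^ 4 / e ^ 6)) \<longlongrightarrow> 0\<^sup>2 * (2 / e\<^sup>2 + 0 ^ 4 / e ^ 6)) (at_right 0)"
    by (intro tendsto_intros) (use \<open>0 < e\<close> in auto)
  then have "\<forall>\<^sub>F \<rho> in at_right 0. \<rho>\<^sup>2 * (2 / e\<^sup>2 + \<rho> ^ 4 / e ^ 6) < e\<^sup>2 / K\<^sup>2"
    by (rule order_tendstoD(2)) (use \<open>0 < e\<close> K in simp)
  then have "\<forall>\<^sub>F \<rho> in at_right 0. \<rho>\<^sup>2 * (2 / e\<^sup>2 + \<rho> ^ 4 / e ^ 6) < e\<^sup>2 / K\<^sup>2 \<and> 0 < \<rho> \<and> \<rho> < r"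
    using eventually_at_right_less[of "0::real"] eventually_at_right_real[OF \<open>0 < r\<close>]
    by eventually_elim auto
  then obtain \<rho> where \<rho>: "\<rho>\<^sup>2 * (2 / e\<^sup>2 + \<rho> ^ 4 / e ^ 6) < e\<^sup>2 / K\<^sup>2" "0 < \<rho>" "\<rho> < r"
    using eventually_happens[of _ "at_right (0::real)"] by auto
  have "(e + \<rho> ^ 4 / e ^ 3)\<^sup>2 = e\<^sup>2 + \<rho>\<^sup>2 * (\<rho>\<^sup>2 * (2 / e\<^sup>2 + \<rho> ^ 4 / e ^ 6))"
    using \<open>0 < e\<close> by (simp add: field_simps power2_eq_square eval_nat_numeral)
  also have "\<dots> < e\<^sup>2 + \<rho>\<^sup>2 * (e\<^sup>2 / K\<^sup>2)"
    using \<rho> by (intro add_strict_left_mono mult_strict_left_mono) auto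
  finally have lt: "(e + \<rho> ^ 4 / e ^ 3)\<^sup>2 < e\<^sup>2 * (1 + \<rho>\<^sup>2 / K\<^sup>2)" by (simp add: field_simps)
  have "((\<lambda>\<eta>. (\<eta> + \<rho> ^ 4 / e ^ 3)\<^sup>2) \<longlongrightarrow> (e + \<rho> ^ 4 / e ^ 3)\<^sup>2) (at_right e)"
    by (intro tendsto_intros)
  then have "\<forall>\<^sub>F \<eta> in at_right e. (\<eta> + \<rho> ^ 4 / e ^ 3)\<^sup>2 < e\<^sup>2 * (1 + \<rho>\<^sup>2 / K\<^sup>2)"
    by (rule order_tendstoD(2)[OF _ lt])
  then have "\<forall>\<^sub>F \<eta> in at_right e. (\<eta> + \<rho> ^ 4 / e ^ 3)\<^sup>2 < e\<^sup>2 * (1 + \<rho>\<^sup>2 / K\<^sup>2) \<and> e < \<eta>"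
    using eventually_at_right_less[of e] by eventually_elim auto
  then obtain \<eta> where \<eta>: "(\<eta> + \<rho> ^ 4 / e ^ 3)\<^sup>2 < e\<^sup>2 * (1 + \<rho>\<^sup>2 / K\<^sup>2)" "e < \<eta>"
    using eventually_happens[of _ "at_right e"] by auto
  have "\<not> pseudo_eigenvalue S B z0 \<eta>"
  proof
    assume "pseudo_eigenvalue S B z0 \<eta>"
    then obtain y where y: "y \<in> S" "norm (T y) < \<eta> * norm y"
      by (auto simp: pseudo_eigenvalue_def T_def)
    obtain y1 where y1: "y1 \<in> S" "T y1 = y" using Tsurj[OF y(1)] by blast
    obtain y2 where y2: "y2 \<in> S" "T y2 = y1" using Tsurj[OF y1(1)] by blast
    obtain v where v: "v \<in> S" "T v = y2" using Tsurj[OF y2(1)] by blast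
    have "e ^ 3 * norm v \<le> norm y"
    proof -
      have "e ^ 3 * norm v = e * (e * (e * norm v))" by (simp add: power3_eq_cube)
      also have "\<dots> \<le> e * (e * norm y2)"
        using Tlow[OF v(1)] v(2) \<open>0 < e\<close> by (intro mult_left_mono) auto
      also have "\<dots> \<le> e * norm y1"
        using Tlow[OF y2(1)] y2(2) \<open>0 < e\<close> by (intro mult_left_mono) auto
      also have "\<dots> \<le> norm y" using Tlow[OF y1(1)] y1(2) by simp
      finally show ?thesis .
    qed
    then have nv: "norm v \<le> norm y / e ^ 3" using \<open>0 < e\<close> by (simp add: field_simps)
    have ny1: "norm y / K \<le> norm y1" using TK[of y1] y1(2) K by (simp add: field_simps)
    have "norm (y + w *\<^sub>C y1 + w\<^sup>2 *\<^sub>C y2 + w ^ 3 *\<^sub>C v) \<le> (\<eta> + \<rho> ^ 4 / e ^ 3) * norm y / e"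
      if w: "w ^ 4 = complex_of_real (\<rho> ^ 4)" for w
    proof -
      \<comment> \<open>The truncated resolvent series, applied to \<open>T y = T\<^sup>4 v\<close>.\<close>
      define u where "u = y + w *\<^sub>C y1 + w\<^sup>2 *\<^sub>C y2 + w ^ 3 *\<^sub>C v"
      have "cmod w ^ 4 = \<rho> ^ 4"
        using arg_cong[OF w, of cmod] \<rho>(2) by (simp add: norm_power)
      then have cw: "cmod w = \<rho>" using \<rho>(2) power_eq_iff_eq_base[of 4 "cmod w" \<rho>] by simp
      have uS: "u \<in> S"
        unfolding u_def by (intro cvec.subspace_add[OF subspace] cvec.subspace_scale[OF subspace] y y1 y2 v)
      have "B u - (z0 + w) *\<^sub>C u = T u - w *\<^sub>C u"
        by (simp add: T_def scaleC_add_left)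
      also have "\<dots> = T y - w ^ 4 *\<^sub>C v"
        by (simp add: u_def T_add T_scale y1 y2 v scaleC_add_right scaleC_scaleC eval_nat_numeral mult_ac)
      finally have eq: "B u - (z0 + w) *\<^sub>C u = T y - w ^ 4 *\<^sub>C v" .
      have "e * norm u \<le> norm (B u - (z0 + w) *\<^sub>C u)"
        using low[of "z0 + w"] uS cw \<rho>(3) by (simp add: not_pseudo_eigenvalue_iff dist_norm)
      also have "\<dots> \<le> norm (T y) + \<rho> ^ 4 * norm v"
        unfolding eq using norm_triangle_ineq4[of "T y" "w ^ 4 *\<^sub>C v"]
        by (simp add: norm_scaleC norm_power cw)
      also have "\<dots> \<le> \<eta> * norm y + \<rho> ^ 4 * (norm y / e ^ 3)"
        using y(2) nv \<rho>(2) by (intro add_mono mult_left_mono) auto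
      finally show ?thesis using \<open>0 < e\<close> by (simp add: u_def field_simps)
    qed
    then have "(norm y)\<^sup>2 + \<rho>\<^sup>2 * (norm y1)\<^sup>2 \<le> ((\<eta> + \<rho> ^ 4 / e ^ 3) * norm y / e)\<^sup>2"
      by (rule cubic_mean_value)
    moreover have "(norm y)\<^sup>2 + \<rho>\<^sup>2 * (norm y / K)\<^sup>2 \<le> (norm y)\<^sup>2 + \<rho>\<^sup>2 * (norm y1)\<^sup>2"
      using ny1 K by (intro add_left_mono mult_left_mono power_mono) auto
    ultimately have "(norm y)\<^sup>2 + \<rho>\<^sup>2 * (norm y / K)\<^sup>2 \<le> ((\<eta> + \<rho> ^ 4 / e ^ 3) * norm y / e)\<^sup>2"
      by (rule order_trans[rotated])
    also have "\<dots> = (\<eta> + \<rho> ^ 4 / e ^ 3)\<^sup>2 * (norm y)\<^sup>2 / e\<^sup>2"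
      by (simp add: power_mult_distrib power_divide)
    finally have "((norm y)\<^sup>2 + \<rho>\<^sup>2 * (norm y / K)\<^sup>2) * e\<^sup>2 \<le> (\<eta> + \<rho> ^ 4 / e ^ 3)\<^sup>2 * (norm y)\<^sup>2"
      using \<open>0 < e\<close> by (simp add: pos_le_divide_eq)
    then have "e\<^sup>2 * (1 + \<rho>\<^sup>2 / K\<^sup>2) * (norm y)\<^sup>2 \<le> (\<eta> + \<rho> ^ 4 / e ^ 3)\<^sup>2 * (norm y)\<^sup>2"
      by (simp add: power_divide distrib_left distrib_right mult_ac)
    moreover have "0 < (norm y)\<^sup>2" using y(2) by (cases "y = 0") (auto simp: T_def)
    ultimately show False using \<eta>(1) by (simp add: mult_le_cancel_right)
  qed
  with \<eta>(2) show ?thesis by (rule that)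
qed

text \<open>By Riesz representation this is \<open>spec\<^sub>e\<close> of the restriction of \<open>B\<close> to \<open>S\<close>.\<close>
definition pseudospectrum :: "real \<Rightarrow> complex set" where
  "pseudospectrum e = {z. pseudo_eigenvalue S B z e \<or> pseudo_eigenvalue S B' (cnj z) e}"

text \<open>If \<open>z\<^sub>0\<close> were at positive distance from the open pseudospectrum, the maximum principle for \<open>B\<close>
  and for \<open>B'\<close> would keep both lower norms at \<open>z\<^sub>0\<close> strictly above \<open>e\<close>. This needs the parallelogram
  law; in a general Banach space the resolvent norm can be constant on an open set.\<close>
theorem closed_pseudospectrum_subset_closure:
  assumes "0 < e" and z0: "\<And>\<eta>. e < \<eta> \<Longrightarrow> z0 \<in> pseudospectrum \<eta>"
  shows "z0 \<in> closure (pseudospectrum e)"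
proof (rule ccontr)
  assume "z0 \<notin> closure (pseudospectrum e)"
  then obtain r where r: "0 < r" "\<And>z. dist z z0 < r \<Longrightarrow> z \<notin> pseudospectrum e"
    by (auto simp: closure_approachable)
  have low: "\<not> pseudo_eigenvalue S B z e" "\<not> pseudo_eigenvalue S B' (cnj z) e"
    if "dist z z0 \<le> r / 2" for z
    using r that by (auto simp: pseudospectrum_def)
  obtain \<eta>1 where \<eta>1: "e < \<eta>1" "\<not> pseudo_eigenvalue S B z0 \<eta>1"
    using resolvent_maximum_principle[OF \<open>0 < e\<close> half_gt_zero[OF \<open>0 < r\<close>] low(1) low(2)[of z0]] r(1)
    by auto
  have "dist (cnj z) z0 = dist z (cnj z0)" for z
    using complex_mod_cnj[of "z - cnj z0"] by (simp add: dist_norm)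
  then have "\<not> pseudo_eigenvalue S B' z e" if "dist z (cnj z0) \<le> r / 2" for z
    using low(2)[of "cnj z"] that by simp
  then obtain \<eta>2 where \<eta>2: "e < \<eta>2" "\<not> pseudo_eigenvalue S B' (cnj z0) \<eta>2"
    using hilbert_operator.resolvent_maximum_principle[OF dual \<open>0 < e\<close> half_gt_zero[OF \<open>0 < r\<close>], of "cnj z0"]
      low(1)[of z0] r(1) by auto
  show False
    using z0[of "min \<eta>1 \<eta>2"] \<eta>1 \<eta>2 pseudo_eigenvalue_mono[of S _ _ "min \<eta>1 \<eta>2"]
    by (auto simp: pseudospectrum_def)
qed

section \<open>Pseudospectra are bounded and non-empty\<close>

lemma pseudospectrum_bounded:
  assumes "z \<in> pseudospectrum e" and "norm B \<le> C" and "norm B' \<le> C"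
  shows "cmod z \<le> C + e"
proof -
  have *: "cmod w \<le> C + e" if w: "pseudo_eigenvalue S D w e" and D: "norm D \<le> C" for w and D :: "'a \<Rightarrow>\<^sub>L 'a"
  proof -
    obtain x where x: "x \<in> S" "norm (D x - w *\<^sub>C x) < e * norm x"
      using w by (auto simp: pseudo_eigenvalue_def)
    have "norm (D x) \<le> C * norm x"
      by (rule order_trans[OF norm_blinfun]) (simp add: D mult_right_mono)
    then have "cmod w * norm x < (C + e) * norm x"
      using x norm_triangle_ineq2[of "w *\<^sub>C x" "D x"]
      by (simp add: norm_scaleC norm_minus_commute distrib_right)
    then show ?thesis by (simp add: mult_less_cancel_right split: if_splits) 
  qed
  show ?thesis using assms *[of B z] *[of B' "cnj z"] by (auto simp: pseudospectrum_def)
qed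

text \<open>Otherwise \<open>z \<mapsto> \<langle>(B - z)\<^sup>-\<^sup>1 x, y\<rangle>\<close> would be an entire function vanishing at infinity.\<close>
theorem pseudospectrum_nonempty:
  assumes "x0 \<in> S" "x0 \<noteq> 0" "0 < e"
  shows "pseudospectrum e \<noteq> {}"
proof
  assume empty: "pseudospectrum e = {}"
  then have low: "\<not> pseudo_eigenvalue S B z e" "\<not> pseudo_eigenvalue S B' (cnj z) e" for z
    by (auto simp: pseudospectrum_def)
  note sub = cvec.subspace_diff[OF subspace] cvec.subspace_scale[OF subspace]
  define T where "T z x = B x - z *\<^sub>C x" for z x
  define R where "R z x = (SOME u. u \<in> S \<and> T z u = x)" for z x
  have R: "R z x \<in> S" "T z (R z x) = x" if "x \<in> S" for z x
  proof -
    have "\<exists>u. u \<in> S \<and> T z u = x"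
      using that unfolding T_def by (subst (asm) shifted_surj[OF \<open>0 < e\<close> low, of z, symmetric]) auto
    then show "R z x \<in> S" "T z (R z x) = x"
      unfolding R_def by (metis (mono_tags, lifting) someI_ex)+
  qed
  have Tlow: "e * norm x \<le> norm (T z x)" if "x \<in> S" for z x
    using low(1)[of z] that by (simp add: T_def not_pseudo_eigenvalue_iff)
  have T_diff: "T z (x - y) = T z x - T z y" for z x y
    using linear_diff[OF shifted_linear[of z]] by (simp add: T_def)
  have T_scale: "T z (c *\<^sub>C x) = c *\<^sub>C T z x" for z c x
    unfolding T_def by (rule shifted_scale)
  have R_unique: "R z x = u" if "u \<in> S" "T z u = x" "x \<in> S" for z x u
  proof -
    have "e * norm (R z x - u) \<le> norm (T z (R z x - u))" by (intro Tlow sub R that)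
    then show ?thesis using R(2)[OF that(3)] that(2) \<open>0 < e\<close> by (simp add: T_diff mult_le_0_iff)
  qed
  have R_bound: "norm (R z x) \<le> norm x / e" if "x \<in> S" for z x
    using Tlow[OF R(1)[OF that], of z z] R(2)[OF that, of z] \<open>0 < e\<close> by (simp add: field_simps)
  have R_scale: "R z (c *\<^sub>C x) = c *\<^sub>C R z x" if "x \<in> S" for z c x
    by (intro R_unique sub that R) (simp add: T_scale R that)
  have resolvent: "R z x - R w x = (z - w) *\<^sub>C R z (R w x)" if x: "x \<in> S" for z w x
  proof -
    have "R z ((z - w) *\<^sub>C R w x) = R z x - R w x"
    proof (rule R_unique)
      have "T z (R w x) = T w (R w x) - (z - w) *\<^sub>C R w x"
        by (simp add: T_def cvec.scale_left_diff_distrib)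
      then show "T z (R z x - R w x) = (z - w) *\<^sub>C R w x"
        by (simp add: T_diff R x)
    qed (intro sub R x)+
    then show ?thesis by (simp add: R_scale R x)
  qed
  define y0 where "y0 = R 0 x0"
  define h where "h z = cinner (R z x0) y0" for z
  define h' where "h' w = cinner (R w (R w x0)) y0" for w
  have "(h has_field_derivative h' w) (at w)" for w
    unfolding has_field_derivative_iff
  proof (rule LIM_zero_cancel, rule Lim_null_comparison)
    show "\<forall>\<^sub>F z in at w. cmod ((h z - h w) / (z - w) - h' w) \<le> cmod (z - w) * (norm x0 / e / e / e * norm y0)"
      unfolding eventually_at_filter
    proof (intro always_eventually allI impI)
      fix z assume "z \<noteq> w"
      have x1: "R w x0 \<in> S" "R w (R w x0) \<in> S" by (intro R assms)+
      have "h z - h w = (z - w) * cinner (R z (R w x0)) y0"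
        by (simp add: h_def cinner_diff_left[symmetric] resolvent assms cinner_scaleC_left)
      then have "(h z - h w) / (z - w) - h' w = cinner (R z (R w x0) - R w (R w x0)) y0"
        using \<open>z \<noteq> w\<close> by (simp add: h'_def cinner_diff_left)
      also have "\<dots> = (z - w) * cinner (R z (R w (R w x0))) y0"
        by (simp add: resolvent x1 cinner_scaleC_left)
      finally have "cmod ((h z - h w) / (z - w) - h' w) \<le> cmod (z - w) * (norm (R z (R w (R w x0))) * norm y0)"
        by (simp add: norm_mult cmod_cinner_le mult_left_mono)
      also have "norm (R z (R w (R w x0))) \<le> norm x0 / e / e / e"
        using R_bound[OF x1(2), of z] R_bound[OF x1(1), of w] R_bound[OF assms(1), of w] \<open>0 < e\<close>
        by (meson divide_right_mono less_imp_le order_trans)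
      finally show "cmod ((h z - h w) / (z - w) - h' w) \<le> cmod (z - w) * (norm x0 / e / e / e * norm y0)"
        by (simp add: mult_left_mono mult_right_mono)
    qed
    have "((\<lambda>z. cmod (z - w) * (norm x0 / e / e / e * norm y0)) \<longlongrightarrow> cmod (w - w) * (norm x0 / e / e / e * norm y0)) (at w)"
      by (intro tendsto_intros)
    then show "((\<lambda>z. cmod (z - w) * (norm x0 / e / e / e * norm y0)) \<longlongrightarrow> 0) (at w)" by simp
  qed
  then have holo: "h holomorphic_on UNIV"
    by (simp add: holomorphic_on_def field_differentiable_def) blast
  have "(h \<longlongrightarrow> 0) at_infinity"
  proof (rule Lim_null_comparison)
    show "\<forall>\<^sub>F z in at_infinity. cmod (h z) \<le> (norm B + 1) * (norm x0 / e) * norm y0 * inverse (cmod z) + norm x0 * norm y0 * inverse (cmod z)"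
      unfolding eventually_at_infinity
    proof (intro exI[of _ 1] allI impI)
      fix z :: complex assume "1 \<le> cmod z"
      have "cmod z * norm (R z x0) \<le> norm (B (R z x0)) + norm x0"
        using R(2)[OF assms(1), of z] norm_triangle_ineq4[of "B (R z x0)" x0]
        by (auto simp: T_def norm_scaleC[symmetric] algebra_simps)
      also have "\<dots> \<le> (norm B + 1) * (norm x0 / e) + norm x0"
      proof -
        have "norm (B (R z x0)) \<le> norm B * norm (R z x0)" by (rule norm_blinfun)
        also have "\<dots> \<le> (norm B + 1) * (norm x0 / e)"
          using R_bound[OF assms(1), of z] by (intro mult_mono) auto
        finally show ?thesis by simp
      qed
      finally have "norm (R z x0) \<le> ((norm B + 1) * (norm x0 / e) + norm x0) * inverse (cmod z)"
        using \<open>1 \<le> cmod z\<close> unfolding divide_inverse[symmetric]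
        by (subst pos_le_divide_eq) (auto simp: mult.commute)
      then have "norm (R z x0) * norm y0 \<le> ((norm B + 1) * (norm x0 / e) + norm x0) * inverse (cmod z) * norm y0"
        by (rule mult_right_mono) simp
      then show "cmod (h z) \<le> (norm B + 1) * (norm x0 / e) * norm y0 * inverse (cmod z) + norm x0 * norm y0 * inverse (cmod z)"
        using cmod_cinner_le[of "R z x0" y0] by (simp add: h_def algebra_simps)
    qed
    have "((\<lambda>z::complex. (norm B + 1) * (norm x0 / e) * norm y0 * inverse (cmod z) + norm x0 * norm y0 * inverse (cmod z))
      \<longlongrightarrow> (norm B + 1) * (norm x0 / e) * norm y0 * 0 + norm x0 * norm y0 * 0) at_infinity"
      by (intro tendsto_intros tendsto_inverse_0_at_top filterlim_norm_at_top)
    then show "((\<lambda>z::complex. (norm B + 1) * (norm x0 / e) * norm y0 * inverse (cmod z) + norm x0 * norm y0 * inverse (cmod z)) \<longlongrightarrow> 0) at_infinity"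
      by simp
  qed
  then have "h 0 = 0" by (rule Liouville_weak_0[OF holo])
  then have "y0 = 0" by (simp add: h_def y0_def[symmetric] cinner_self)
  then have "x0 = T 0 0" using R(2)[OF assms(1), of 0] by (simp add: y0_def)
  with assms(2) show False by (simp add: T_def)
qed

end

section \<open>Localisation of approximate eigenvectors of band operators\<close>

lemma infsum_sum_finite:
  fixes f :: "'k \<Rightarrow> 'g \<Rightarrow> real"
  assumes "finite K" "\<And>k. k \<in> K \<Longrightarrow> f k summable_on UNIV"
  shows "(\<lambda>i. \<Sum>k\<in>K. f k i) summable_on UNIV \<and> (\<Sum>\<^sub>\<infinity>i. \<Sum>k\<in>K. f k i) = (\<Sum>k\<in>K. \<Sum>\<^sub>\<infinity>i. f k i)"
  using assms by (induction K rule: finite_induct) (auto simp: infsum_add intro!: summable_on_add)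

lemma L2_set_power2: "(L2_set f A)\<^sup>2 = (\<Sum>i\<in>A. (f i)\<^sup>2)"
  by (simp add: L2_set_def sum_nonneg)

text \<open>Fubini for a finite family of vectors that are dominated entrywise by multiples of \<open>u\<close>.\<close>
lemma L2_set_norm_ell2_le:
  fixes u :: "('g, 'y::complex_normed_space) ell2"
  assumes "finite K" "0 \<le> C"
    and y: "\<And>k i. k \<in> K \<Longrightarrow> norm (ell2_nth (y k) i) \<le> \<bar>c k i\<bar> * norm (ell2_nth u i)"
    and c: "\<And>i. L2_set (\<lambda>k. c k i) K \<le> C"
  shows "L2_set (\<lambda>k. norm (y k)) K \<le> C * norm u"
proof -
  note S = infsum_sum_finite[OF assms(1), of "\<lambda>k i. (norm (ell2_nth (y k) i))\<^sup>2", OF ell2_summable]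
  have "(\<Sum>k\<in>K. (norm (y k))\<^sup>2) = (\<Sum>\<^sub>\<infinity>i. \<Sum>k\<in>K. (norm (ell2_nth (y k) i))\<^sup>2)"
    using S by (simp add: norm_ell2_sq)
  also have "\<dots> \<le> (\<Sum>\<^sub>\<infinity>i. C\<^sup>2 * (norm (ell2_nth u i))\<^sup>2)"
  proof (rule infsum_mono)
    show "(\<lambda>i. C\<^sup>2 * (norm (ell2_nth u i))\<^sup>2) summable_on UNIV"
      by (intro summable_on_cmult_right ell2_summable)
    fix i
    have "(\<Sum>k\<in>K. (norm (ell2_nth (y k) i))\<^sup>2) \<le> (\<Sum>k\<in>K. (c k i)\<^sup>2 * (norm (ell2_nth u i))\<^sup>2)"
    proof (rule sum_mono)
      fix k assume "k \<in> K"
      from power_mono[OF y[OF this], of i 2]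
      show "(norm (ell2_nth (y k) i))\<^sup>2 \<le> (c k i)\<^sup>2 * (norm (ell2_nth u i))\<^sup>2"
        by (simp add: power_mult_distrib)
    qed
    also have "\<dots> = (L2_set (\<lambda>k. c k i) K)\<^sup>2 * (norm (ell2_nth u i))\<^sup>2"
      by (simp add: L2_set_power2 sum_distrib_right)
    also have "\<dots> \<le> C\<^sup>2 * (norm (ell2_nth u i))\<^sup>2"
      using c by (intro mult_right_mono power_mono) auto
    finally show "(\<Sum>k\<in>K. (norm (ell2_nth (y k) i))\<^sup>2) \<le> C\<^sup>2 * (norm (ell2_nth u i))\<^sup>2" .
  qed (use S in blast)
  also have "\<dots> = (C * norm u)\<^sup>2"
    by (simp add: infsum_cmult_right' norm_ell2_sq power_mult_distrib)
  finally show ?thesis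
    unfolding L2_set_def using \<open>0 \<le> C\<close> by (intro real_le_lsqrt) (auto simp: sum_nonneg)
qed

lemma L2_set_reflect_le:
  fixes \<psi> :: "'g::ab_group_add \<Rightarrow> real"
  assumes "square_summable \<psi>" "finite K"
  shows "L2_set (\<lambda>k. \<psi> (i - k)) K \<le> l2norm \<psi>"
proof -
  have "L2_set (\<lambda>k. \<psi> (i - k)) K = L2_set (\<lambda>m. norm (\<psi> m)) ((\<lambda>k. i - k) ` K)"
    unfolding L2_set_def by (subst sum.reindex) (auto simp: inj_on_def)
  also have "\<dots> \<le> l2norm \<psi>" using assms by (intro L2_set_le_l2norm) auto
  finally show ?thesis .
qed

lemma norm_shift_op: "norm (shift_op j x) = norm x"
  by (simp add: norm_ell2_def ext[of "ell2_nth (shift_op j x)", OF ell2_nth_shift_op]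
      square_summable_translate(2))

lemma proj_op_in: "proj_op S x \<in> ell2_on S"
  by (simp add: ell2_on_def ell2_nth_proj_op)

lemma proj_op_eq: "x \<in> ell2_on S \<Longrightarrow> proj_op S x = x"
  by (auto intro!: ell2_eqI simp: ell2_on_def ell2_nth_proj_op)

lemma norm_proj_op_le: "norm (proj_op S x) \<le> norm x"
proof -
  have "l2norm (ell2_nth (proj_op S x)) \<le> 1 * l2norm (ell2_nth x)"
    by (rule square_summable_dominated(2)[OF square_summable_ell2_nth]) (auto simp: ell2_nth_proj_op)
  then show ?thesis by (simp add: norm_ell2_def)
qed

lemma power2_norm_minus_proj_op:
  assumes "finite F"
  shows "(norm (x - proj_op F x))\<^sup>2 = (norm x)\<^sup>2 - (\<Sum>i\<in>F. (norm (ell2_nth x i))\<^sup>2)"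
proof -
  have "(\<Sum>\<^sub>\<infinity>i. (norm (ell2_nth (proj_op F x) i))\<^sup>2) = (\<Sum>\<^sub>\<infinity>i\<in>F. (norm (ell2_nth x i))\<^sup>2)"
    by (rule infsum_cong_neutral) (auto simp: ell2_nth_proj_op)
  moreover have "(norm x)\<^sup>2 = (norm (x - proj_op F x))\<^sup>2 + (norm (proj_op F x))\<^sup>2"
    unfolding norm_ell2_sq infsum_add[OF ell2_summable ell2_summable, symmetric]
    by (intro infsum_cong) (simp add: ell2_nth_proj_op)
  ultimately show ?thesis using assms by (simp add: norm_ell2_sq[of "proj_op F x"])
qed

lemma proj_op_tendsto: "((\<lambda>F. proj_op F x) \<longlongrightarrow> x) (finite_subsets_at_top UNIV)"
proof -
  have "((\<lambda>F. (norm x)\<^sup>2 - (\<Sum>i\<in>F. (norm (ell2_nth x i))\<^sup>2)) \<longlongrightarrow> (norm x)\<^sup>2 - (norm x)\<^sup>2)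
    (finite_subsets_at_top UNIV)"
    unfolding norm_ell2_sq
    by (intro tendsto_intros infsum_tendsto ell2_summable)
  moreover have "\<forall>\<^sub>F F in finite_subsets_at_top UNIV.
    (norm x)\<^sup>2 - (\<Sum>i\<in>F. (norm (ell2_nth x i))\<^sup>2) = (norm (proj_op F x - x))\<^sup>2"
    by (intro eventually_finite_subsets_at_top_weakI)
      (simp add: power2_norm_minus_proj_op norm_minus_commute)
  ultimately have "((\<lambda>F. (norm (proj_op F x - x))\<^sup>2) \<longlongrightarrow> 0) (finite_subsets_at_top UNIV)"
    using Lim_transform_eventually by fastforce
  then have "((\<lambda>F. sqrt ((norm (proj_op F x - x))\<^sup>2)) \<longlongrightarrow> sqrt 0) (finite_subsets_at_top UNIV)"
    by (rule tendsto_real_sqrt)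
  then have "((\<lambda>F. norm (proj_op F x - x)) \<longlongrightarrow> 0) (finite_subsets_at_top UNIV)" by simp
  then show ?thesis by (rule LIM_zero_cancel[OF tendsto_norm_zero_cancel])
qed

text \<open>With finite support only finitely many translates of a cut-off function see the vector, and
  the sums over translates below are finite.\<close>
lemma finitely_supported_pseudo_eigenvector:
  assumes "pseudo_eigenvalue UNIV A z e"
  obtains F x where "finite F" "x \<in> ell2_on F" "norm (A x - z *\<^sub>C x) < e * norm x"
proof -
  obtain x where x: "norm (A x - z *\<^sub>C x) < e * norm x" using assms by (auto simp: pseudo_eigenvalue_def)
  have scale: "bounded_linear (\<lambda>x. z *\<^sub>C x)"
    by (rule bounded_linear_intro[where K = "cmod z"])
      (auto simp: scaleC_add_right scaleC_scaleR_commute norm_scaleC)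
  have "((\<lambda>F. norm (A (proj_op F x) - z *\<^sub>C proj_op F x) - e * norm (proj_op F x)) \<longlongrightarrow>
    norm (A x - z *\<^sub>C x) - e * norm x) (finite_subsets_at_top UNIV)"
    by (intro tendsto_intros bounded_linear.tendsto[OF scale] proj_op_tendsto)
  then have "\<forall>\<^sub>F F in finite_subsets_at_top UNIV.
    norm (A (proj_op F x) - z *\<^sub>C proj_op F x) - e * norm (proj_op F x) < 0"
    by (rule order_tendstoD(2)) (use x in simp)
  then have "\<forall>\<^sub>F F in finite_subsets_at_top UNIV. finite F \<and>
    norm (A (proj_op F x) - z *\<^sub>C proj_op F x) - e * norm (proj_op F x) < 0"
    by (rule eventually_conj[OF eventually_finite_subsets_at_top_weakI, rotated])
  then obtain F where "finite F" "norm (A (proj_op F x) - z *\<^sub>C proj_op F x) - e * norm (proj_op F x) < 0"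
    using eventually_happens[of _ "finite_subsets_at_top UNIV"] by (metis (no_types, lifting) finite_subsets_at_top_neq_bot)
  then show ?thesis using that[of F "proj_op F x"] proj_op_in by auto
qed

text \<open>This is what is used of the term \<open>M\<^sub>b V\<^sub>j\<close> of an operator in the Wiener algebra. Unlike the
  coefficient function \<open>b\<close>, the property passes to adjoints at once.\<close>
definition diagonal_bounded ::
  "'g::ab_group_add \<Rightarrow> real \<Rightarrow> (('g, 'y::complex_normed_space) ell2 \<Rightarrow>\<^sub>L ('g, 'y) ell2) \<Rightarrow> bool" where
  "diagonal_bounded j a T \<longleftrightarrow> 0 \<le> a \<and>
    (\<forall>x i. norm (ell2_nth (T x) i) \<le> a * norm (ell2_nth x (i - j)))"

definition cutoff ::
  "('g::ab_group_add \<Rightarrow> real) \<Rightarrow> 'g \<Rightarrow> ('g, 'y::complex_normed_space) ell2 \<Rightarrow>\<^sub>L ('g, 'y) ell2" where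
  "cutoff \<phi> k = mult_op (\<lambda>i. \<phi> (i - k) *\<^sub>R id_blinfun)"

lemma ell2_nth_cutoff:
  fixes x :: "('g::ab_group_add, 'y::complex_normed_space) ell2"
  assumes "square_summable \<phi>"
  shows "ell2_nth (cutoff \<phi> k x) i = \<phi> (i - k) *\<^sub>R ell2_nth x i"
proof -
  have "\<bar>\<phi> m\<bar> \<le> l2norm \<phi>" for m
    using L2_set_le_l2norm[OF assms, of "{m}"] by simp
  then have "norm (\<phi> (i - k) *\<^sub>R (id_blinfun :: 'y \<Rightarrow>\<^sub>L 'y)) \<le> l2norm \<phi> * norm (id_blinfun :: 'y \<Rightarrow>\<^sub>L 'y)" for i
    by (simp add: mult_right_mono)
  then have "bounded (range (\<lambda>i. \<phi> (i - k) *\<^sub>R (id_blinfun :: 'y \<Rightarrow>\<^sub>L 'y)))"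
    unfolding bounded_iff by blast
  then show ?thesis unfolding cutoff_def
    by (subst ell2_nth_mult_op) (auto simp: blinfun.scaleR_left)
qed

text \<open>In the entry \<open>i\<close> the commutator multiplies \<open>x\<^sub>i\<^sub>-\<^sub>j\<close> by a difference of two values of \<open>\<phi>\<close>. When
  \<open>k\<close> runs through the group these differences run through all values of \<open>\<phi>(\<cdot> - j) - \<phi>\<close>, for every \<open>i\<close>,
  which is why averaging over the translates gives a bound by its norm.\<close>
lemma commutator_le:
  assumes \<phi>: "square_summable \<phi>" and T: "diagonal_bounded j a T" and "finite K"
  shows "L2_set (\<lambda>k. norm (T (cutoff \<phi> k x) - cutoff \<phi> k (T x))) K
    \<le> a * l2norm (\<lambda>m. \<phi> (m - j) - \<phi> m) * norm x"
proof -
  have diff: "square_summable (\<lambda>m. \<phi> (m - j) - \<phi> m)"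
    using square_summable_add(1)[OF square_summable_translate(1)[OF \<phi>], of "\<lambda>m. - \<phi> m" j] \<phi>
    by (simp add: square_summable_def)
  have "L2_set (\<lambda>k. norm (T (cutoff \<phi> k x) - cutoff \<phi> k (T x))) K
    \<le> a * l2norm (\<lambda>m. \<phi> (m - j) - \<phi> m) * norm (shift_op j x)"
  proof (rule L2_set_norm_ell2_le[OF \<open>finite K\<close>, where c = "\<lambda>k i. a * (\<phi> (i - k - j) - \<phi> (i - k))"])
    show "0 \<le> a * l2norm (\<lambda>m. \<phi> (m - j) - \<phi> m)"
      using T by (simp add: diagonal_bounded_def l2norm_nonneg)
    show "L2_set (\<lambda>k. a * (\<phi> (i - k - j) - \<phi> (i - k))) K \<le> a * l2norm (\<lambda>m. \<phi> (m - j) - \<phi> m)" for i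
      using L2_set_reflect_le[OF diff \<open>finite K\<close>, of i] T
      by (simp add: diagonal_bounded_def L2_set_right_distrib[symmetric] mult_left_mono)
    fix k i
    \<comment> \<open>\<open>T\<close> only sees the entry at \<open>i - j\<close>, so there \<open>cutoff \<phi> k\<close> may be replaced by a constant.\<close>
    have "T (cutoff \<phi> k x) - cutoff \<phi> k (T x) = T (cutoff \<phi> k x - \<phi> (i - k) *\<^sub>R x)
      + (\<phi> (i - k) *\<^sub>R T x - cutoff \<phi> k (T x))"
      by (simp add: blinfun.bilinear_simps)
    then have "ell2_nth (T (cutoff \<phi> k x) - cutoff \<phi> k (T x)) i
      = ell2_nth (T (cutoff \<phi> k x - \<phi> (i - k) *\<^sub>R x)) i"
      by (simp add: ell2_nth_cutoff[OF \<phi>])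
    also have "norm \<dots> \<le> a * norm (ell2_nth (cutoff \<phi> k x - \<phi> (i - k) *\<^sub>R x) (i - j))"
      using T unfolding diagonal_bounded_def by blast
    also have "\<dots> = \<bar>a * (\<phi> (i - k - j) - \<phi> (i - k))\<bar> * norm (ell2_nth (shift_op j x) i)"
      using T by (simp add: ell2_nth_cutoff[OF \<phi>] ell2_nth_shift_op scaleR_left_diff_distrib[symmetric]
          diagonal_bounded_def abs_mult diff_diff_eq add.commute)
    finally show "norm (ell2_nth (T (cutoff \<phi> k x) - cutoff \<phi> k (T x)) i)
      \<le> \<bar>a * (\<phi> (i - k - j) - \<phi> (i - k))\<bar> * norm (ell2_nth (shift_op j x) i)" .
  qed
  then show ?thesis by (simp add: norm_shift_op)
qed

lemma L2_set_cutoff_le: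
  assumes "square_summable \<phi>" "finite K"
  shows "L2_set (\<lambda>k. norm (cutoff \<phi> k x)) K \<le> l2norm \<phi> * norm x"
  by (rule L2_set_norm_ell2_le[OF assms(2) l2norm_nonneg, where c = "\<lambda>k i. \<phi> (i - k)"])
    (auto simp: ell2_nth_cutoff[OF assms(1)] L2_set_reflect_le[OF assms])

text \<open>The squares of the translates of \<open>\<phi>\<close> sum up to the constant \<open>\<parallel>\<phi>\<parallel>\<^sup>2\<close>. The set \<open>K\<close> collects the
  translates whose support meets that of \<open>x\<close>.\<close>
lemma L2_set_cutoff_eq:
  assumes "finite W" "finite F" and \<phi>: "\<And>m. m \<notin> W \<Longrightarrow> \<phi> m = 0" and x: "x \<in> ell2_on F"
  defines "K \<equiv> (\<lambda>(i, m). i - m) ` (F \<times> W)"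
  shows "L2_set (\<lambda>k. norm (cutoff \<phi> k x)) K = l2norm \<phi> * norm x"
proof -
  have sq: "square_summable \<phi>" by (rule square_summable_finite_support[OF assms(1) \<phi>])
  have K: "finite K" using assms(1,2) by (simp add: K_def)
  have l2: "(\<Sum>k\<in>K. (\<phi> (i - k))\<^sup>2) = (l2norm \<phi>)\<^sup>2" if "i \<in> F" for i
  proof -
    have "(l2norm \<phi>)\<^sup>2 = (\<Sum>\<^sub>\<infinity>m. (\<phi> m)\<^sup>2)" by (simp add: l2norm_def infsum_nonneg)
    also have "\<dots> = (\<Sum>\<^sub>\<infinity>m\<in>W. (\<phi> m)\<^sup>2)" by (rule infsum_cong_neutral) (auto simp: \<phi>)
    also have "\<dots> = (\<Sum>m\<in>W. (\<phi> m)\<^sup>2)" using assms(1) by simp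
    also have "\<dots> = (\<Sum>k\<in>(\<lambda>m. i - m) ` W. (\<phi> (i - k))\<^sup>2)"
      by (subst sum.reindex) (auto simp: inj_on_def)
    also have "\<dots> = (\<Sum>k\<in>K. (\<phi> (i - k))\<^sup>2)"
    proof (rule sum.mono_neutral_left[OF K])
      show "(\<lambda>m. i - m) ` W \<subseteq> K" using that by (force simp: K_def)
      show "\<forall>k\<in>K - (\<lambda>m. i - m) ` W. (\<phi> (i - k))\<^sup>2 = 0"
      proof
        fix k assume k: "k \<in> K - (\<lambda>m. i - m) ` W"
        then have "i - k \<notin> W" using image_eqI[of k "\<lambda>m. i - m" "i - k" W] by auto
        then show "(\<phi> (i - k))\<^sup>2 = 0" by (simp add: \<phi>)
      qed
    qed
    finally show ?thesis by simp
  qed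
  note S = infsum_sum_finite[OF K, of "\<lambda>k i. (norm (ell2_nth (cutoff \<phi> k x) i))\<^sup>2", OF ell2_summable]
  have "(\<Sum>k\<in>K. (norm (cutoff \<phi> k x))\<^sup>2) = (\<Sum>\<^sub>\<infinity>i. \<Sum>k\<in>K. (norm (ell2_nth (cutoff \<phi> k x) i))\<^sup>2)"
    using S by (simp add: norm_ell2_sq)
  also have "\<dots> = (\<Sum>\<^sub>\<infinity>i. (l2norm \<phi>)\<^sup>2 * (norm (ell2_nth x i))\<^sup>2)"
  proof (rule infsum_cong)
    fix i
    have "(\<Sum>k\<in>K. (norm (ell2_nth (cutoff \<phi> k x) i))\<^sup>2) = (\<Sum>k\<in>K. (\<phi> (i - k))\<^sup>2) * (norm (ell2_nth x i))\<^sup>2"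
      by (simp add: ell2_nth_cutoff[OF sq] power_mult_distrib sum_distrib_right)
    also have "\<dots> = (l2norm \<phi>)\<^sup>2 * (norm (ell2_nth x i))\<^sup>2"
      using l2[of i] x by (cases "i \<in> F") (auto simp: ell2_on_def)
    finally show "(\<Sum>k\<in>K. (norm (ell2_nth (cutoff \<phi> k x) i))\<^sup>2) = (l2norm \<phi>)\<^sup>2 * (norm (ell2_nth x i))\<^sup>2" .
  qed
  also have "\<dots> = (l2norm \<phi> * norm x)\<^sup>2"
    by (simp add: infsum_cmult_right' norm_ell2_sq power_mult_distrib)
  finally show ?thesis
    unfolding L2_set_def by (simp add: l2norm_nonneg)
qed

text \<open>Put \<open>D = \<Sum>j. a\<^sub>j \<parallel>\<phi>(\<cdot> - j) - \<phi>\<parallel>\<close> and let \<open>x\<close> be an approximate eigenvector. The pieces \<open>\<phi>\<^sub>k x\<close> satisfy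
  \<open>\<Sum>k. \<parallel>\<phi>\<^sub>k x\<parallel>\<^sup>2 = \<parallel>x\<parallel>\<^sup>2\<close>, and \<open>(A - z) \<phi>\<^sub>k x = \<phi>\<^sub>k (A - z) x + [A, \<phi>\<^sub>k] x\<close> with Minkowski's inequality gives
  \<open>\<Sum>k. \<parallel>(A - z) \<phi>\<^sub>k x\<parallel>\<^sup>2 \<le> (\<parallel>(A - z) x\<parallel> + D \<parallel>x\<parallel>)\<^sup>2\<close>. Hence some piece is an approximate eigenvector with
  error at most \<open>e + D\<close>.\<close>
theorem localize_pseudo_eigenvector:
  fixes T :: "'g::ab_group_add \<Rightarrow> ('g, 'y::complex_normed_space) ell2 \<Rightarrow>\<^sub>L ('g, 'y) ell2"
    and \<phi> :: "'g \<Rightarrow> real"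
  assumes "finite J" and A: "A = (\<Sum>j\<in>J. T j)" and T: "\<And>j. j \<in> J \<Longrightarrow> diagonal_bounded j (a j) (T j)"
    and "finite W" and \<phi>: "\<And>m. m \<notin> W \<Longrightarrow> \<phi> m = 0" and "l2norm \<phi> = 1"
    and "pseudo_eigenvalue UNIV A z e"
  shows "\<exists>k. pseudo_eigenvalue (ell2_on ((\<lambda>w. k + w) ` W)) A z
    (e + (\<Sum>j\<in>J. a j * l2norm (\<lambda>m. \<phi> (m - j) - \<phi> m)))"
proof (rule ccontr)
  define D where "D = (\<Sum>j\<in>J. a j * l2norm (\<lambda>m. \<phi> (m - j) - \<phi> m))"
  assume "\<nexists>k. pseudo_eigenvalue (ell2_on ((\<lambda>w. k + w) ` W)) A z
    (e + (\<Sum>j\<in>J. a j * l2norm (\<lambda>m. \<phi> (m - j) - \<phi> m)))"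
  then have low: "(e + D) * norm y \<le> norm (A y - z *\<^sub>C y)" if "y \<in> ell2_on ((\<lambda>w. k + w) ` W)" for k y
    using that by (auto simp: not_pseudo_eigenvalue_iff D_def)
  obtain F x where x: "finite F" "x \<in> ell2_on F" "norm (A x - z *\<^sub>C x) < e * norm x"
    using finitely_supported_pseudo_eigenvector[OF assms(7)] by blast
  have sq: "square_summable \<phi>" by (rule square_summable_finite_support[OF assms(4) \<phi>])
  have "0 \<le> D" unfolding D_def using T by (intro sum_nonneg) (auto simp: diagonal_bounded_def l2norm_nonneg)
  have "0 < e"
  proof (rule ccontr)
    assume "\<not> 0 < e"
    then have "e * norm x \<le> 0" by (simp add: mult_nonpos_nonneg)
    with x(3) show False using norm_ge_zero[of "A x - z *\<^sub>C x"] by linarith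
  qed
  define K where "K = (\<lambda>(i, m). i - m) ` (F \<times> W)"
  have K: "finite K" using assms(4) x(1) by (simp add: K_def)
  have "(e + D) * norm x = (e + D) * L2_set (\<lambda>k. norm (cutoff \<phi> k x)) K"
    using L2_set_cutoff_eq[where \<phi> = \<phi>, OF assms(4) x(1) \<phi> x(2)] assms(6) by (simp add: K_def)
  also have "\<dots> = L2_set (\<lambda>k. (e + D) * norm (cutoff \<phi> k x)) K"
    using \<open>0 \<le> D\<close> \<open>0 < e\<close> by (simp add: L2_set_right_distrib)
  also have "\<dots> \<le> L2_set (\<lambda>k. norm (cutoff \<phi> k (A x - z *\<^sub>C x))
      + (\<Sum>j\<in>J. norm (T j (cutoff \<phi> k x) - cutoff \<phi> k (T j x)))) K"
  proof (rule L2_set_mono)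
    fix k assume "k \<in> K"
    have "cutoff \<phi> k x \<in> ell2_on ((\<lambda>w. k + w) ` W)"
    proof -
      have "i - k \<notin> W" if "i \<notin> (\<lambda>w. k + w) ` W" for i
        using that image_eqI[of i "\<lambda>w. k + w" "i - k" W] by auto
      then show ?thesis by (simp add: ell2_on_def ell2_nth_cutoff[OF sq] \<phi>)
    qed
    then have "(e + D) * norm (cutoff \<phi> k x) \<le> norm (A (cutoff \<phi> k x) - z *\<^sub>C cutoff \<phi> k x)"
      by (rule low)
    also have "A (cutoff \<phi> k x) - z *\<^sub>C cutoff \<phi> k x =
      cutoff \<phi> k (A x - z *\<^sub>C x) + (\<Sum>j\<in>J. T j (cutoff \<phi> k x) - cutoff \<phi> k (T j x))"
    proof -
      have "z *\<^sub>C cutoff \<phi> k x = cutoff \<phi> k (z *\<^sub>C x)"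
        by (rule ell2_eqI) (simp add: ell2_nth_cutoff[OF sq] scaleC_scaleR_commute)
      then show ?thesis
        by (simp add: A blinfun.bilinear_simps sum_subtractf)
    qed
    also have "norm \<dots> \<le> norm (cutoff \<phi> k (A x - z *\<^sub>C x)) + (\<Sum>j\<in>J. norm (T j (cutoff \<phi> k x) - cutoff \<phi> k (T j x)))"
      by (rule order_trans[OF norm_triangle_ineq]) (simp add: norm_sum)
    finally show "(e + D) * norm (cutoff \<phi> k x) \<le> norm (cutoff \<phi> k (A x - z *\<^sub>C x))
      + (\<Sum>j\<in>J. norm (T j (cutoff \<phi> k x) - cutoff \<phi> k (T j x)))" .
  qed (use \<open>0 \<le> D\<close> \<open>0 < e\<close> in auto)
  also have "\<dots> \<le> L2_set (\<lambda>k. norm (cutoff \<phi> k (A x - z *\<^sub>C x))) K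
      + L2_set (\<lambda>k. \<Sum>j\<in>J. norm (T j (cutoff \<phi> k x) - cutoff \<phi> k (T j x))) K"
    by (rule L2_set_triangle_ineq)
  also have "\<dots> \<le> norm (A x - z *\<^sub>C x)
      + (\<Sum>j\<in>J. L2_set (\<lambda>k. norm (T j (cutoff \<phi> k x) - cutoff \<phi> k (T j x))) K)"
  proof (rule add_mono)
    show "L2_set (\<lambda>k. norm (cutoff \<phi> k (A x - z *\<^sub>C x))) K \<le> norm (A x - z *\<^sub>C x)"
      using L2_set_cutoff_le[OF sq K] assms(6) by (metis mult_1)
    show "L2_set (\<lambda>k. \<Sum>j\<in>J. f j k) K \<le> (\<Sum>j\<in>J. L2_set (f j) K)" for f :: "'g \<Rightarrow> 'g \<Rightarrow> real"
      using \<open>finite J\<close>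
    proof (induction J rule: finite_induct)
      case (insert j J)
      then show ?case
        using L2_set_triangle_ineq[of "f j" "\<lambda>k. \<Sum>j\<in>J. f j k" K] by simp
    qed (simp add: L2_set_0')
  qed
  also have "\<dots> \<le> norm (A x - z *\<^sub>C x) + (\<Sum>j\<in>J. a j * l2norm (\<lambda>m. \<phi> (m - j) - \<phi> m) * norm x)"
    by (intro add_left_mono sum_mono commutator_le sq T K)
  also have "\<dots> = norm (A x - z *\<^sub>C x) + D * norm x" by (simp add: D_def sum_distrib_right)
  finally show False using x(3) by (simp add: distrib_right)
qed

section \<open>Adjoints of diagonals and patches\<close>

lemma cinner_ell2_single:
  fixes x y :: "('g, 'y::complex_hilbert_space) ell2"
  assumes "\<And>m. m \<noteq> i \<Longrightarrow> ell2_nth x m = 0 \<or> ell2_nth y m = 0"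
  shows "cinner x y = cinner (ell2_nth x i) (ell2_nth y i)"
proof -
  have "cinner x y = (\<Sum>\<^sub>\<infinity>m\<in>{i}. cinner (ell2_nth x m) (ell2_nth y m))"
    unfolding cinner_ell2_def by (rule infsum_cong_neutral) (use assms in fastforce)+
  then show ?thesis by simp
qed

text \<open>The entry \<open>i\<close> of \<open>T' y\<close> is tested against itself, placed at \<open>i\<close>; \<open>T\<close> moves this test vector to
  the single entry \<open>i + j\<close>.\<close>
lemma diagonal_bounded_adjoint:
  fixes T T' :: "('g::ab_group_add, 'y::complex_hilbert_space) ell2 \<Rightarrow>\<^sub>L ('g, 'y) ell2"
  assumes adj: "adjoint_pair T T'" and T: "diagonal_bounded j a T"
  shows "diagonal_bounded (- j) a T'"
  unfolding diagonal_bounded_def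
proof (intro conjI allI)
  show a: "0 \<le> a" using T by (simp add: diagonal_bounded_def)
  fix y i
  define u where "u = ell2_nth (T' y) i"
  define x where "x = proj_op {i} (T' y)"
  have Tx: "norm (ell2_nth (T x) m) \<le> a * norm (ell2_nth x (m - j))" for m
    using T by (simp add: diagonal_bounded_def)
  have x: "ell2_nth x m = (if m = i then u else 0)" for m
    by (simp add: x_def u_def ell2_nth_proj_op)
  have "cinner u u = cinner x (T' y)"
    using cinner_ell2_single[of i x "T' y"] by (simp add: x u_def)
  also have "\<dots> = cinner (T x) y" using adj by (simp add: adjoint_pair_def)
  also have "\<dots> = cinner (ell2_nth (T x) (i + j)) (ell2_nth y (i + j))"
  proof (rule cinner_ell2_single)
    fix m assume "m \<noteq> i + j"
    then have "m - j \<noteq> i" by (auto simp: algebra_simps)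
    then show "ell2_nth (T x) m = 0 \<or> ell2_nth y m = 0" using Tx[of m] by (simp add: x)
  qed
  finally have "cmod (cinner u u) \<le> norm (ell2_nth (T x) (i + j)) * norm (ell2_nth y (i + j))"
    by (simp add: cmod_cinner_le)
  also have "\<dots> \<le> a * norm u * norm (ell2_nth y (i + j))"
    using Tx[of "i + j"] by (intro mult_right_mono) (auto simp: x)
  finally have "cmod (cinner u u) \<le> a * norm (ell2_nth y (i + j)) * norm u"
    by (simp add: mult_ac)
  then show "norm (ell2_nth (T' y) i) \<le> a * norm (ell2_nth y (i - - j))"
    using norm_cinner_bound[of u] a by (simp add: u_def)
qed

lemma adjoint_pair_sum:
  assumes "\<And>j. j \<in> J \<Longrightarrow> adjoint_pair (T j) (T' j)"
  shows "adjoint_pair (\<Sum>j\<in>J. T j) (\<Sum>j\<in>J. T' j)"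
  using assms unfolding adjoint_pair_def clinear_op_def
  by (auto simp: blinfun.sum_left cinner_sum_left cinner_sum_right cvec.scale_sum_right)

lemma adjoint_pair_compose:
  assumes "adjoint_pair S S'" "adjoint_pair T T'"
  shows "adjoint_pair (S o\<^sub>L T) (T' o\<^sub>L S')"
  using assms by (simp add: adjoint_pair_def clinear_op_def)

lemma adjoint_pair_proj_op:
  "adjoint_pair (proj_op I) (proj_op I :: ('g, 'y::complex_hilbert_space) ell2 \<Rightarrow>\<^sub>L ('g, 'y) ell2)"
  unfolding adjoint_pair_def clinear_op_def
proof (intro conjI allI)
  fix c and x y :: "('g, 'y) ell2"
  show "proj_op I (c *\<^sub>C x) = c *\<^sub>C proj_op I x"
    by (rule ell2_eqI) (simp add: ell2_nth_proj_op)
  then show "proj_op I (c *\<^sub>C x) = c *\<^sub>C proj_op I x" .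
  show "cinner (proj_op I x) y = cinner x (proj_op I y)"
    unfolding cinner_ell2_def by (intro infsum_cong) (simp add: ell2_nth_proj_op)
qed

definition compression ::
  "'g set \<Rightarrow> (('g, 'y::complex_normed_space) ell2 \<Rightarrow>\<^sub>L ('g, 'y) ell2) \<Rightarrow> ('g, 'y) ell2 \<Rightarrow>\<^sub>L ('g, 'y) ell2" where
  "compression I A = proj_op I o\<^sub>L A o\<^sub>L proj_op I"

lemma compression_in: "compression I A x \<in> ell2_on I"
  by (simp add: compression_def proj_op_in)

lemma adjoint_pair_compression:
  assumes "adjoint_pair A A'"
  shows "adjoint_pair (compression I A) (compression I A')"
proof -
  have "proj_op I o\<^sub>L A' o\<^sub>L proj_op I = proj_op I o\<^sub>L (A' o\<^sub>L proj_op I)"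
    by (rule blinfun_eqI) simp
  then show ?thesis
    unfolding compression_def
    using adjoint_pair_compose[OF adjoint_pair_compose[OF adjoint_pair_proj_op assms] adjoint_pair_proj_op]
    by simp
qed

lemma norm_compression_le: "norm (compression I A) \<le> norm A"
proof (rule norm_blinfun_bound)
  fix x
  have "norm (compression I A x) \<le> norm (A (proj_op I x))"
    by (simp add: compression_def norm_proj_op_le)
  also have "\<dots> \<le> norm A * norm x"
    by (rule order_trans[OF norm_blinfun]) (simp add: norm_proj_op_le mult_left_mono)
  finally show "norm (compression I A x) \<le> norm A * norm x" .
qed simp

lemma pseudo_eigenvalue_compression:
  assumes "pseudo_eigenvalue (ell2_on I) A z e"
  shows "pseudo_eigenvalue (ell2_on I) (compression I A) z e"
proof -
  obtain x where x: "x \<in> ell2_on I" "norm (A x - z *\<^sub>C x) < e * norm x"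
    using assms by (auto simp: pseudo_eigenvalue_def)
  have "compression I A x - z *\<^sub>C x = proj_op I (A x - z *\<^sub>C x)"
    using proj_op_eq[OF x(1)] proj_op_eq[OF cvec.subspace_scale[OF subspace_ell2_on x(1)], of z]
    by (simp add: compression_def blinfun.diff_right)
  then have "norm (compression I A x - z *\<^sub>C x) < e * norm x"
    using norm_proj_op_le[of I "A x - z *\<^sub>C x"] x(2) by simp
  with x(1) show ?thesis by (auto simp: pseudo_eigenvalue_def)
qed

section \<open>Self-adjoint operators on finite-dimensional coordinate spaces\<close>

interpretation cvec_pair: vector_space_pair
  "scaleC :: complex \<Rightarrow> 'a::complex_normed_space \<Rightarrow> 'a" "scaleC :: complex \<Rightarrow> 'b::complex_normed_space \<Rightarrow> 'b"
  by unfold_locales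

definition unit_ell2 :: "'g \<Rightarrow> ('g, complex) ell2" where
  "unit_ell2 k = Abs_ell2 (\<lambda>i. if i = k then 1 else 0)"

lemma ell2_nth_unit: "ell2_nth (unit_ell2 k) i = (if i = k then 1 else 0)"
  unfolding unit_ell2_def
  by (subst ell2_nth_Abs, rule square_summable_finite_support[of "{k}"]) auto

lemma ell2_nth_sum: "ell2_nth (\<Sum>k\<in>F. f k) i = (\<Sum>k\<in>F. ell2_nth (f k) i)"
  by (induction F rule: infinite_finite_induct) auto

lemma norm_unit_ell2: "norm (unit_ell2 k) = 1"
proof -
  have "(norm (unit_ell2 k))\<^sup>2 = (\<Sum>\<^sub>\<infinity>i\<in>{k}. 1)"
    unfolding norm_ell2_sq by (rule infsum_cong_neutral) (auto simp: ell2_nth_unit)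
  then show ?thesis using norm_ge_zero[of "unit_ell2 k"] by (auto simp: power2_eq_1_iff)
qed

lemma ell2_on_expansion:
  assumes "finite W" "x \<in> ell2_on W"
  shows "x = (\<Sum>k\<in>W. ell2_nth x k *\<^sub>C unit_ell2 k)"
proof (rule ell2_eqI)
  fix i
  have "(\<Sum>k\<in>W. ell2_nth x k *\<^sub>C ell2_nth (unit_ell2 k) i) = (\<Sum>k\<in>W. if i = k then ell2_nth x k else 0)"
    by (intro sum.cong) (auto simp: ell2_nth_unit scaleC_complex_def)
  then show "ell2_nth x i = ell2_nth (\<Sum>k\<in>W. ell2_nth x k *\<^sub>C unit_ell2 k) i"
    using assms by (auto simp: ell2_nth_sum ell2_on_def)
qed

lemma unit_ell2_in: "k \<in> W \<Longrightarrow> unit_ell2 k \<in> ell2_on W"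
  by (auto simp: ell2_on_def ell2_nth_unit)

lemma ell2_on_subset_span: "finite W \<Longrightarrow> ell2_on W \<subseteq> cvec.span (unit_ell2 ` W)"
proof
  fix x :: "('a, complex) ell2" assume "finite W" "x \<in> ell2_on W"
  then have "x = (\<Sum>k\<in>W. ell2_nth x k *\<^sub>C unit_ell2 k)" by (rule ell2_on_expansion)
  also have "\<dots> \<in> cvec.span (unit_ell2 ` W)"
    by (intro cvec.span_sum cvec.span_scale cvec.span_base) auto
  finally show "x \<in> cvec.span (unit_ell2 ` W)" .
qed

text \<open>The ambient space has infinite dimension; only the \<open>T\<close>-invariant subspace \<open>S\<close> is spanned by a finite
  set.\<close>
lemma finite_dim_inj_imp_surj:
  assumes lin: "Vector_Spaces.linear scaleC scaleC (T :: 'a::complex_normed_space \<Rightarrow> 'a)"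
    and S: "cvec.subspace S" "finite E" "S \<subseteq> cvec.span E"
    and T: "T ` S \<subseteq> S" "inj_on T S"
  shows "T ` S = S"
proof
  interpret T: Vector_Spaces.linear scaleC scaleC T by (rule lin)
  obtain C where C: "C \<subseteq> S" "cvec.independent C" "S \<subseteq> cvec.span C"
    using cvec.maximal_independent_subset[of S] by blast
  have span: "cvec.span C = S" using cvec.span_subspace[OF C(1) C(3) S(1)] .
  have "finite C" using cvec.independent_span_bound[OF S(2) C(2)] C(1) S(3) by blast
  have ind: "cvec.independent (T ` C)"
    using cvec_pair.linear_independent_injective_image[OF lin C(2)] T(2) span by simp
  show "S \<subseteq> T ` S"
  proof
    fix y assume y: "y \<in> S"
    show "y \<in> T ` S"
    proof (rule ccontr)
      assume "y \<notin> T ` S"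
      then have y': "y \<notin> cvec.span (T ` C)"
        using T.span_image[of C] span by simp
      then have "cvec.independent (insert y (T ` C))"
        using ind by (rule cvec.independent_insertI)
      moreover have "insert y (T ` C) \<subseteq> cvec.span C" using y T(1) C(1) span by auto
      ultimately have "card (insert y (T ` C)) \<le> card C"
        using cvec.independent_span_bound[OF \<open>finite C\<close>] by blast
      moreover have "y \<notin> T ` C" using y' cvec.span_base[of y "T ` C"] by blast
      moreover have "card (T ` C) = card C"
        by (rule card_image[OF inj_on_subset[OF T(2) C(1)]])
      ultimately show False using \<open>finite C\<close> by simp
    qed
  qed
qed (rule T(1))

lemma orthogonal_imp_independent:
  fixes v :: "'i \<Rightarrow> 'a::complex_hilbert_space"
  assumes nz: "\<And>t. t \<in> I \<Longrightarrow> v t \<noteq> 0"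
    and orth: "\<And>s t. s \<in> I \<Longrightarrow> t \<in> I \<Longrightarrow> s \<noteq> t \<Longrightarrow> cinner (v s) (v t) = 0"
  shows "inj_on v I \<and> cvec.independent (v ` I)"
proof
  show inj: "inj_on v I"
  proof (rule inj_onI)
    fix s t assume "s \<in> I" "t \<in> I" "v s = v t"
    then show "s = t" using nz[of s] orth[of s t] by (auto simp: cinner_self)
  qed
  show "cvec.independent (v ` I)"
    unfolding cvec.independent_explicit_module
  proof (intro allI impI)
    fix F u w assume F: "finite F" "F \<subseteq> v ` I" "(\<Sum>w\<in>F. u w *\<^sub>C w) = 0" "w \<in> F"
    have "0 = cinner (\<Sum>x\<in>F. u x *\<^sub>C x) w" using F(3) by simp
    also have "\<dots> = (\<Sum>x\<in>F. u x * cinner x w)" by (simp add: cinner_sum_left cinner_scaleC_left)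
    also have "\<dots> = (\<Sum>x\<in>{w}. u x * cinner x w)"
    proof (rule sum.mono_neutral_right[OF F(1)])
      show "\<forall>x\<in>F - {w}. u x * cinner x w = 0"
      proof
        fix x assume x: "x \<in> F - {w}"
        obtain s t where "s \<in> I" "t \<in> I" "x = v s" "w = v t" using x F(2,4) by blast
        then show "u x * cinner x w = 0" using orth[of s t] x by auto
      qed
    qed (use F in auto)
    finally have "u w * cinner w w = 0" by simp
    moreover have "w \<noteq> 0" using F(2,4) nz by auto
    ultimately show "u w = 0" by (simp add: cinner_self)
  qed
qed

text \<open>The smallest spectral point is the infimum \<open>m\<close> of the Rayleigh quotient: if \<open>M = L - m\<close>
  were invertible, then \<open>\<parallel>M x\<parallel>\<^sup>2 \<le> K \<langle>M x, x\<rangle>\<close> would keep \<open>\<langle>M x, x\<rangle>\<close> away from zero on the unit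
  sphere. Finiteness of the spectrum, by orthogonality of eigenvectors, is what makes \<open>Min\<close> the
  actual minimum.\<close>
theorem ground_state:
  fixes L :: "('g, complex) ell2 \<Rightarrow>\<^sub>L ('g, complex) ell2"
  assumes W: "finite W" "W \<noteq> {}" and adj: "adjoint_pair L L"
    and inv: "\<And>x. x \<in> ell2_on W \<Longrightarrow> L x \<in> ell2_on W"
  defines "\<Lambda> \<equiv> {t. complex_of_real t \<in> spectrum_on W L}"
  shows "\<exists>x\<in>ell2_on W. norm x = 1 \<and> Re (cinner (L x) x) = Min \<Lambda>"
    and "\<And>x. x \<in> ell2_on W \<Longrightarrow> Min \<Lambda> * (norm x)\<^sup>2 \<le> Re (cinner (L x) x)"
proof -
  let ?S = "ell2_on W :: ('g, complex) ell2 set"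
  interpret hilbert_operator ?S L L
    by unfold_locales (auto intro: subspace_ell2_on closed_ell2_on adj inv)
  define T where "T t x = L x - complex_of_real t *\<^sub>C x" for t x
  note sub = cvec.subspace_diff[OF subspace_ell2_on] cvec.subspace_scale[OF subspace_ell2_on]
  have T_in: "T t x \<in> ?S" if "x \<in> ?S" for t x
    unfolding T_def using that by (rule shifted_in)
  have T_scale: "T t (c *\<^sub>C x) = c *\<^sub>C T t x" for t c x
    unfolding T_def by (rule shifted_scale)
  have T_add: "T t (x + y) = T t x + T t y" and T_diff: "T t (x - y) = T t x - T t y" for t x y
    using linear_add[OF shifted_linear] linear_diff[OF shifted_linear] by (simp_all add: T_def)
  have T_linear: "Vector_Spaces.linear scaleC scaleC (T t)" for t
    by unfold_locales (simp_all add: T_add T_scale)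
  have sym: "cinner (L x) y = cinner x (L y)" for x y using adj by (simp add: adjoint_pair_def)
  have T_sym: "cinner (T t x) y = cinner x (T t y)" for t x y
    by (simp add: T_def cinner_diff_left cinner_diff_right cinner_scaleC_left cinner_scaleC_right sym)
  have \<Lambda>: "t \<in> \<Lambda> \<longleftrightarrow> \<not> bij_betw (T t) ?S ?S" for t
    by (simp add: \<Lambda>_def spectrum_on_def T_def[abs_def])
  have eigen: "\<exists>x\<in>?S. x \<noteq> 0 \<and> L x = complex_of_real t *\<^sub>C x" if "t \<in> \<Lambda>" for t
  proof -
    have "T t ` ?S \<subseteq> ?S" using T_in by blast
    then have "\<not> inj_on (T t) ?S"
      using that finite_dim_inj_imp_surj[OF T_linear subspace_ell2_on _ ell2_on_subset_span[OF W(1)], of t] W(1)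
      unfolding \<Lambda> bij_betw_def by blast
    then obtain x y where "x \<in> ?S" "y \<in> ?S" "x \<noteq> y" "T t x = T t y" by (auto simp: inj_on_def)
    then show ?thesis
      by (intro bexI[of _ "x - y"] sub) (use T_diff[of t x y] in \<open>auto simp: T_def\<close>)
  qed
  then obtain v where v: "\<And>t. t \<in> \<Lambda> \<Longrightarrow> v t \<in> ?S" "\<And>t. t \<in> \<Lambda> \<Longrightarrow> v t \<noteq> 0"
    "\<And>t. t \<in> \<Lambda> \<Longrightarrow> L (v t) = complex_of_real t *\<^sub>C v t" by metis
  have orth: "cinner (v s) (v t) = 0" if "s \<in> \<Lambda>" "t \<in> \<Lambda>" "s \<noteq> t" for s t
  proof -
    have "complex_of_real s * cinner (v s) (v t) = complex_of_real t * cinner (v s) (v t)"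
      using sym[of "v s" "v t"] v(3) that by (simp add: cinner_scaleC_left cinner_scaleC_right)
    then show ?thesis using that(3) by simp
  qed
  have "inj_on v \<Lambda>" "cvec.independent (v ` \<Lambda>)"
    using orthogonal_imp_independent[of \<Lambda> v, OF v(2) orth] by blast+
  moreover have "v ` \<Lambda> \<subseteq> cvec.span (unit_ell2 ` W)" using v(1) ell2_on_subset_span[OF W(1)] by blast
  ultimately have fin: "finite \<Lambda>"
    using cvec.independent_span_bound[of "unit_ell2 ` W" "v ` \<Lambda>"] W(1) finite_imageD by blast
  define q where "q x = Re (cinner (L x) x)" for x
  define S1 where "S1 = {x \<in> ?S. norm x = 1}"
  define m where "m = Inf (q ` S1)"
  obtain k where "k \<in> W" using W(2) by blast
  then have S1: "S1 \<noteq> {}" using unit_ell2_in norm_unit_ell2 by (force simp: S1_def)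
  have q_bound: "\<bar>q x\<bar> \<le> norm L" if "norm x = 1" for x
    using order_trans[OF abs_Re_le_cmod cmod_cinner_le[of "L x" x]] norm_blinfun[of L x] that
    by (simp add: q_def)
  have "- norm L \<le> q x" if "x \<in> S1" for x using q_bound[of x] that by (simp add: S1_def)
  then have bdd: "bdd_below (q ` S1)" by (rule bdd_belowI2)
  have m_le: "m * (norm x)\<^sup>2 \<le> q x" if "x \<in> ?S" for x
  proof (cases "x = 0")
    case False
    have "inverse (norm x) *\<^sub>R x \<in> S1"
      using that False sub(2)[OF that, of "complex_of_real (inverse (norm x))", folded scaleR_scaleC]
      by (simp add: S1_def)
    then have "m \<le> q (inverse (norm x) *\<^sub>R x)" unfolding m_def by (intro cInf_lower bdd) auto
    also have "\<dots> = q x / (norm x)\<^sup>2"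
      using False by (simp add: q_def blinfun.scaleR_right cinner_scaleR_left cinner_scaleR_right
          power2_eq_square divide_simps)
    finally show ?thesis using False by (simp add: pos_le_divide_eq)
  qed (simp add: q_def)
  have "m \<in> \<Lambda>"
  proof (rule ccontr)
    assume "m \<notin> \<Lambda>"
    then have bij: "bij_betw (T m) ?S ?S" by (simp add: \<Lambda>)
    define f where "f x = Re (cinner (T m x) x)" for x
    have f: "f x = q x - m * (norm x)\<^sup>2" for x
      by (simp add: f_def q_def T_def cinner_diff_left cinner_scaleC_left cinner_self)
    define K where "K = norm L + \<bar>m\<bar> + 1"
    have K: "0 < K" by (simp add: K_def add_nonneg_pos)
    have TK: "norm (T m x) \<le> K * norm x" for x
      using order_trans[OF shifted_bound[of x "complex_of_real m"], of "K * norm x"]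
      by (simp add: T_def K_def distrib_right)
    have pos: "(norm (T m x))\<^sup>2 \<le> K * f x" if x: "x \<in> ?S" for x
    proof -
      \<comment> \<open>Non-negativity of the form \<open>f\<close> at \<open>x - M x / K\<close> is the desired inequality.\<close>
      define r where "r = inverse K"
      define y where "y = T m x"
      have "0 \<le> f (x - complex_of_real r *\<^sub>C y)"
        using m_le[of "x - complex_of_real r *\<^sub>C y"] f x by (auto simp: y_def intro!: sub T_in)
      also have "\<dots> = f x - 2 * r * (norm y)\<^sup>2 + r\<^sup>2 * Re (cinner (T m y) y)"
      proof -
        have "cinner (T m y) x = cinner y y" by (simp add: T_sym y_def)
        then show ?thesis
          by (simp add: f_def T_diff T_scale cinner_diff_left cinner_diff_right cinner_scaleC_left
              cinner_scaleC_right y_def[symmetric] cinner_self power2_eq_square algebra_simps)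
      qed
      also have "Re (cinner (T m y) y) \<le> K * (norm y)\<^sup>2"
        using order_trans[OF complex_Re_le_cmod cmod_cinner_le[of "T m y" y]]
          mult_right_mono[OF TK[of y] norm_ge_zero[of y]]
        by (simp add: power2_eq_square mult.assoc)
      finally have "0 \<le> f x - 2 * r * (norm y)\<^sup>2 + r\<^sup>2 * (K * (norm y)\<^sup>2)"
        by (simp add: mult_left_mono)
      also have "r\<^sup>2 * (K * (norm y)\<^sup>2) = r * (norm y)\<^sup>2"
        using K by (simp add: r_def power2_eq_square)
      finally show ?thesis using K by (simp add: y_def r_def field_simps)
    qed
    have "\<exists>u\<in>?S. T m u = unit_ell2 k" if "k \<in> W" for k
      using bij_betw_imp_surj_on[OF bij] unit_ell2_in[OF that] by (metis imageE)
    then obtain u where u: "\<And>k. k \<in> W \<Longrightarrow> u k \<in> ?S" "\<And>k. k \<in> W \<Longrightarrow> T m (u k) = unit_ell2 k"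
      by metis
    define C where "C = (\<Sum>k\<in>W. norm (u k)) + 1"
    have C: "0 < C" by (simp add: C_def add_nonneg_pos sum_nonneg)
    have bound: "norm x \<le> C * norm (T m x)" if x: "x \<in> ?S" for x
    proof -
      define x' where "x' = (\<Sum>k\<in>W. ell2_nth (T m x) k *\<^sub>C u k)"
      have x': "x' \<in> ?S"
        unfolding x'_def by (intro cvec.subspace_sum[OF subspace_ell2_on] sub u)
      have "T m x' = (\<Sum>k\<in>W. ell2_nth (T m x) k *\<^sub>C unit_ell2 k)"
        unfolding x'_def cvec_pair.linear_sum[OF T_linear] by (intro sum.cong) (auto simp: T_scale u)
      also have "\<dots> = T m x" by (rule ell2_on_expansion[OF W(1) T_in[OF x], symmetric])
      finally have "x = x'" using bij x x' by (auto simp: bij_betw_def inj_on_def)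
      then have "norm x \<le> (\<Sum>k\<in>W. norm (ell2_nth (T m x) k *\<^sub>C u k))"
        unfolding x'_def by (metis norm_sum)
      also have "\<dots> \<le> (\<Sum>k\<in>W. norm (T m x) * norm (u k))"
        by (intro sum_mono) (simp add: norm_scaleC mult_right_mono norm_ell2_nth_le)
      also have "\<dots> = (C - 1) * norm (T m x)"
        unfolding sum_distrib_left[symmetric] by (simp add: C_def mult.commute)
      also have "\<dots> \<le> C * norm (T m x)" by (intro mult_right_mono) auto
      finally show ?thesis .
    qed
    have "m + 1 / (C\<^sup>2 * K) \<le> q x" if "x \<in> S1" for x
    proof -
      have x: "x \<in> ?S" "norm x = 1" using that by (auto simp: S1_def)
      have "1 \<le> (C * norm (T m x))\<^sup>2" using bound[OF x(1)] x(2) by (simp add: one_le_power)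
      also have "\<dots> \<le> C\<^sup>2 * (K * f x)"
        using pos[OF x(1)] by (simp add: power_mult_distrib mult_left_mono)
      finally show ?thesis using f[of x] x(2) C K by (simp add: field_simps)
    qed
    then have "m + 1 / (C\<^sup>2 * K) \<le> m" unfolding m_def[symmetric]
      using cINF_greatest[OF S1, of "m + 1 / (C\<^sup>2 * K)" q] by (simp add: m_def)
    then show False using C K by (simp add: divide_le_0_iff mult_le_0_iff)
  qed
  moreover have "m \<le> t" if "t \<in> \<Lambda>" for t
    using m_le[OF v(1)[OF that]] v(2,3)[OF that]
    by (simp add: q_def cinner_scaleC_left cinner_self mult_le_cancel_right)
  ultimately have Min: "Min \<Lambda> = m" using fin by (intro Min_eqI)
  show "Min \<Lambda> * (norm x)\<^sup>2 \<le> Re (cinner (L x) x)" if "x \<in> ?S" for x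
    using m_le[OF that] by (simp add: Min q_def)
  show "\<exists>x\<in>?S. norm x = 1 \<and> Re (cinner (L x) x) = Min \<Lambda>"
  proof (intro bexI conjI)
    let ?x = "inverse (norm (v m)) *\<^sub>R v m"
    show n: "norm ?x = 1" using v(2)[OF \<open>m \<in> \<Lambda>\<close>] by simp
    show "?x \<in> ?S" unfolding scaleR_scaleC by (intro sub v \<open>m \<in> \<Lambda>\<close>)
    have "L ?x = complex_of_real m *\<^sub>C ?x"
      by (simp add: blinfun.scaleR_right v(3)[OF \<open>m \<in> \<Lambda>\<close>] scaleC_scaleR_commute)
    then show "Re (cinner (L ?x) ?x) = Min \<Lambda>"
      unfolding Min by (simp add: cinner_scaleC_left cinner_self n del: norm_scaleR)
  qed
qed

section \<open>The penalty term as a Rayleigh quotient\<close>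

lemma beta_uminus: "beta b (- j) = beta b j"
  by (simp add: beta_def add.commute)

lemma square_summable_shift_diff:
  fixes \<phi> :: "'g::ab_group_add \<Rightarrow> 'y::real_normed_vector"
  assumes "square_summable \<phi>"
  shows "square_summable (\<lambda>m. \<phi> (m - j) - \<phi> m)"
  using square_summable_add(1)[OF square_summable_translate(1)[OF assms], of "\<lambda>m. - \<phi> m" j] assms
  by (simp add: square_summable_def)

lemma l2norm_shift_diff_uminus:
  fixes \<phi> :: "'g::ab_group_add \<Rightarrow> 'y::real_normed_vector"
  shows "l2norm (\<lambda>m. \<phi> (m - (- j)) - \<phi> m) = l2norm (\<lambda>m. \<phi> (m - j) - \<phi> m)"
proof -
  have "l2norm (\<lambda>m. \<phi> (m - (- j)) - \<phi> m) = l2norm (\<lambda>m. \<phi> (m - j - (- j)) - \<phi> (m - j))"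
    by (rule square_summable_translate(2)[symmetric, where x = "\<lambda>m. \<phi> (m - (- j)) - \<phi> m"])
  then show ?thesis by (simp add: l2norm_def norm_minus_commute)
qed

lemma norm_shift_op_diff: "norm (shift_op j x - x) = l2norm (\<lambda>m. ell2_nth x (m - j) - ell2_nth x m)"
  by (simp add: norm_ell2_def ext[of "ell2_nth (shift_op j x - x)", OF ell2_nth_simps(4)] ell2_nth_shift_op)

lemma cinner_shift_op:
  fixes x y :: "('g::ab_group_add, 'y::complex_hilbert_space) ell2"
  shows "cinner (shift_op j x) y = cinner x (shift_op (- j) y)"
proof -
  have bij: "bij_betw (\<lambda>i. i + j) UNIV (UNIV :: 'g set)"
    by (rule bij_betwI[where g = "\<lambda>i. i - j"]) auto
  show ?thesis
    unfolding cinner_ell2_def ell2_nth_shift_op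
    using infsum_reindex_bij_betw[OF bij, of "\<lambda>i. cinner (ell2_nth x (i - j)) (ell2_nth y i)"]
    by simp
qed

text \<open>Only finitely many offsets carry a positive weight, as is the case when the balls of the graph
  are finite. All series over the group then are finite sums over \<open>J\<close>.\<close>
locale hopping_weights =
  fixes p :: real and b :: "'g::ab_group_add \<Rightarrow> 'g \<Rightarrow> 'a::real_normed_vector"
  assumes beta_nonneg: "0 \<le> beta b j"
    and finite_range: "finite {j. j \<noteq> 0 \<and> 0 < beta b j}"
begin

definition J :: "'g set" where "J = {j. j \<noteq> 0 \<and> 0 < beta b j}"

lemma finite_J: "finite J" using finite_range by (simp add: J_def)

lemma beta_outside: "j \<noteq> 0 \<Longrightarrow> j \<notin> J \<Longrightarrow> beta b j = 0"
  using beta_nonneg[of j] by (auto simp: J_def)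

lemma sum_J_uminus: "(\<Sum>j\<in>J. f (- j)) = (\<Sum>j\<in>J. f j)"
  by (rule sum.reindex_bij_witness[of _ uminus uminus]) (auto simp: J_def beta_uminus)

text \<open>The graph Laplacian of the whole group.\<close>
definition free_laplacian :: "('g, complex) ell2 \<Rightarrow>\<^sub>L ('g, complex) ell2" where
  "free_laplacian = (\<Sum>j\<in>J. (2 * beta b j powr p) *\<^sub>R (id_blinfun - shift_op j))"

text \<open>The Dirichlet form of the graph Laplacian, sorted by the offset \<open>j\<close> of the edges.\<close>
definition energy :: "('g \<Rightarrow> 'c::real_normed_vector) \<Rightarrow> real" where
  "energy \<phi> = (\<Sum>j\<in>J. beta b j powr p * (l2norm (\<lambda>m. \<phi> (m - j) - \<phi> m))\<^sup>2)"

lemma free_laplacian_apply: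
  "free_laplacian x = (\<Sum>j\<in>J. (2 * beta b j powr p) *\<^sub>R (x - shift_op j x))"
  by (simp add: free_laplacian_def blinfun.sum_left blinfun.scaleR_left blinfun.diff_left)

lemma adjoint_pair_free_laplacian: "adjoint_pair free_laplacian free_laplacian"
  unfolding adjoint_pair_def clinear_op_def
proof (intro conjI allI)
  fix c and x y :: "('g, complex) ell2"
  have "shift_op j (c *\<^sub>C x) = c *\<^sub>C shift_op j x" for j
    by (rule ell2_eqI) (simp add: ell2_nth_shift_op)
  then show "free_laplacian (c *\<^sub>C x) = c *\<^sub>C free_laplacian x"
    by (simp add: free_laplacian_apply cvec.scale_sum_right cvec.scale_right_diff_distrib
        scaleC_scaleR_commute)
  then show "free_laplacian (c *\<^sub>C x) = c *\<^sub>C free_laplacian x" .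
  have "cinner (free_laplacian x) y
    = (\<Sum>j\<in>J. complex_of_real (2 * beta b j powr p) * (cinner x y - cinner x (shift_op (- j) y)))"
    by (simp add: free_laplacian_apply cinner_sum_left cinner_scaleR_left cinner_diff_left
        cinner_shift_op)
  also have "\<dots> = (\<Sum>j\<in>J. complex_of_real (2 * beta b j powr p) * (cinner x y - cinner x (shift_op j y)))"
    using sum_J_uminus[of "\<lambda>j. complex_of_real (2 * beta b j powr p) * (cinner x y - cinner x (shift_op j y))"]
    by (simp add: beta_uminus)
  also have "\<dots> = cinner x (free_laplacian y)"
    by (simp add: free_laplacian_apply cinner_sum_right cinner_scaleR_right cinner_diff_right)
  finally show "cinner (free_laplacian x) y = cinner x (free_laplacian y)" .
qed

lemma Re_cinner_free_laplacian: "Re (cinner (free_laplacian x) x) = energy (ell2_nth x)"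
proof -
  have "Re (cinner (free_laplacian x) x)
    = (\<Sum>j\<in>J. beta b j powr p * (2 * ((norm x)\<^sup>2 - Re (cinner (shift_op j x) x))))"
    by (simp add: free_laplacian_apply cinner_sum_left cinner_scaleR_left cinner_diff_left cinner_self
        algebra_simps)
  also have "\<dots> = (\<Sum>j\<in>J. beta b j powr p * (norm (shift_op j x - x))\<^sup>2)"
    by (simp add: power2_norm_diff norm_shift_op)
  finally show ?thesis by (simp add: energy_def norm_shift_op_diff)
qed

text \<open>Outside \<open>W\<close> the functions in \<open>ell2_on W\<close> vanish, so the killing term is exactly the
  contribution of the edges that leave \<open>W\<close>.\<close>
lemma dirichlet_laplacian_eq_compression:
  assumes W: "finite W" and x: "x \<in> ell2_on W"
  shows "dirichlet_laplacian p b W x = compression W free_laplacian x"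
proof (rule ell2_eqI)
  fix k
  have xW: "ell2_nth x i = 0" if "i \<notin> W" for i using x that by (simp add: ell2_on_def)
  show "ell2_nth (dirichlet_laplacian p b W x) k = ell2_nth (compression W free_laplacian x) k"
  proof (cases "k \<in> W")
    case True
    let ?g = "\<lambda>j. (2 * beta b j powr p) *\<^sub>R (ell2_nth x k - ell2_nth x (k - j))"
    have "(\<Sum>l\<in>W. edge_weight_on p b W k l *\<^sub>R (ell2_nth x k - ell2_nth x l))
      = (\<Sum>l\<in>{l \<in> W. k - l \<in> J}. edge_weight_on p b W k l *\<^sub>R (ell2_nth x k - ell2_nth x l))"
    proof (rule sum.mono_neutral_right[OF W])
      show "\<forall>l\<in>W - {l \<in> W. k - l \<in> J}. edge_weight_on p b W k l *\<^sub>R (ell2_nth x k - ell2_nth x l) = 0"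
        using beta_outside by (auto simp: edge_weight_on_def)
    qed auto
    also have "\<dots> = (\<Sum>j\<in>{j \<in> J. k - j \<in> W}. ?g j)"
      by (rule sum.reindex_bij_witness[of _ "\<lambda>j. k - j" "\<lambda>l. k - l"])
        (auto simp: edge_weight_on_def True J_def)
    finally have edges: "(\<Sum>l\<in>W. edge_weight_on p b W k l *\<^sub>R (ell2_nth x k - ell2_nth x l))
      = (\<Sum>j\<in>{j \<in> J. k - j \<in> W}. ?g j)" .
    have "(\<Sum>\<^sub>\<infinity>j\<in>{j. j \<noteq> 0 \<and> k - j \<notin> W}. beta b j powr p) = (\<Sum>\<^sub>\<infinity>j\<in>{j \<in> J. k - j \<notin> W}. beta b j powr p)"
      by (rule infsum_cong_neutral) (auto simp: beta_outside J_def)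
    also have "\<dots> = (\<Sum>j\<in>{j \<in> J. k - j \<notin> W}. beta b j powr p)" using finite_J by simp
    finally have "killing_term p b W k *\<^sub>R ell2_nth x k = (\<Sum>j\<in>{j \<in> J. k - j \<notin> W}. ?g j)"
      by (simp add: killing_term_def xW scaleR_sum_left[symmetric] sum_distrib_left[symmetric])
    moreover have "(\<Sum>j\<in>J. ?g j) = (\<Sum>j\<in>{j \<in> J. k - j \<in> W}. ?g j) + (\<Sum>j\<in>{j \<in> J. k - j \<notin> W}. ?g j)"
      by (subst sum.union_disjoint[symmetric]) (auto simp: finite_J intro!: sum.cong)
    moreover have "ell2_nth (free_laplacian x) k = (\<Sum>j\<in>J. ?g j)"
      by (simp add: free_laplacian_apply ell2_nth_sum ell2_nth_shift_op)
    ultimately show ?thesis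
      using True edges by (simp add: ell2_nth_dirichlet_laplacian[OF W] compression_def ell2_nth_proj_op
          proj_op_eq[OF x])
  qed (simp add: ell2_nth_dirichlet_laplacian[OF W] compression_def ell2_nth_proj_op)
qed

definition bottom :: "'g set \<Rightarrow> real" where
  "bottom W = Min {t. complex_of_real t \<in> spectrum_on W (dirichlet_laplacian p b W)}"

lemma bottom_variational:
  fixes x :: "('g, complex) ell2"
  assumes W: "finite W" "W \<noteq> {}"
  shows "\<exists>x\<in>ell2_on W :: ('g, complex) ell2 set. norm x = 1 \<and> energy (ell2_nth x) = bottom W"
    and "x \<in> ell2_on W \<Longrightarrow> bottom W * (norm x)\<^sup>2 \<le> energy (ell2_nth x)"
proof -
  let ?L = "compression W free_laplacian"
  have "spectrum_on W (dirichlet_laplacian p b W) = spectrum_on W ?L"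
    unfolding spectrum_on_def
    by (intro Collect_cong arg_cong[of _ _ Not] bij_betw_cong)
      (simp add: dirichlet_laplacian_eq_compression[OF W(1)])
  then have bottom: "bottom W = Min {t. complex_of_real t \<in> spectrum_on W ?L}" by (simp add: bottom_def)
  have adj: "adjoint_pair ?L ?L" by (rule adjoint_pair_compression[OF adjoint_pair_free_laplacian])
  have q: "Re (cinner (?L x) x) = energy (ell2_nth x)" if "x \<in> ell2_on W" for x
  proof -
    have "cinner (?L x) x = cinner (free_laplacian x) x"
      using adjoint_pair_proj_op[of W] proj_op_eq[OF that]
      unfolding compression_def adjoint_pair_def blinfun_apply_blinfun_compose by metis
    then show ?thesis by (simp add: Re_cinner_free_laplacian)
  qed
  note gs = ground_state[OF W adj compression_in, folded bottom]
  show "\<exists>x\<in>ell2_on W :: ('g, complex) ell2 set. norm x = 1 \<and> energy (ell2_nth x) = bottom W" using gs(1) q by auto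
  show "bottom W * (norm x)\<^sup>2 \<le> energy (ell2_nth x)" if "x \<in> ell2_on W" using gs(2) q that by simp
qed

lemma energy_nonneg: "0 \<le> energy \<phi>"
  unfolding energy_def by (intro sum_nonneg) auto

lemma penalty_eq: "penalty p b W = sqrt (\<Sum>j\<in>J. beta b j powr (2 - p)) * sqrt (bottom W)"
proof -
  have "(\<Sum>\<^sub>\<infinity>j\<in>UNIV - {0}. beta b j powr (2 - p)) = (\<Sum>\<^sub>\<infinity>j\<in>J. beta b j powr (2 - p))"
    by (rule infsum_cong_neutral) (auto simp: beta_outside J_def)
  then show ?thesis by (simp add: penalty_def bottom_def finite_J)
qed

lemma bottom_nonneg: "finite W \<Longrightarrow> W \<noteq> {} \<Longrightarrow> 0 \<le> bottom W"
  using bottom_variational(1) energy_nonneg by metis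

lemma penalty_nonneg: "finite W \<Longrightarrow> W \<noteq> {} \<Longrightarrow> 0 \<le> penalty p b W"
  unfolding penalty_eq using bottom_nonneg by (simp add: sum_nonneg)

text \<open>Splitting \<open>\<beta>\<^sub>j = \<beta>\<^sub>j powr ((2 - p) / 2) * \<beta>\<^sub>j powr (p / 2)\<close> in the Cauchy-Schwarz inequality turns the
  localisation error into the root of the energy of \<open>\<phi>\<close>, which is minimal for the ground state. Its
  modulus is a real function with no larger energy.\<close>
lemma penalty_attained:
  assumes W: "finite W" "W \<noteq> {}"
  obtains \<phi> :: "'g \<Rightarrow> real" where "\<And>m. m \<notin> W \<Longrightarrow> \<phi> m = 0" "l2norm \<phi> = 1"
    "(\<Sum>j\<in>J. beta b j * l2norm (\<lambda>m. \<phi> (m - j) - \<phi> m)) \<le> penalty p b W"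
proof -
  obtain x :: "('g, complex) ell2" where x: "x \<in> ell2_on W" "norm x = 1" "energy (ell2_nth x) = bottom W"
    using bottom_variational(1)[OF W] by blast
  define \<phi> where "\<phi> m = cmod (ell2_nth x m)" for m
  have diff_le: "l2norm (\<lambda>m. \<phi> (m - j) - \<phi> m) \<le> l2norm (\<lambda>m. ell2_nth x (m - j) - ell2_nth x m)" for j
  proof -
    have "l2norm (\<lambda>m. \<phi> (m - j) - \<phi> m) \<le> 1 * l2norm (\<lambda>m. ell2_nth x (m - j) - ell2_nth x m)"
      by (rule square_summable_dominated(2)[OF square_summable_shift_diff[OF square_summable_ell2_nth]])
        (auto simp: \<phi>_def norm_triangle_ineq3)
    then show ?thesis by simp
  qed
  have "energy \<phi> \<le> energy (ell2_nth x)"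
    unfolding energy_def by (intro sum_mono mult_left_mono power_mono diff_le l2norm_nonneg) auto
  then have energy: "energy \<phi> \<le> bottom W" using x(3) by simp
  have "(\<Sum>j\<in>J. beta b j * l2norm (\<lambda>m. \<phi> (m - j) - \<phi> m))
    = (\<Sum>j\<in>J. \<bar>beta b j powr ((2 - p) / 2)\<bar> * \<bar>beta b j powr (p / 2) * l2norm (\<lambda>m. \<phi> (m - j) - \<phi> m)\<bar>)"
  proof (rule sum.cong)
    fix j assume "j \<in> J"
    then have "beta b j = beta b j powr ((2 - p) / 2) * beta b j powr (p / 2)"
      by (simp add: J_def powr_add[symmetric] add_divide_distrib[symmetric])
    then show "beta b j * l2norm (\<lambda>m. \<phi> (m - j) - \<phi> m)
      = \<bar>beta b j powr ((2 - p) / 2)\<bar> * \<bar>beta b j powr (p / 2) * l2norm (\<lambda>m. \<phi> (m - j) - \<phi> m)\<bar>"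
      by (simp add: abs_mult l2norm_nonneg)
  qed simp
  also have "\<dots> \<le> L2_set (\<lambda>j. beta b j powr ((2 - p) / 2)) J
      * L2_set (\<lambda>j. beta b j powr (p / 2) * l2norm (\<lambda>m. \<phi> (m - j) - \<phi> m)) J"
    by (rule L2_set_mult_ineq)
  also have "\<dots> = sqrt (\<Sum>j\<in>J. beta b j powr (2 - p)) * sqrt (energy \<phi>)"
  proof -
    have half: "(beta b j powr (s / 2))\<^sup>2 = beta b j powr s" for j s
      by (simp add: power2_eq_square powr_add[symmetric])
    show ?thesis unfolding L2_set_def energy_def power_mult_distrib half ..
  qed
  also have "\<dots> \<le> penalty p b W"
    unfolding penalty_eq using energy by (intro mult_left_mono) (auto simp: sum_nonneg)
  finally have "(\<Sum>j\<in>J. beta b j * l2norm (\<lambda>m. \<phi> (m - j) - \<phi> m)) \<le> penalty p b W" .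
  moreover have "\<phi> m = 0" if "m \<notin> W" for m using x(1) that by (simp add: \<phi>_def ell2_on_def)
  moreover have "l2norm \<phi> = 1" using x(2) by (simp add: norm_ell2_def l2norm_def \<phi>_def)
  ultimately show ?thesis using that by blast
qed

text \<open>The indicator function of \<open>B\<close> has energy \<open>\<Sum>j. \<beta>\<^sub>j powr p * \<bar>(B + j) \<triangle> B\<bar>\<close>. The factor 2 accounts for the
  two halves of the symmetric difference, which have the same size.\<close>
lemma bottom_le_isoperimetric:
  assumes W: "finite W" and B: "B \<subseteq> W" "B \<noteq> {}"
    and c: "\<And>j. j \<in> J \<Longrightarrow> real (card ((\<lambda>m. m + j) ` B - B)) \<le> c * real (card B)"
  shows "bottom W \<le> 2 * c * (\<Sum>j\<in>J. beta b j powr p)"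
proof -
  have fin: "finite B" using W B(1) finite_subset by blast
  then have cB: "0 < real (card B)" using B(2) by (simp add: card_gt_0_iff)
  define x :: "('g, complex) ell2" where "x = Abs_ell2 (\<lambda>i. if i \<in> B then 1 else 0)"
  have x: "ell2_nth x i = (if i \<in> B then 1 else 0)" for i
    unfolding x_def by (subst ell2_nth_Abs, rule square_summable_finite_support[OF fin]) auto
  have xW: "x \<in> ell2_on W" using B(1) by (auto simp: ell2_on_def x)
  have "(norm x)\<^sup>2 = (\<Sum>\<^sub>\<infinity>i\<in>B. 1)"
    unfolding norm_ell2_sq by (rule infsum_cong_neutral) (auto simp: x)
  then have nx: "(norm x)\<^sup>2 = real (card B)" using fin by simp
  have D: "(l2norm (\<lambda>m. ell2_nth x (m - j) - ell2_nth x m))\<^sup>2 \<le> 2 * c * real (card B)" if j: "j \<in> J" for j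
  proof -
    let ?Bj = "(\<lambda>m. m + j) ` B"
    have mem: "i - j \<in> B \<longleftrightarrow> i \<in> ?Bj" for i
      by (auto simp: image_iff) (metis diff_add_cancel)
    have cj: "card ?Bj = card B" by (rule card_image) (auto simp: inj_on_def)
    have "(l2norm (\<lambda>m. ell2_nth x (m - j) - ell2_nth x m))\<^sup>2
      = (\<Sum>\<^sub>\<infinity>m. (norm (ell2_nth x (m - j) - ell2_nth x m))\<^sup>2)"
      by (simp add: l2norm_def infsum_nonneg)
    also have "\<dots> = (\<Sum>\<^sub>\<infinity>m\<in>(?Bj - B) \<union> (B - ?Bj). 1)"
      by (rule infsum_cong_neutral) (auto simp: x mem)
    also have "\<dots> = real (card ((?Bj - B) \<union> (B - ?Bj)))" using fin by simp
    also have "card ((?Bj - B) \<union> (B - ?Bj)) = card (?Bj - B) + card (B - ?Bj)"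
      using fin by (intro card_Un_disjoint) auto
    also have "card (B - ?Bj) = card (?Bj - B)"
    proof -
      have "card B = card (B - ?Bj) + card (B \<inter> ?Bj)"
        using fin by (subst card_Un_disjoint[symmetric]) (auto intro!: arg_cong[of _ _ card])
      moreover have "card ?Bj = card (?Bj - B) + card (B \<inter> ?Bj)"
        using fin by (subst card_Un_disjoint[symmetric]) (auto intro!: arg_cong[of _ _ card])
      ultimately show ?thesis using cj by linarith
    qed
    finally show ?thesis using c[OF j] by simp
  qed
  have "bottom W * real (card B) \<le> energy (ell2_nth x)"
    using bottom_variational(2)[OF W _ xW] B by (auto simp: nx)
  also have "\<dots> \<le> (\<Sum>j\<in>J. beta b j powr p * (2 * c * real (card B)))"
    unfolding energy_def by (intro sum_mono mult_left_mono D) auto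
  also have "\<dots> = 2 * c * (\<Sum>j\<in>J. beta b j powr p) * real (card B)"
    by (simp add: sum_distrib_left sum_distrib_right mult_ac)
  finally show ?thesis using cB by (simp add: mult_le_cancel_right)
qed

end

section \<open>Balls of the graph\<close>

lemma graph_ball_iff: "l \<in> graph_ball w k r \<longleftrightarrow> (\<exists>n\<le>r. (k, l) \<in> {(i, j). w i j > 0} ^^ n)"
proof -
  let ?N = "{n. (k, l) \<in> {(i, j). w i j > 0} ^^ n}"
  have "graph_dist w k l \<le> enat r \<longleftrightarrow> (\<exists>n\<in>?N. n \<le> r)"
  proof
    assume le: "graph_dist w k l \<le> enat r"
    have "graph_dist w k l < enat (Suc r)"
      using le by (rule le_less_trans) simp
    then show "\<exists>n\<in>?N. n \<le> r"
      unfolding graph_dist_def INF_less_iff by auto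
  next
    assume "\<exists>n\<in>?N. n \<le> r"
    then obtain n where "n \<in> ?N" "n \<le> r" by blast
    then show "graph_dist w k l \<le> enat r"
      unfolding graph_dist_def by (intro INF_lower2[of n]) auto
  qed
  then show ?thesis by (simp add: graph_ball_def) blast
qed

lemma graph_ball_self: "k \<in> graph_ball w k r"
  unfolding graph_ball_iff by (intro exI[of _ 0]) auto

lemma graph_ball_step: "l \<in> graph_ball w k r \<Longrightarrow> w l m > 0 \<Longrightarrow> m \<in> graph_ball w k (Suc r)"
  unfolding graph_ball_iff by (metis (mono_tags, lifting) Suc_le_mono case_prodI mem_Collect_eq relpow_Suc_I)

lemma graph_ball_mono: "r \<le> s \<Longrightarrow> graph_ball w k r \<subseteq> graph_ball w k s"
  unfolding graph_ball_iff subset_iff by (meson order_trans)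

lemma card_graph_ball_translate:
  fixes w :: "'g::ab_group_add \<Rightarrow> 'g \<Rightarrow> real"
  assumes w: "\<And>k l t. w (k + t) (l + t) = w k l"
  shows "card (graph_ball w k r) = card (graph_ball w 0 r)"
proof -
  let ?R = "{(i, j). w i j > 0}"
  have imp: "(k, l) \<in> ?R ^^ n \<Longrightarrow> (k + t, l + t) \<in> ?R ^^ n" for k l t n
  proof (induction n arbitrary: l)
    case (Suc n)
    from Suc.prems obtain m where m: "(k, m) \<in> ?R ^^ n" "w m l > 0" by auto
    have "(m + t, l + t) \<in> ?R" using m(2) w by simp
    with Suc.IH[OF m(1)] show ?case by (rule relpow_Suc_I)
  qed simp
  have "bij_betw (\<lambda>l. l + k) (graph_ball w 0 r) (graph_ball w k r)"
  proof (rule bij_betwI[where g = "\<lambda>l. l - k"])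
    have "(k, l + k) \<in> ?R ^^ n" if "(0, l) \<in> ?R ^^ n" for l n using imp[OF that, of k] by simp
    then show "(\<lambda>l. l + k) \<in> graph_ball w 0 r \<rightarrow> graph_ball w k r"
      unfolding Pi_iff Ball_def graph_ball_iff by blast
    have "(0, l - k) \<in> ?R ^^ n" if "(k, l) \<in> ?R ^^ n" for l n using imp[OF that, of "- k"] by simp
    then show "(\<lambda>l. l - k) \<in> graph_ball w k r \<rightarrow> graph_ball w 0 r"
      unfolding Pi_iff Ball_def graph_ball_iff by blast
  qed auto
  then show ?thesis by (rule bij_betw_same_card[symmetric])
qed

text \<open>If the volume grew by a factor \<open>1 + \<eta>\<close> at each step, the growth rate would be at least
  \<open>ln (1 + \<eta>)\<close>.\<close>
lemma subexponential_growth_step: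
  fixes w :: "'g::ab_group_add \<Rightarrow> 'g \<Rightarrow> real"
  assumes w: "\<And>k l t. w (k + t) (l + t) = w k l" and growth: "subexponential_growth w" and "0 < \<eta>"
  obtains r where "real (card (graph_ball w 0 (Suc r))) \<le> (1 + \<eta>) * real (card (graph_ball w 0 r))"
proof (rule ccontr)
  define v where "v r = real (card (graph_ball w 0 r))" for r
  have vol: "real (card (graph_ball w k r)) = v r" for k r
    using card_graph_ball_translate[of w k r, OF w] by (simp add: v_def)
  assume "\<not> thesis"
  then have grow: "(1 + \<eta>) * v r < v (Suc r)" for r using that[of r] unfolding v_def by linarith
  have fin: "finite (graph_ball w 0 r)" for r using growth by (simp add: subexponential_growth_def)
  have v0: "1 \<le> v r" for r
  proof -
    have "0 < card (graph_ball w 0 r)" using graph_ball_self[of 0 w r] fin[of r] by (auto simp: card_gt_0_iff)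
    then show ?thesis by (simp add: v_def)
  qed
  have pow: "(1 + \<eta>) ^ r \<le> v r" for r
  proof (induction r)
    case (Suc r)
    have "(1 + \<eta>) ^ Suc r \<le> (1 + \<eta>) * v r" using Suc \<open>0 < \<eta>\<close> by (simp add: mult_left_mono)
    also have "\<dots> \<le> v (Suc r)" using grow by (rule less_imp_le)
    finally show ?case .
  qed (use v0 in simp)
  have le: "ln (1 + \<eta>) - ln (v 1) * inverse (real r) \<le> 1 / real r * ln (v r / v 1)" if "0 < r" for r
  proof -
    have "real r * ln (1 + \<eta>) = ln ((1 + \<eta>) ^ r)" using \<open>0 < \<eta>\<close> by (simp add: ln_realpow)
    also have "\<dots> \<le> ln (v r)" using pow[of r] \<open>0 < \<eta>\<close> v0[of r] by (intro ln_mono) auto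
    finally have "real r * ln (1 + \<eta>) - ln (v 1) \<le> ln (v r / v 1)"
      using v0[of r] v0[of 1] by (simp add: ln_div)
    then have "1 / real r * (real r * ln (1 + \<eta>) - ln (v 1)) \<le> 1 / real r * ln (v r / v 1)"
      by (rule mult_left_mono) simp
    moreover have "1 / real r * (real r * ln (1 + \<eta>) - ln (v 1)) = ln (1 + \<eta>) - ln (v 1) * inverse (real r)"
      using that by (simp add: right_diff_distrib divide_inverse)
    ultimately show ?thesis by simp
  qed
  have "(\<lambda>r. ln (1 + \<eta>) - ln (v 1) * inverse (real r)) \<longlonglongrightarrow> ln (1 + \<eta>) - ln (v 1) * 0"
    by (intro tendsto_intros lim_inverse_n)
  then have "(\<lambda>r. ereal (ln (1 + \<eta>) - ln (v 1) * inverse (real r))) \<longlonglongrightarrow> ereal (ln (1 + \<eta>))"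
    by simp
  then have "ereal (ln (1 + \<eta>)) = liminf (\<lambda>r. ereal (ln (1 + \<eta>) - ln (v 1) * inverse (real r)))"
    by (intro lim_imp_Liminf[symmetric]) simp_all
  also have "\<dots> \<le> liminf (\<lambda>r. ereal (1 / real r * ln (v r / v 1)))"
    by (rule Liminf_mono) (use le in \<open>auto simp: eventually_sequentially intro!: exI[of _ 1]\<close>)
  also have "\<dots> = liminf (\<lambda>r. INF k. ereal
      (1 / real r * ln (real (card (graph_ball w k r)) / real (card (graph_ball w k 1)))))"
    by (simp add: vol)
  also have "\<dots> = 0" using growth by (simp add: subexponential_growth_def)
  finally have "ln (1 + \<eta>) \<le> 0" by simp
  then show False using \<open>0 < \<eta>\<close> ln_gt_zero[of "1 + \<eta>"] by simp
qed

section \<open>The penalty tends to zero\<close>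

context hopping_weights
begin

lemma wiener_graph_pos_iff: "0 < wiener_graph p b k l \<longleftrightarrow> l - k \<in> J"
proof -
  have "(norm_inf (b (k - l)) + norm_inf (b (l - k))) / 2 = beta b (l - k)"
    by (simp add: beta_def add.commute)
  then show ?thesis using beta_nonneg[of "l - k"] by (auto simp: wiener_graph_def J_def)
qed

lemma wiener_graph_translate: "wiener_graph p b (k + t) (l + t) = wiener_graph p b k l"
  by (simp add: wiener_graph_def)

text \<open>A ball whose volume hardly grows in the next step has a small boundary, and it is contained in
  \<open>W n\<close> for large \<open>n\<close>.\<close>
lemma bottom_tendsto_0:
  assumes growth: "subexponential_growth (wiener_graph p b)"
    and W: "\<And>n. finite (W n)" "\<And>n. W n \<noteq> {}" "\<And>n. W n \<subseteq> W (Suc n)" "(\<Union>n. W n) = UNIV"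
  shows "(\<lambda>n. bottom (W n)) \<longlonglongrightarrow> 0"
proof (rule LIMSEQ_I)
  fix e :: real assume "0 < e"
  define G where "G = (\<Sum>j\<in>J. beta b j powr p)"
  have G: "0 \<le> G" unfolding G_def by (intro sum_nonneg) auto
  define \<eta> where "\<eta> = e / (2 * (G + 1))"
  have \<eta>: "0 < \<eta>" using \<open>0 < e\<close> G by (simp add: \<eta>_def)
  let ?w = "wiener_graph p b"
  obtain r where r: "real (card (graph_ball ?w 0 (Suc r))) \<le> (1 + \<eta>) * real (card (graph_ball ?w 0 r))"
    using subexponential_growth_step[OF wiener_graph_translate growth \<eta>] by blast
  define B where "B = graph_ball ?w 0 r"
  have fin: "finite (graph_ball ?w 0 s)" for s using growth by (simp add: subexponential_growth_def)
  have B: "B \<noteq> {}" using graph_ball_self[of 0 ?w r] by (auto simp: B_def)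
  have c: "real (card ((\<lambda>m. m + j) ` B - B)) \<le> \<eta> * real (card B)" if "j \<in> J" for j
  proof -
    have "(\<lambda>m. m + j) ` B \<subseteq> graph_ball ?w 0 (Suc r)"
      using that by (auto simp: B_def intro!: graph_ball_step simp: wiener_graph_pos_iff)
    then have "card ((\<lambda>m. m + j) ` B - B) \<le> card (graph_ball ?w 0 (Suc r) - B)"
      using fin by (intro card_mono) auto
    also have "\<dots> = card (graph_ball ?w 0 (Suc r)) - card B"
      unfolding B_def by (intro card_Diff_subset fin graph_ball_mono) simp
    finally have "card ((\<lambda>m. m + j) ` B - B) + card B \<le> card (graph_ball ?w 0 (Suc r))"
      using card_mono[OF fin[of "Suc r"] graph_ball_mono[of r "Suc r" ?w 0]] by (simp add: B_def)
    then have "real (card ((\<lambda>m. m + j) ` B - B)) + real (card B) \<le> real (card (graph_ball ?w 0 (Suc r)))"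
      by linarith
    with r show ?thesis by (simp add: B_def distrib_right)
  qed
  have mono: "W m \<subseteq> W n" if "m \<le> n" for m n using lift_Suc_mono_le[of W, OF W(3) that] .
  have "\<exists>N. B \<subseteq> W N"
  proof -
    have "finite B" using fin by (simp add: B_def)
    then show ?thesis
    proof (induction B rule: finite_induct)
      case (insert m B)
      then obtain N where "B \<subseteq> W N" by blast
      moreover obtain M where "m \<in> W M" using W(4) by blast
      ultimately show ?case using mono[of N "max M N"] mono[of M "max M N"] by (intro exI[of _ "max M N"]) auto
    qed simp
  qed
  then obtain N where N: "B \<subseteq> W N" by blast
  have "norm (bottom (W n) - 0) < e" if "N \<le> n" for n
  proof -
    have "bottom (W n) \<le> 2 * \<eta> * G"
      unfolding G_def using N mono[OF that] by (intro bottom_le_isoperimetric[OF W(1) _ B c]) auto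
    also have "\<dots> < e" using \<open>0 < e\<close> G by (simp add: \<eta>_def field_simps)
    finally show ?thesis using bottom_nonneg[OF W(1,2), of n] by simp
  qed
  then show "\<exists>no. \<forall>n\<ge>no. norm (bottom (W n) - 0) < e" by blast
qed

lemma penalty_tendsto_0:
  assumes "subexponential_growth (wiener_graph p b)"
    and "\<And>n. finite (W n)" "\<And>n. W n \<noteq> {}" "\<And>n. W n \<subseteq> W (Suc n)" "(\<Union>n. W n) = UNIV"
  shows "(\<lambda>n. penalty p b (W n)) \<longlonglongrightarrow> 0"
proof -
  have "(\<lambda>n. penalty p b (W n)) \<longlonglongrightarrow> sqrt (\<Sum>j\<in>J. beta b j powr (2 - p)) * sqrt 0"
    unfolding penalty_eq by (intro tendsto_intros bottom_tendsto_0 assms)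
  then show ?thesis by simp
qed

end

section \<open>Operators in the Wiener algebra\<close>

lemma norm_le_norm_inf:
  assumes "b \<in> linf"
  shows "norm (b i) \<le> norm_inf b"
proof -
  have "bdd_above (range (\<lambda>i. norm (b i)))"
    using assms by (auto simp: linf_def bounded_iff bdd_above_def)
  then show ?thesis unfolding norm_inf_def by (rule cSUP_upper[OF UNIV_I])
qed

lemma norm_inf_nonneg: "b \<in> linf \<Longrightarrow> 0 \<le> norm_inf b"
  by (rule order_trans[OF norm_ge_zero norm_le_norm_inf])

lemma ell2_nth_weighted_shift:
  assumes "b \<in> linf"
  shows "ell2_nth ((mult_op b o\<^sub>L shift_op j) x) i = b i (ell2_nth x (i - j))"
  using assms by (simp add: linf_def ell2_nth_mult_op ell2_nth_shift_op)

lemma diagonal_bounded_weighted_shift: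
  assumes "b \<in> linf"
  shows "diagonal_bounded j (norm_inf b) (mult_op b o\<^sub>L shift_op j)"
  unfolding diagonal_bounded_def ell2_nth_weighted_shift[OF assms]
proof (intro conjI allI)
  show "0 \<le> norm_inf b" by (rule norm_inf_nonneg[OF assms])
  show "norm (b i (ell2_nth x (i - j))) \<le> norm_inf b * norm (ell2_nth x (i - j))" for x i
    by (rule order_trans[OF norm_blinfun]) (simp add: norm_le_norm_inf[OF assms] mult_right_mono)
qed

lemma clinear_op_weighted_shift:
  assumes "b \<in> linf"
  shows "clinear_op (mult_op b o\<^sub>L shift_op j)"
  unfolding clinear_op_def
proof (intro allI)
  have b: "b i (c *\<^sub>C u) = c *\<^sub>C b i u" for i c u
    using assms by (simp add: linf_def clinear_op_def)
  show "(mult_op b o\<^sub>L shift_op j) (c *\<^sub>C x) = c *\<^sub>C (mult_op b o\<^sub>L shift_op j) x" for c x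
    by (rule ell2_eqI) (simp only: ell2_nth_weighted_shift[OF assms] ell2_nth_simps b)
qed

lemma ell2_on_UNIV: "ell2_on UNIV = UNIV"
  by (simp add: ell2_on_def)

context hopping_weights
begin

text \<open>The norms of the coefficients enter the localisation error linearly, so they may be averaged
  over \<open>j\<close> and \<open>- j\<close>. This is why the error is kept as a sum over \<open>j\<close> and the Cauchy-Schwarz inequality
  is applied last: it produces powers with exponent \<open>2 - p\<close>, and by convexity, for \<open>p \<le> 1\<close>,
  averaging these would give at least \<open>\<beta>\<^sub>j powr (2 - p)\<close>.\<close>
lemma sum_symmetrized:
  assumes d: "\<And>j. d (- j) = d j" and "d 0 = 0"
  shows "(\<Sum>j\<in>insert 0 J. norm_inf (b j) * d j) = (\<Sum>j\<in>J. beta b j * d j)"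
    and "(\<Sum>j\<in>insert 0 J. norm_inf (b (- j)) * d j) = (\<Sum>j\<in>J. beta b j * d j)"
proof -
  have J0: "0 \<notin> J" by (simp add: J_def)
  have flip: "(\<Sum>j\<in>J. norm_inf (b (- j)) * d j) = (\<Sum>j\<in>J. norm_inf (b j) * d j)"
    using sum_J_uminus[of "\<lambda>j. norm_inf (b j) * d j"] by (simp add: d)
  have "(\<Sum>j\<in>J. beta b j * d j) = ((\<Sum>j\<in>J. norm_inf (b j) * d j) + (\<Sum>j\<in>J. norm_inf (b (- j)) * d j)) / 2"
    by (simp add: beta_def sum.distrib[symmetric] distrib_right sum_divide_distrib)
  then show "(\<Sum>j\<in>insert 0 J. norm_inf (b j) * d j) = (\<Sum>j\<in>J. beta b j * d j)"
    "(\<Sum>j\<in>insert 0 J. norm_inf (b (- j)) * d j) = (\<Sum>j\<in>J. beta b j * d j)"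
    using flip finite_J J0 assms(2) by simp_all
qed

end

text \<open>The adjoint of the diagonal with offset \<open>- j\<close> has offset \<open>j\<close>, so \<open>A'\<close> satisfies the same
  assumptions as \<open>A\<close> with the coefficient norms reflected, which leaves \<open>\<beta>\<close> unchanged.\<close>
theorem wiener_localization:
  fixes A :: "('g::ab_group_add, 'y::complex_hilbert_space) ell2 \<Rightarrow>\<^sub>L ('g, 'y) ell2"
  assumes rep: "wiener_rep p A b" and weights: "hopping_weights b"
  obtains A' where "adjoint_pair A A'"
    and "\<And>W z e. finite W \<Longrightarrow> W \<noteq> {} \<Longrightarrow> pseudo_eigenvalue UNIV A z e \<Longrightarrow>
      \<exists>k. pseudo_eigenvalue (ell2_on ((\<lambda>w. k + w) ` W)) A z (e + penalty p b W)"
    and "\<And>W z e. finite W \<Longrightarrow> W \<noteq> {} \<Longrightarrow> pseudo_eigenvalue UNIV A' z e \<Longrightarrow>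
      \<exists>k. pseudo_eigenvalue (ell2_on ((\<lambda>w. k + w) ` W)) A' z (e + penalty p b W)"
proof -
  interpret hopping_weights p b by (rule weights)
  have b: "b j \<in> linf" for j using rep by (simp add: wiener_rep_def)
  define T where "T j = mult_op (b j) o\<^sub>L shift_op j" for j
  have T: "diagonal_bounded j (norm_inf (b j)) (T j)" for j
    unfolding T_def by (rule diagonal_bounded_weighted_shift[OF b])
  have T0: "T j = 0" if "j \<notin> insert 0 J" for j
  proof -
    have "beta b j = 0" using that beta_outside by auto
    then have "norm_inf (b j) = 0"
      using norm_inf_nonneg[OF b[of j]] norm_inf_nonneg[OF b[of "- j"]] by (simp add: beta_def)
    then have "ell2_nth (T j x) i = 0" for x i using T[of j] by (simp add: diagonal_bounded_def)
    then show ?thesis by (intro blinfun_eqI ell2_eqI) simp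
  qed
  have "(T has_sum A) UNIV" using rep by (simp add: wiener_rep_def T_def[abs_def])
  then have "(T has_sum A) (insert 0 J)"
    by (rule has_sum_cong_neutral[THEN iffD1, rotated -1]) (use T0 in auto)
  then have A: "A = (\<Sum>j\<in>insert 0 J. T j)" using finite_J by (simp add: has_sum_finite_iff)
  have "\<exists>T'. adjoint_pair (T j) T'" for j
    using adjoint_pair_exists[OF clinear_op_weighted_shift[OF b]] unfolding T_def by blast
  then obtain T' where T': "\<And>j. adjoint_pair (T j) (T' j)" by metis
  define A' where "A' = (\<Sum>j\<in>insert 0 J. T' j)"
  have adj: "adjoint_pair A A'" unfolding A A'_def by (rule adjoint_pair_sum) (rule T')
  have A': "A' = (\<Sum>j\<in>insert 0 J. T' (- j))"
    unfolding A'_def by (rule sum.reindex_bij_witness[of _ uminus uminus]) (auto simp: J_def beta_uminus)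
  have T'_diag: "diagonal_bounded j (norm_inf (b (- j))) (T' (- j))" for j
    using diagonal_bounded_adjoint[OF T' T, of "- j"] by simp
  have loc: "\<exists>k. pseudo_eigenvalue (ell2_on ((\<lambda>w. k + w) ` W)) D z (e + penalty p b W)"
    if W: "finite W" "W \<noteq> {}" and ev: "pseudo_eigenvalue UNIV D z e"
      and D: "D = (\<Sum>j\<in>insert 0 J. R j)" "\<And>j. diagonal_bounded j (a j) (R j)"
      and a: "\<And>d. (\<And>j. d (- j) = d j) \<Longrightarrow> d 0 = 0 \<Longrightarrow> (\<Sum>j\<in>insert 0 J. a j * d j) = (\<Sum>j\<in>J. beta b j * d j)"
    for W z e D R a
  proof -
    obtain \<phi> :: "'g \<Rightarrow> real" where \<phi>: "\<And>m. m \<notin> W \<Longrightarrow> \<phi> m = 0" "l2norm \<phi> = 1"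
      "(\<Sum>j\<in>J. beta b j * l2norm (\<lambda>m. \<phi> (m - j) - \<phi> m)) \<le> penalty p b W"
      using penalty_attained[OF W] by blast
    obtain k where "pseudo_eigenvalue (ell2_on ((\<lambda>w. k + w) ` W)) D z
        (e + (\<Sum>j\<in>insert 0 J. a j * l2norm (\<lambda>m. \<phi> (m - j) - \<phi> m)))"
      using localize_pseudo_eigenvector[OF _ D(1) D(2) W(1) \<phi>(1,2) ev] finite_J by auto
    moreover have "(\<Sum>j\<in>insert 0 J. a j * l2norm (\<lambda>m. \<phi> (m - j) - \<phi> m)) \<le> penalty p b W"
      using a[of "\<lambda>j. l2norm (\<lambda>m. \<phi> (m - j) - \<phi> m)", OF l2norm_shift_diff_uminus] \<phi>(3)
      by (simp add: l2norm_def)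
    ultimately show ?thesis using pseudo_eigenvalue_mono[OF _ add_left_mono] by blast
  qed
  show ?thesis
    using that[OF adj] loc[OF _ _ _ A T sum_symmetrized(1)] loc[OF _ _ _ A' T'_diag sum_symmetrized(2)]
    by blast
qed

section \<open>Hausdorff convergence\<close>

lemma Spec_closed_eq_Inter:
  assumes "0 \<le> e"
  shows "Spec_closed e I B = (\<Inter>d\<in>{e<..}. spec_open d I B)"
proof -
  have "m \<le> ennreal e \<longleftrightarrow> (\<forall>d>e. m < ennreal d)" for m :: ennreal
  proof
    assume "m \<le> ennreal e"
    then show "\<forall>d>e. m < ennreal d" using assms by (auto intro: le_less_trans ennreal_lessI)
  next
    assume less: "\<forall>d>e. m < ennreal d"
    show "m \<le> ennreal e"
    proof (rule ccontr)
      assume "\<not> m \<le> ennreal e"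
      then have "ennreal e < m" by simp
      then obtain c where c: "ennreal e < c" "c < m" using dense by blast
      then obtain d where "c = ennreal d" "0 \<le> d" by (cases c) auto
      with c less assms show False by (auto simp: ennreal_less_iff)
    qed
  qed
  then show ?thesis by (auto simp: Spec_closed_def spec_open_def)
qed

lemma spec_open_subset_Spec_closed: "spec_open e I B \<subseteq> Spec_closed e I B"
  by (auto simp: spec_open_def Spec_closed_def)

lemma Spec_closed_mono: "d \<le> e \<Longrightarrow> Spec_closed d I B \<subseteq> Spec_closed e I B"
  using order_trans[OF _ ennreal_leI] by (auto simp: Spec_closed_def)

lemma spec_open_eq_pseudospectrum:
  fixes B B' :: "('g, 'y::complex_hilbert_space) ell2 \<Rightarrow>\<^sub>L ('g, 'y) ell2"
  assumes "hilbert_operator (ell2_on I) B B'"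
  shows "spec_open e I B = hilbert_operator.pseudospectrum (ell2_on I) B B' e"
proof -
  interpret hilbert_operator "ell2_on I" B B' by (rule assms)
  show ?thesis
    unfolding spec_open_def pseudospectrum_def using mu_less_iff[OF adjoint inv inv'] by simp
qed

lemma hausdorff_convergesI:
  assumes inner: "\<And>n. T \<subseteq> closure (X n)"
    and outer: "\<And>\<eta>. 0 < \<eta> \<Longrightarrow> \<forall>\<^sub>F n in sequentially. \<forall>s\<in>X n. \<exists>t\<in>T. dist s t < \<eta>"
  shows "hausdorff_converges X T"
  unfolding hausdorff_converges_def
proof (rule order_tendstoI)
  fix a :: ennreal assume "0 < a"
  then obtain c where c: "0 < c" "c < a" using dense by blast
  then obtain \<eta> where \<eta>: "c = ennreal \<eta>" "0 \<le> \<eta>" by (cases c) auto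
  have "0 < \<eta>" using c(1) \<eta> by simp
  from outer[OF this] show "\<forall>\<^sub>F n in sequentially. hausdorff_distance (X n) T < a"
  proof eventually_elim
    case (elim n)
    have "(SUP s\<in>X n. INF t\<in>T. ennreal (dist s t)) \<le> ennreal \<eta>"
    proof (rule SUP_least)
      fix s assume "s \<in> X n"
      then obtain t where "t \<in> T" "dist s t < \<eta>" using elim by blast
      then show "(INF t\<in>T. ennreal (dist s t)) \<le> ennreal \<eta>"
        by (intro INF_lower2[of t]) (auto intro: ennreal_leI)
    qed
    moreover have "(SUP t\<in>T. INF s\<in>X n. ennreal (dist t s)) \<le> ennreal \<eta>"
    proof (rule SUP_least)
      fix t assume "t \<in> T"
      then obtain s where "s \<in> X n" "dist s t < \<eta>"
        using inner[of n] \<open>0 < \<eta>\<close> by (auto simp: closure_approachable subset_iff)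
      then show "(INF s\<in>X n. ennreal (dist t s)) \<le> ennreal \<eta>"
        by (intro INF_lower2[of s]) (auto intro: ennreal_leI simp: dist_commute)
    qed
    ultimately have "hausdorff_distance (X n) T \<le> ennreal \<eta>" by (simp add: hausdorff_distance_def)
    then show ?case using c(2) \<eta>(1) by simp
  qed
qed simp

text \<open>A sequence that stays in the \<open>S n\<close> along a subsequence only can be completed to a full
  sequence when all \<open>S n\<close> are non-empty.\<close>
lemma set_limsupI:
  assumes "\<And>n. S n \<noteq> {}" and "strict_mono r" and "\<And>n. u n \<in> S (r n)" and "u \<longlonglongrightarrow> l"
  shows "l \<in> set_limsup S"
proof -
  define s where "s m = (if m \<in> range r then u (inv r m) else (SOME z. z \<in> S m))" for m
  have inj: "inj r" using assms(2) by (rule strict_mono_imp_inj_on)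
  have "s m \<in> S m" for m
    using assms(3) some_in_eq[of "S m"] assms(1)[of m] by (auto simp: s_def inj)
  moreover have "s \<circ> r = u" by (auto simp: s_def inj)
  ultimately show ?thesis using assms(2,4) unfolding set_limsup_def by auto
qed

text \<open>A point of the union of the patch pseudospectra that stays away from \<open>T\<close> infinitely often
  has, by boundedness, a partial limit; absence of pollution puts it into \<open>T\<close>.\<close>
lemma eventually_near_no_pollution:
  fixes P :: "real \<Rightarrow> nat \<Rightarrow> complex set" and Q :: "real \<Rightarrow> complex set"
  assumes mono: "\<And>d e n. d \<le> e \<Longrightarrow> P d n \<subseteq> P e n"
    and bounded: "\<And>e n z. 0 \<le> e \<Longrightarrow> z \<in> P e n \<Longrightarrow> cmod z \<le> C + e"
    and nonempty: "\<And>d n m e. 0 < d \<Longrightarrow> 0 \<le> e \<Longrightarrow> P e m \<noteq> {} \<Longrightarrow> P d n \<noteq> {}"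
    and limsup: "\<And>d. 0 < d \<Longrightarrow> set_limsup (P d) \<subseteq> Q d"
    and T: "(\<Inter>d\<in>{\<epsilon><..}. Q d) \<subseteq> T"
    and "0 < \<epsilon>" and pen: "pen \<longlonglongrightarrow> 0" "\<And>n. 0 \<le> pen n" and "0 < \<eta>"
  shows "\<forall>\<^sub>F n in sequentially. \<forall>s\<in>P (\<epsilon> + pen n) n. \<exists>t\<in>T. dist s t < \<eta>"
proof (rule ccontr)
  define bad where "bad n s \<longleftrightarrow> s \<in> P (\<epsilon> + pen n) n \<and> (\<forall>t\<in>T. \<eta> \<le> dist s t)" for n s
  assume "\<not> (\<forall>\<^sub>F n in sequentially. \<forall>s\<in>P (\<epsilon> + pen n) n. \<exists>t\<in>T. dist s t < \<eta>)"
  then have "\<forall>N. \<exists>n\<ge>N. \<exists>s. bad n s"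
    unfolding eventually_sequentially bad_def by (meson not_less)
  then have "infinite {n. \<exists>s. bad n s}" by (simp add: infinite_nat_iff_unbounded_le)
  from infinite_enumerate[OF this]
  obtain r :: "nat \<Rightarrow> nat" where r: "strict_mono r" "\<And>n. \<exists>s. bad (r n) s" by auto
  then obtain s where s: "\<And>n. bad (r n) (s n)" by metis
  obtain D where D: "\<And>n. \<bar>pen n\<bar> \<le> D"
    using convergent_imp_Bseq[OF convergentI[OF pen(1)]] unfolding Bseq_def by auto
  have "cmod (s n) \<le> C + (\<epsilon> + D)" for n
  proof -
    have "cmod (s n) \<le> C + (\<epsilon> + pen (r n))" using bounded[of "\<epsilon> + pen (r n)" "s n" "r n"] s[of n] pen(2)[of "r n"] \<open>0 < \<epsilon>\<close> by (simp add: bad_def)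
    then show ?thesis using D[of "r n"] by linarith
  qed
  then have "bounded (range s)" unfolding bounded_iff by blast
  then obtain l q where l: "strict_mono q" "(s \<circ> q) \<longlonglongrightarrow> l"
    using bounded_imp_convergent_subsequence by blast
  have "l \<in> Q d" if "\<epsilon> < d" for d
  proof -
    have "(\<lambda>n. pen (r (q n))) \<longlonglongrightarrow> 0"
      using LIMSEQ_subseq_LIMSEQ[OF LIMSEQ_subseq_LIMSEQ[OF pen(1) r(1)] l(1)] by (simp add: o_def)
    then have "\<forall>\<^sub>F n in sequentially. pen (r (q n)) < d - \<epsilon>"
      by (rule order_tendstoD(2)) (use that in simp)
    then obtain N where N: "\<And>n. n \<ge> N \<Longrightarrow> pen (r (q n)) < d - \<epsilon>"
      by (auto simp: eventually_sequentially)
    have "l \<in> set_limsup (P d)"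
    proof (rule set_limsupI)
      show "P d n \<noteq> {}" for n
        using nonempty[of d "\<epsilon> + pen (r 0)" "r 0" n] s[of 0] \<open>0 < \<epsilon>\<close> pen(2)[of "r 0"] that by (auto simp: bad_def)
      show "strict_mono (\<lambda>n. r (q (n + N)))"
        using r(1) l(1) by (simp add: strict_mono_def)
      show "s (q (n + N)) \<in> P d (r (q (n + N)))" for n
      proof -
        have "\<epsilon> + pen (r (q (n + N))) \<le> d" using N[of "n + N"] by simp
        then show ?thesis using mono s[of "q (n + N)"] by (auto simp: bad_def)
      qed
      show "(\<lambda>n. s (q (n + N))) \<longlonglongrightarrow> l"
        using LIMSEQ_ignore_initial_segment[OF l(2), of N] by (simp add: o_def)
    qed
    then show ?thesis using limsup[of d] that \<open>0 < \<epsilon>\<close> by auto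
  qed
  then have "l \<in> T" using T by auto
  have "\<forall>\<^sub>F n in sequentially. dist ((s \<circ> q) n) l < \<eta>" by (rule tendstoD[OF l(2) \<open>0 < \<eta>\<close>])
  then obtain n where "dist (s (q n)) l < \<eta>" by (auto simp: eventually_sequentially)
  with s[of "q n"] \<open>l \<in> T\<close> show False by (auto simp: bad_def)
qed

lemma near_closure:
  assumes "\<And>s. s \<in> X \<Longrightarrow> \<exists>t\<in>T. dist s t < \<eta> / 2" "0 < \<eta>" "s \<in> closure X"
  shows "\<exists>t\<in>T. dist s (t::complex) < \<eta>"
proof -
  obtain x where x: "x \<in> X" "dist x s < \<eta> / 2"
    using assms(2,3) half_gt_zero unfolding closure_approachable by blast
  obtain t where t: "t \<in> T" "dist x t < \<eta> / 2" using assms(1)[OF x(1)] by blast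
  have "dist s t \<le> dist x s + dist x t" by (rule dist_triangle3)
  then show ?thesis using x t by (intro bexI[of _ t]) auto
qed

text \<open>All offsets with positive weight belong to the unit ball around \<open>0\<close>.\<close>
lemma hopping_weights_wiener:
  fixes A :: "('g::ab_group_add, 'y::complex_normed_space) ell2 \<Rightarrow>\<^sub>L ('g, 'y) ell2"
  assumes rep: "wiener_rep p A b" and growth: "subexponential_growth (wiener_graph p b)"
  shows "hopping_weights b"
proof
  have lin: "b j \<in> linf" for j using rep by (simp add: wiener_rep_def)
  show nonneg: "0 \<le> beta b j" for j
    using norm_inf_nonneg[OF lin[of j]] norm_inf_nonneg[OF lin[of "- j"]] by (simp add: beta_def)
  have "{j. j \<noteq> 0 \<and> 0 < beta b j} \<subseteq> graph_ball (wiener_graph p b) 0 (Suc 0)"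
  proof
    fix j assume "j \<in> {j. j \<noteq> 0 \<and> 0 < beta b j}"
    then have "0 < wiener_graph p b 0 j"
      by (simp add: wiener_graph_def beta_def add.commute)
    then show "j \<in> graph_ball (wiener_graph p b) 0 (Suc 0)"
      by (rule graph_ball_step[OF graph_ball_self])
  qed
  then show "finite {j. j \<noteq> 0 \<and> 0 < beta b j}"
    by (rule finite_subset) (use growth in \<open>simp add: subexponential_growth_def\<close>)
qed

lemma pseudo_eigenvector_nonzero:
  assumes "pseudo_eigenvalue S B z e"
  shows "\<exists>x\<in>S. x \<noteq> 0"
proof -
  obtain x where x: "x \<in> S" "norm (B x - z *\<^sub>C x) < e * norm x"
    using assms by (auto simp: pseudo_eigenvalue_def)
  have "x \<noteq> 0" using x(2) by auto
  with x(1) show ?thesis by blast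
qed

lemma patch_eq_compression: "patch A W k n = compression (patch_set W k n) A"
  by (simp add: patch_def compression_def)

theorem corollary5p18:
  fixes A :: "('g::{ab_group_add, countable}, 'y::complex_hilbert_space) ell2 \<Rightarrow>\<^sub>L ('g, 'y) ell2"
    and b :: "'g \<Rightarrow> 'g \<Rightarrow> ('y \<Rightarrow>\<^sub>L 'y)"
    and W :: "nat \<Rightarrow> 'g set"
    and p \<epsilon> :: real
  assumes "0 \<le> p" and "p \<le> 1"
    and "wiener_rep p A b"
    and "subexponential_growth (wiener_graph p b)"
    and "graph_connected (wiener_graph p b)"
    and "\<epsilon> > 0"
    and "\<And>n. finite (W n)" and "\<And>n. W n \<noteq> {}"
    and "\<And>n. W n \<subseteq> W (Suc n)"
    and "(\<Union>n. W n) = UNIV"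
    and "no_spectral_pollution A W"
  shows "hausdorff_converges
      (\<lambda>n. \<Union>k. spec_open (\<epsilon> + penalty p b (W n)) (patch_set W k n) (patch A W k n))
      (Spec_closed \<epsilon> UNIV A)
    \<and> hausdorff_converges
      (\<lambda>n. closure (\<Union>k. Spec_closed (\<epsilon> + penalty p b (W n)) (patch_set W k n) (patch A W k n)))
      (Spec_closed \<epsilon> UNIV A)"
proof -
  have weights: "hopping_weights b" by (rule hopping_weights_wiener[OF assms(3,4)])
  interpret hopping_weights p b by (rule weights)
  define pen where "pen n = penalty p b (W n)" for n
  define T where "T = Spec_closed \<epsilon> UNIV A"
  define U where "U n = (\<Union>k. spec_open (\<epsilon> + pen n) (patch_set W k n) (patch A W k n))" for n
  define P where "P e n = (\<Union>k. Spec_closed e (patch_set W k n) (patch A W k n))" for e n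
  have pen: "pen \<longlonglongrightarrow> 0" "0 \<le> pen n" for n
    unfolding pen_def using penalty_tendsto_0[OF assms(4,7-10)] penalty_nonneg assms(7,8) by blast+
  obtain A' where adj: "adjoint_pair A A'"
    and loc: "\<And>W z e. finite W \<Longrightarrow> W \<noteq> {} \<Longrightarrow> pseudo_eigenvalue UNIV A z e \<Longrightarrow>
      \<exists>k. pseudo_eigenvalue (ell2_on ((\<lambda>w. k + w) ` W)) A z (e + penalty p b W)"
    and loc': "\<And>W z e. finite W \<Longrightarrow> W \<noteq> {} \<Longrightarrow> pseudo_eigenvalue UNIV A' z e \<Longrightarrow>
      \<exists>k. pseudo_eigenvalue (ell2_on ((\<lambda>w. k + w) ` W)) A' z (e + penalty p b W)"
    using wiener_localization[OF assms(3) weights] by blast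
  interpret A: hilbert_operator "ell2_on UNIV" A A'
    by unfold_locales (auto simp: ell2_on_UNIV cvec.subspace_UNIV adj)
  have patch: "hilbert_operator (ell2_on (patch_set W k n)) (patch A W k n) (patch A' W k n)" for k n
    unfolding patch_eq_compression
    by unfold_locales (auto intro: subspace_ell2_on closed_ell2_on adjoint_pair_compression[OF adj]
        compression_in)
  note spec_A = spec_open_eq_pseudospectrum[OF A.hilbert_operator_axioms]
  note spec_patch = spec_open_eq_pseudospectrum[OF patch]
  \<comment> \<open>Localisation for \<open>A\<close> and for its adjoint covers both lower norms in \<open>\<mu>\<close>.\<close>
  have inner: "spec_open \<epsilon> UNIV A \<subseteq> U n" for n
  proof
    fix z assume "z \<in> spec_open \<epsilon> UNIV A"
    then have "pseudo_eigenvalue UNIV A z \<epsilon> \<or> pseudo_eigenvalue UNIV A' (cnj z) \<epsilon>"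
      unfolding spec_A A.pseudospectrum_def by (simp add: ell2_on_UNIV)
    then obtain k where "pseudo_eigenvalue (ell2_on (patch_set W k n)) A z (\<epsilon> + pen n) \<or>
        pseudo_eigenvalue (ell2_on (patch_set W k n)) A' (cnj z) (\<epsilon> + pen n)"
      using loc[OF assms(7,8)] loc'[OF assms(7,8)] unfolding patch_set_def pen_def by blast
    then have "z \<in> spec_open (\<epsilon> + pen n) (patch_set W k n) (patch A W k n)"
      unfolding spec_patch hilbert_operator.pseudospectrum_def[OF patch]
      using pseudo_eigenvalue_compression unfolding patch_eq_compression by blast
    then show "z \<in> U n" by (auto simp: U_def)
  qed
  have "T \<subseteq> closure (spec_open \<epsilon> UNIV A)"
  proof
    fix z assume "z \<in> T"
    then have "z \<in> A.pseudospectrum d" if "\<epsilon> < d" for d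
      using that assms(6) by (simp add: T_def Spec_closed_eq_Inter spec_A)
    then show "z \<in> closure (spec_open \<epsilon> UNIV A)"
      unfolding spec_A by (rule A.closed_pseudospectrum_subset_closure[OF assms(6)])
  qed
  then have T_sub: "T \<subseteq> closure (U n)" for n using closure_mono[OF inner] by blast
  have U_sub: "U n \<subseteq> P (\<epsilon> + pen n) n" for n
    unfolding U_def P_def using spec_open_subset_Spec_closed by blast
  define C where "C = max (norm A) (norm A')"
  have near: "\<forall>\<^sub>F n in sequentially. \<forall>s\<in>P (\<epsilon> + pen n) n. \<exists>t\<in>T. dist s t < \<eta>" if "0 < \<eta>" for \<eta>
  proof (rule eventually_near_no_pollution[where C = C and Q = "\<lambda>d. Spec_closed d UNIV A"])
    show "P d n \<subseteq> P e n" if "d \<le> e" for d e n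
      unfolding P_def using Spec_closed_mono[OF that] by blast
    have P_iff: "z \<in> P e n \<longleftrightarrow> (\<exists>k. \<forall>d>e. z \<in> spec_open d (patch_set W k n) (patch A W k n))"
      if "0 \<le> e" for z e n
      using that by (auto simp: P_def Spec_closed_eq_Inter)
    show "cmod z \<le> C + e" if z: "0 \<le> e" "z \<in> P e n" for e n z
    proof (rule field_le_epsilon)
      fix \<delta> :: real assume "0 < \<delta>"
      then obtain k where "z \<in> spec_open (e + \<delta>) (patch_set W k n) (patch A W k n)"
        using z(2) unfolding P_iff[OF z(1)] by force
      then have "cmod z \<le> C + (e + \<delta>)"
        unfolding spec_patch by (rule hilbert_operator.pseudospectrum_bounded[OF patch])
          (auto simp: patch_eq_compression C_def intro: norm_compression_le order_trans[OF norm_compression_le])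
      then show "cmod z \<le> C + e + \<delta>" by simp
    qed
    show "P d n \<noteq> {}" if de: "0 < d" "0 \<le> e" "P e m \<noteq> {}" for d n m e
    proof -
      obtain z k where "z \<in> spec_open (e + 1) (patch_set W k m) (patch A W k m)"
        using de(3) P_iff[OF de(2), of _ m] less_add_one[of e] by blast
      then have "pseudo_eigenvalue (ell2_on (patch_set W k m)) (patch A W k m) z (e + 1) \<or>
          pseudo_eigenvalue (ell2_on (patch_set W k m)) (patch A' W k m) (cnj z) (e + 1)"
        unfolding spec_patch hilbert_operator.pseudospectrum_def[OF patch] by simp
      then have "\<exists>x\<in>ell2_on (patch_set W k m) :: ('g, 'y) ell2 set. x \<noteq> 0"
        using pseudo_eigenvector_nonzero[of _ "patch A W k m"] pseudo_eigenvector_nonzero[of _ "patch A' W k m"]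
        by meson
      then obtain x :: "('g, 'y) ell2" where "x \<noteq> 0" by blast
      then obtain i where "ell2_nth x i \<noteq> 0" by (metis ell2_eqI ell2_nth_simps(1))
      then obtain y :: 'y where y: "y \<noteq> 0" by blast
      obtain w where w: "w \<in> W n" using assms(8) by blast
      \<comment> \<open>One non-empty patch pseudospectrum shows that \<open>Y\<close> is not trivial, and then neither is the
        space of any other patch.\<close>
      define x0 where "x0 = Abs_ell2 (\<lambda>i. if i = w then y else 0)"
      have x0: "ell2_nth x0 i = (if i = w then y else 0)" for i
        unfolding x0_def by (subst ell2_nth_Abs, rule square_summable_finite_support[of "{w}"]) auto
      have "x0 \<in> ell2_on (patch_set W 0 n)" using w by (auto simp: ell2_on_def x0 patch_set_def)
      moreover have "x0 \<noteq> 0" using x0[of w] y by auto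
      ultimately have "spec_open d (patch_set W 0 n) (patch A W 0 n) \<noteq> {}"
        unfolding spec_patch using hilbert_operator.pseudospectrum_nonempty[OF patch _ _ de(1)] by blast
      then show ?thesis unfolding P_def using spec_open_subset_Spec_closed by blast
    qed
    show "set_limsup (P d) \<subseteq> Spec_closed d UNIV A" if "0 < d" for d
      using assms(11) that unfolding no_spectral_pollution_def P_def by blast
    show "(\<Inter>d\<in>{\<epsilon><..}. Spec_closed d UNIV A) \<subseteq> T"
    proof
      fix z assume z: "z \<in> (\<Inter>d\<in>{\<epsilon><..}. Spec_closed d UNIV A)"
      have "z \<in> spec_open d UNIV A" if d: "\<epsilon> < d" for d
      proof -
        obtain c where c: "\<epsilon> < c" "c < d" using dense[OF d] by blast
        have "0 \<le> c" using c(1) assms(6) by simp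
        have "z \<in> Spec_closed c UNIV A" using z c(1) by blast
        then show ?thesis unfolding Spec_closed_eq_Inter[OF \<open>0 \<le> c\<close>] using c(2) by blast
      qed
      then show "z \<in> T" unfolding T_def Spec_closed_eq_Inter[OF less_imp_le[OF assms(6)]] by blast
    qed
  qed (use assms(6) pen that in auto)
  have "hausdorff_converges U T"
  proof (rule hausdorff_convergesI[OF T_sub])
    show "\<forall>\<^sub>F n in sequentially. \<forall>s\<in>U n. \<exists>t\<in>T. dist s t < \<eta>" if "0 < \<eta>" for \<eta>
      using near[OF that] by eventually_elim (use U_sub in blast)
  qed
  moreover have "hausdorff_converges (\<lambda>n. closure (P (\<epsilon> + pen n) n)) T"
  proof (rule hausdorff_convergesI)
    show "T \<subseteq> closure (closure (P (\<epsilon> + pen n) n))" for n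
      using T_sub closure_mono[OF U_sub] by (metis closure_closure order_trans)
    show "\<forall>\<^sub>F n in sequentially. \<forall>s\<in>closure (P (\<epsilon> + pen n) n). \<exists>t\<in>T. dist s t < \<eta>" if "0 < \<eta>" for \<eta>
      using near[OF half_gt_zero[OF that]] by eventually_elim (use near_closure that in blast)
  qed
  ultimately show ?thesis unfolding U_def P_def T_def pen_def by simp
qed

end
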